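(* Let $k\geq 1$. There is a picture language definable by a $\Sigma^{\mathrm{mon}}_1(\mathrm{FO}(\Sigma^{\mathrm{mon}}_1))$-formula but not by an $\mathrm{FO}(\Sigma^{\mathrm{mon}}_k)$-formula.
   Context: **Pictures.** A (non-empty) picture of size $(m,n)$, $m,n\ge1$, over a finite alphabet $\Gamma$ is an $m\times n$-matrix over $\Gamma$; $\mathrm{dom}(p)=\{1,\dots,m\}\times\{1,\dots,n\}$, and $p\langle i,j\rangle$ is the entry in row $i$, column $j$. A picture language is a set of non-empty pictures. Alphabets are of the form $\{0,1\}^J$ for a finite set $J$ of attributes ($\{0,1\}^\emptyset$ is a singleton alphabet). **Logic.** Formulas use first-order variables $x_\nu$ and set variables $X_\mu$, atomic formulas $X_\mu x_\nu$, $S_1x_\mu x_\nu$, $S_2x_\mu x_\nu$, $x_\mu=x_\nu$, Boolean connectives, and first-order and set quantification. A picture $p$ over $\{0,1\}^J$ gives the structure with universe $\mathrm{dom}(p)$, $S_1$ the vertical successor relation ($(i,j)\mapsto(i+1,j)$), $S_2$ the horizontal successor relation ($(i,j)\mapsto(i,j+1)$), and $X_\mu$ (for $\mu\in J$) interpreted as $\{(i,j):p\langle i,j\rangle(\mu)=1\}$. A formula $\varphi$ without free first-order variables and with free set variables among $(X_\mu)_{\mu\in J}$ defines the language of all non-empty pictures $p$ over $\{0,1\}^J$ with $p\models\varphi$. Two formulas are equivalent iff they are satisfied by the same pictures-with-assignments. **Formula classes.** $\mathrm{FO}$ is the class of formulas without set quantifiers. For a formula class $\mathcal F$: $\mathrm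 B(\mathcal F)$ is the closure of $\mathcal F$ under Boolean combinations; $\Sigma^{\mathrm{mon}}_1(\mathcal F)$ is the closure of $\mathcal F$ under existential set quantification and positive Boolean combinations; $\mathrm{FO}(\mathcal F)$ is the closure of $\mathcal F$ under first-order quantifications and Boolean combinations. $\Sigma^{\mathrm{mon}}_0(\mathcal F)=\mathcal F$, $\Sigma^{\mathrm{mon}}_{k+1}(\mathcal F)=\Sigma^{\mathrm{mon}}_1(\mathrm B(\Sigma^{\mathrm{mon}}_k(\mathcal F)))$, and $\Sigma^{\mathrm{mon}}_k=\Sigma^{\mathrm{mon}}_k(\mathrm{FO})$. Formulas equivalent to a formula in $\mathcal F$ are also counted as $\mathcal F$-formulas. *)

theory Defs
  imports "Jordan_Normal_Form.Matrix" "HOL-Library.FuncSet"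
begin

section \<open>Pictures\<close>

text \<open>A letter of \<open>{0,1}\<^sup>J\<close> is an extensional function on \<open>J\<close>; attributes are natural numbers.\<close>

definition alphabet :: "nat set \<Rightarrow> (nat \<Rightarrow> nat) set" where
  "alphabet J = J \<rightarrow>\<^sub>E {0, 1}"

definition pictures :: "'a set \<Rightarrow> 'a mat set" where
  "pictures \<Gamma> = {p. dim_row p \<ge> 1 \<and> dim_col p \<ge> 1 \<and> elements_mat p \<subseteq> \<Gamma>}"

definition grid :: "nat \<Rightarrow> nat \<Rightarrow> (nat \<times> nat) set" where
  "grid m n = {1..m} \<times> {1..n}"

definition pic_dom :: "'a mat \<Rightarrow> (nat \<times> nat) set" where
  "pic_dom p = grid (dim_row p) (dim_col p)"

text \<open>Picture positions are counted from 1, matrix indices from 0.\<close>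

definition entry :: "'a mat \<Rightarrow> nat \<Rightarrow> nat \<Rightarrow> 'a" where
  "entry p i j = p $$ (i - 1, j - 1)"

definition attr_set :: "(nat \<Rightarrow> nat) mat \<Rightarrow> nat \<Rightarrow> (nat \<times> nat) set" where
  "attr_set p \<mu> = {(i, j) \<in> pic_dom p. entry p i j \<mu> = 1}"

section \<open>Monadic second-order formulas\<close>

text \<open>First-order variables and set variables are two separate families, each indexed by \<open>nat\<close>.
  In \<open>In \<mu> \<nu>\<close>, which stands for \<open>X\<^sub>\<mu> x\<^sub>\<nu>\<close>, the set variable comes first.\<close>

datatype fm =
    In nat nat
  | Succ1 nat nat
  | Succ2 nat nat
  | Eq nat nat
  | Neg fm
  | Conj fm fm
  | Disj fm fm
  | Ex1 nat fm
  | All1 nat fm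
  | ExS nat fm
  | AllS nat fm

primrec sat :: "(nat \<times> nat) set \<Rightarrow> (nat \<Rightarrow> nat \<times> nat) \<Rightarrow> (nat \<Rightarrow> (nat \<times> nat) set) \<Rightarrow> fm \<Rightarrow> bool" where
  "sat D e E (In \<mu> \<nu>) \<longleftrightarrow> e \<nu> \<in> E \<mu>"
| "sat D e E (Succ1 x y) \<longleftrightarrow> e y = (fst (e x) + 1, snd (e x))"
| "sat D e E (Succ2 x y) \<longleftrightarrow> e y = (fst (e x), snd (e x) + 1)"
| "sat D e E (Eq x y) \<longleftrightarrow> e x = e y"
| "sat D e E (Neg \<phi>) \<longleftrightarrow> \<not> sat D e E \<phi>"
| "sat D e E (Conj \<phi> \<psi>) \<longleftrightarrow> sat D e E \<phi> \<and> sat D e E \<psi>"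
| "sat D e E (Disj \<phi> \<psi>) \<longleftrightarrow> sat D e E \<phi> \<or> sat D e E \<psi>"
| "sat D e E (Ex1 x \<phi>) \<longleftrightarrow> (\<exists>a\<in>D. sat D (e(x := a)) E \<phi>)"
| "sat D e E (All1 x \<phi>) \<longleftrightarrow> (\<forall>a\<in>D. sat D (e(x := a)) E \<phi>)"
| "sat D e E (ExS \<mu> \<phi>) \<longleftrightarrow> (\<exists>A\<subseteq>D. sat D e (E(\<mu> := A)) \<phi>)"
| "sat D e E (AllS \<mu> \<phi>) \<longleftrightarrow> (\<forall>A\<subseteq>D. sat D e (E(\<mu> := A)) \<phi>)"

primrec free_fo :: "fm \<Rightarrow> nat set" where
  "free_fo (In \<mu> \<nu>) = {\<nu>}"
| "free_fo (Succ1 x y) = {x, y}"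
| "free_fo (Succ2 x y) = {x, y}"
| "free_fo (Eq x y) = {x, y}"
| "free_fo (Neg \<phi>) = free_fo \<phi>"
| "free_fo (Conj \<phi> \<psi>) = free_fo \<phi> \<union> free_fo \<psi>"
| "free_fo (Disj \<phi> \<psi>) = free_fo \<phi> \<union> free_fo \<psi>"
| "free_fo (Ex1 x \<phi>) = free_fo \<phi> - {x}"
| "free_fo (All1 x \<phi>) = free_fo \<phi> - {x}"
| "free_fo (ExS \<mu> \<phi>) = free_fo \<phi>"
| "free_fo (AllS \<mu> \<phi>) = free_fo \<phi>"

primrec free_set :: "fm \<Rightarrow> nat set" where
  "free_set (In \<mu> \<nu>) = {\<mu>}"
| "free_set (Succ1 x y) = {}"
| "free_set (Succ2 x y) = {}"
| "free_set (Eq x y) = {}"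
| "free_set (Neg \<phi>) = free_set \<phi>"
| "free_set (Conj \<phi> \<psi>) = free_set \<phi> \<union> free_set \<psi>"
| "free_set (Disj \<phi> \<psi>) = free_set \<phi> \<union> free_set \<psi>"
| "free_set (Ex1 x \<phi>) = free_set \<phi>"
| "free_set (All1 x \<phi>) = free_set \<phi>"
| "free_set (ExS \<mu> \<phi>) = free_set \<phi> - {\<mu>}"
| "free_set (AllS \<mu> \<phi>) = free_set \<phi> - {\<mu>}"

definition assignment :: "(nat \<times> nat) set \<Rightarrow> (nat \<Rightarrow> nat \<times> nat) \<Rightarrow> (nat \<Rightarrow> (nat \<times> nat) set) \<Rightarrow> bool" where
  "assignment D e E \<longleftrightarrow> (\<forall>\<nu>. e \<nu> \<in> D) \<and> (\<forall>\<mu>. E \<mu> \<subseteq> D)"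

text \<open>A picture over \<open>{0,1}\<^sup>J\<close> together with values for the first-order variables and for the set
  variables outside \<open>J\<close> amounts to a size together with values for all variables.\<close>

definition equivalent :: "fm \<Rightarrow> fm \<Rightarrow> bool" where
  "equivalent \<phi> \<psi> \<longleftrightarrow>
     (\<forall>m\<ge>1. \<forall>n\<ge>1. \<forall>e E. assignment (grid m n) e E \<longrightarrow>
        (sat (grid m n) e E \<phi> \<longleftrightarrow> sat (grid m n) e E \<psi>))"

text \<open>Variables that are neither free in \<open>\<phi>\<close> nor in \<open>J\<close> are irrelevant, so the universal
  quantification over their values is harmless.\<close>

definition language :: "nat set \<Rightarrow> fm \<Rightarrow> (nat \<Rightarrow> nat) mat set" where
  "language J \<phi> =
     {p \<in> pictures (alphabet J).
        \<forall>e E. assignment (pic_dom p) e E \<and> (\<forall>\<mu>\<in>J. E \<mu> = attr_set p \<mu>) \<longrightarrow> sat (pic_dom p) e E \<phi>}"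

section \<open>Formula classes\<close>

primrec set_quantifier_free :: "fm \<Rightarrow> bool" where
  "set_quantifier_free (In \<mu> \<nu>) \<longleftrightarrow> True"
| "set_quantifier_free (Succ1 x y) \<longleftrightarrow> True"
| "set_quantifier_free (Succ2 x y) \<longleftrightarrow> True"
| "set_quantifier_free (Eq x y) \<longleftrightarrow> True"
| "set_quantifier_free (Neg \<phi>) \<longleftrightarrow> set_quantifier_free \<phi>"
| "set_quantifier_free (Conj \<phi> \<psi>) \<longleftrightarrow> set_quantifier_free \<phi> \<and> set_quantifier_free \<psi>"
| "set_quantifier_free (Disj \<phi> \<psi>) \<longleftrightarrow> set_quantifier_free \<phi> \<and> set_quantifier_free \<psi>"
| "set_quantifier_free (Ex1 x \<phi>) \<longleftrightarrow> set_quantifier_free \<phi>"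
| "set_quantifier_free (All1 x \<phi>) \<longleftrightarrow> set_quantifier_free \<phi>"
| "set_quantifier_free (ExS \<mu> \<phi>) \<longleftrightarrow> False"
| "set_quantifier_free (AllS \<mu> \<phi>) \<longleftrightarrow> False"

definition FO :: "fm set" where
  "FO = {\<phi>. set_quantifier_free \<phi>}"

inductive_set Bool_closure :: "fm set \<Rightarrow> fm set" for F :: "fm set" where
  base: "\<phi> \<in> F \<Longrightarrow> \<phi> \<in> Bool_closure F"
| neg: "\<phi> \<in> Bool_closure F \<Longrightarrow> Neg \<phi> \<in> Bool_closure F"
| conj: "\<phi> \<in> Bool_closure F \<Longrightarrow> \<psi> \<in> Bool_closure F \<Longrightarrow> Conj \<phi> \<psi> \<in> Bool_closure F"
| disj: "\<phi> \<in> Bool_closure F \<Longrightarrow> \<psi> \<in> Bool_closure F \<Longrightarrow> Disj \<phi> \<psi> \<in> Bool_closure F"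

inductive_set Sigma1_closure :: "fm set \<Rightarrow> fm set" for F :: "fm set" where
  base: "\<phi> \<in> F \<Longrightarrow> \<phi> \<in> Sigma1_closure F"
| conj: "\<phi> \<in> Sigma1_closure F \<Longrightarrow> \<psi> \<in> Sigma1_closure F \<Longrightarrow> Conj \<phi> \<psi> \<in> Sigma1_closure F"
| disj: "\<phi> \<in> Sigma1_closure F \<Longrightarrow> \<psi> \<in> Sigma1_closure F \<Longrightarrow> Disj \<phi> \<psi> \<in> Sigma1_closure F"
| exS: "\<phi> \<in> Sigma1_closure F \<Longrightarrow> ExS \<mu> \<phi> \<in> Sigma1_closure F"

inductive_set FO_closure :: "fm set \<Rightarrow> fm set" for F :: "fm set" where
  base: "\<phi> \<in> F \<Longrightarrow> \<phi> \<in> FO_closure F"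
| neg: "\<phi> \<in> FO_closure F \<Longrightarrow> Neg \<phi> \<in> FO_closure F"
| conj: "\<phi> \<in> FO_closure F \<Longrightarrow> \<psi> \<in> FO_closure F \<Longrightarrow> Conj \<phi> \<psi> \<in> FO_closure F"
| disj: "\<phi> \<in> FO_closure F \<Longrightarrow> \<psi> \<in> FO_closure F \<Longrightarrow> Disj \<phi> \<psi> \<in> FO_closure F"
| ex1: "\<phi> \<in> FO_closure F \<Longrightarrow> Ex1 x \<phi> \<in> FO_closure F"
| all1: "\<phi> \<in> FO_closure F \<Longrightarrow> All1 x \<phi> \<in> FO_closure F"

primrec Sigma_over :: "nat \<Rightarrow> fm set \<Rightarrow> fm set" where
  "Sigma_over 0 F = F"
| "Sigma_over (Suc k) F = Sigma1_closure (Bool_closure (Sigma_over k F))"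

definition Sigma_mon :: "nat \<Rightarrow> fm set" where
  "Sigma_mon k = Sigma_over k FO"

definition upto_equiv :: "fm set \<Rightarrow> fm set" where
  "upto_equiv F = {\<phi>. \<exists>\<psi>\<in>F. equivalent \<phi> \<psi>}"

text \<open>Formulas equivalent to one in \<open>F\<close> count as \<open>F\<close>-formulas. Closing the outermost class under
  equivalence suffices: equivalence is a congruence, so closing the intermediate classes as well
  adds nothing, as the lemmas below show.\<close>

definition definable :: "nat set \<Rightarrow> fm set \<Rightarrow> (nat \<Rightarrow> nat) mat set \<Rightarrow> bool" where
  "definable J F L \<longleftrightarrow>
     (\<exists>\<phi>\<in>upto_equiv F. free_fo \<phi> = {} \<and> free_set \<phi> \<subseteq> J \<and> L = language J \<phi>)"

lemma equivalent_cong: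
  assumes "equivalent \<phi> \<phi>'"
  shows "equivalent (Neg \<phi>) (Neg \<phi>')"
    and "equivalent \<psi> \<psi>' \<Longrightarrow> equivalent (Conj \<phi> \<psi>) (Conj \<phi>' \<psi>')"
    and "equivalent \<psi> \<psi>' \<Longrightarrow> equivalent (Disj \<phi> \<psi>) (Disj \<phi>' \<psi>')"
    and "equivalent (Ex1 x \<phi>) (Ex1 x \<phi>')"
    and "equivalent (All1 x \<phi>) (All1 x \<phi>')"
    and "equivalent (ExS \<mu> \<phi>) (ExS \<mu> \<phi>')"
proof -
  have e: "assignment D (e(x := a)) E" if "assignment D e E" "a \<in> D" for D e E x a
    using that by (auto simp: assignment_def)
  have E: "assignment D e (E(\<mu> := A))" if "assignment D e E" "A \<subseteq> D" for D e E \<mu> A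
    using that by (auto simp: assignment_def)
  show "equivalent (Neg \<phi>) (Neg \<phi>')"
    and "equivalent \<psi> \<psi>' \<Longrightarrow> equivalent (Conj \<phi> \<psi>) (Conj \<phi>' \<psi>')"
    and "equivalent \<psi> \<psi>' \<Longrightarrow> equivalent (Disj \<phi> \<psi>) (Disj \<phi>' \<psi>')"
    and "equivalent (Ex1 x \<phi>) (Ex1 x \<phi>')"
    and "equivalent (All1 x \<phi>) (All1 x \<phi>')"
    and "equivalent (ExS \<mu> \<phi>) (ExS \<mu> \<phi>')"
    using assms by (simp_all add: equivalent_def e E cong: bex_cong ball_cong conj_cong)
qed

lemma upto_equiv_base: "\<phi> \<in> upto_equiv F \<Longrightarrow> F \<subseteq> G \<Longrightarrow> \<phi> \<in> upto_equiv G"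
  by (auto simp: upto_equiv_def)

lemma Bool_closure_upto_equiv: "Bool_closure (upto_equiv F) \<subseteq> upto_equiv (Bool_closure F)"
proof
  fix \<phi> assume "\<phi> \<in> Bool_closure (upto_equiv F)"
  then show "\<phi> \<in> upto_equiv (Bool_closure F)"
    by induction (auto intro: upto_equiv_base Bool_closure.base, 
      (fastforce simp: upto_equiv_def intro: Bool_closure.intros equivalent_cong)+)
qed

lemma Sigma1_closure_upto_equiv: "Sigma1_closure (upto_equiv F) \<subseteq> upto_equiv (Sigma1_closure F)"
proof
  fix \<phi> assume "\<phi> \<in> Sigma1_closure (upto_equiv F)"
  then show "\<phi> \<in> upto_equiv (Sigma1_closure F)"
    by induction (auto intro: upto_equiv_base Sigma1_closure.base, 
      (fastforce simp: upto_equiv_def intro: Sigma1_closure.intros equivalent_cong)+)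
qed

lemma FO_closure_upto_equiv: "FO_closure (upto_equiv F) \<subseteq> upto_equiv (FO_closure F)"
proof
  fix \<phi> assume "\<phi> \<in> FO_closure (upto_equiv F)"
  then show "\<phi> \<in> upto_equiv (FO_closure F)"
    by induction (auto intro: upto_equiv_base FO_closure.base, 
      (fastforce simp: upto_equiv_def intro: FO_closure.intros equivalent_cong)+)
qed

end

theory Submission
  imports Defs "HOL-Library.Product_Plus"
begin

text \<open>The separating language consists of unlabelled grids. A picture of height \<open>m\<close> is a word whose
  letters are its columns. By Hanf locality, the words of height \<open>m\<close> that satisfy a first-order
  formula have a syntactic congruence of index \<open>2 ^ O(m)\<close>, and each \<open>\<Sigma>\<^sub>1\<close>-step raises the index
  by one exponential. On unlabelled grids of height \<open>m\<close>, first-order quantifiers on top of this neither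
  change the period of the set of accepted widths nor raise the threshold by more than a constant
  factor. So an \<open>FO(\<Sigma>\<^sub>k)\<close>-formula accepts widths that are periodic from a \<open>(k + 1)\<close>-fold exponential
  in \<open>O(m)\<close> on.

  On the other hand, guess bits and nested segmentations of the columns up to level \<open>K\<close>. The content
  of a segment of level \<open>l + 1\<close> is the set of contents of its subsegments together with their bits,
  so that equality of contents is in \<open>FO(\<Sigma>\<^sub>1)\<close> for every level. If subsegments of the same segment
  always have different contents, then the width is bounded in terms of \<open>m\<close>; and a width that is a
  \<open>(K + 1)\<close>-fold exponential in \<open>m\<close> is possible, by letting the contents run through all values.
  Such a bounded set of widths is not periodic from any point below its maximum on.\<close>

section \<open>Pictures as words of columns\<close>

text \<open>Both halves are shaped by what one quantifier costs. A first-order quantifier is a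
  projection just like a set quantifier, so carrying the index through \<open>FO_closure\<close>
  would cost exponentials for its unboundedly many alternations. Hence the index is given up beyond
  the outermost set quantifier and only the pumping of blank columns is kept: a first-order variable
  occupies a single column, so one side of a long blank block stays long and untouched. For the
  other half, segments must be described without climbing the hierarchy. Two cells share a segment
  unless some set separates them, which takes one negated set quantifier; comparing contents then
  needs only first-order quantifiers over representatives. The formula does not describe a counter:
  it asks only that contents differ, which bounds the width for every guess, and a counter is merely
  one admissible guess of large width. The number of levels, \<open>Suc k\<close>, yields a width of
  at least \<open>tower k (2 ^ m)\<close>, and \<open>2 ^ m\<close> outgrows every
  \<open>c * m\<close>, where \<open>c\<close> depends on the formula to be refuted.\<close>

lemma sat_cong:
  assumes "\<And>x. x \<in> free_fo \<phi> \<Longrightarrow> e x = e' x" "\<And>\<mu>. \<mu> \<in> free_set \<phi> \<Longrightarrow> E \<mu> = E' \<mu>"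
  shows "sat D e E \<phi> = sat D e' E' \<phi>"
  using assms
proof (induction \<phi> arbitrary: e e' E E')
  case (Neg \<phi>)
  have "sat D e E \<phi> = sat D e' E' \<phi>" by (rule Neg.IH) (use Neg.prems in auto)
  then show ?case by simp
next
  case (Conj \<phi>1 \<phi>2)
  have "sat D e E \<phi>1 = sat D e' E' \<phi>1" by (rule Conj.IH) (use Conj.prems in auto)
  moreover have "sat D e E \<phi>2 = sat D e' E' \<phi>2" by (rule Conj.IH) (use Conj.prems in auto)
  ultimately show ?case by simp
next
  case (Disj \<phi>1 \<phi>2)
  have "sat D e E \<phi>1 = sat D e' E' \<phi>1" by (rule Disj.IH) (use Disj.prems in auto)
  moreover have "sat D e E \<phi>2 = sat D e' E' \<phi>2" by (rule Disj.IH) (use Disj.prems in auto)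
  ultimately show ?case by simp
next
  case (Ex1 x \<phi>)
  have "sat D (e(x := a)) E \<phi> = sat D (e'(x := a)) E' \<phi>" for a
    by (rule Ex1.IH) (use Ex1.prems in auto)
  then show ?case by simp
next
  case (All1 x \<phi>)
  have "sat D (e(x := a)) E \<phi> = sat D (e'(x := a)) E' \<phi>" for a
    by (rule All1.IH) (use All1.prems in auto)
  then show ?case by simp
next
  case (ExS \<mu> \<phi>)
  have "sat D e (E(\<mu> := A)) \<phi> = sat D e' (E'(\<mu> := A)) \<phi>" for A
    by (rule ExS.IH) (use ExS.prems in auto)
  then show ?case by simp
next
  case (AllS \<mu> \<phi>)
  have "sat D e (E(\<mu> := A)) \<phi> = sat D e' (E'(\<mu> := A)) \<phi>" for A
    by (rule AllS.IH) (use AllS.prems in auto)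
  then show ?case by simp
qed auto

text \<open>A column of height \<open>m\<close>: \<open>l (Inl x)\<close> is the set of rows in which it carries the value of the
  first-order variable \<open>x\<close>, and \<open>l (Inr \<mu>)\<close> the set of rows in which it meets the set variable \<open>\<mu>\<close>.\<close>

type_synonym letter = "nat + nat \<Rightarrow> nat set"

definition blank :: letter where
  "blank = (\<lambda>_. {})"

definition pebbles :: "nat \<Rightarrow> letter list \<Rightarrow> nat" where
  "pebbles x w = sum_list (map (\<lambda>l. card (l (Inl x))) w)"

definition valid :: "nat \<Rightarrow> letter list set" where
  "valid m = {w. (\<forall>l\<in>set w. \<forall>\<kappa>. l \<kappa> \<subseteq> {1..m}) \<and> (\<forall>x. pebbles x w = 1)}"

definition enc :: "nat \<Rightarrow> (nat \<Rightarrow> nat \<times> nat) \<Rightarrow> (nat \<Rightarrow> (nat \<times> nat) set) \<Rightarrow> letter list" where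
  "enc n e E = map (\<lambda>j \<kappa>. case \<kappa> of Inl x \<Rightarrow> {i. e x = (i, j)} | Inr \<mu> \<Rightarrow> {i. (i, j) \<in> E \<mu>}) [1..<Suc n]"

definition dec_fo :: "letter list \<Rightarrow> nat \<Rightarrow> nat \<times> nat" where
  "dec_fo w x = (THE q. \<exists>i j. q = (i, Suc j) \<and> j < length w \<and> i \<in> (w ! j) (Inl x))"

definition dec_set :: "letter list \<Rightarrow> nat \<Rightarrow> (nat \<times> nat) set" where
  "dec_set w \<mu> = {(i, Suc j) | i j. j < length w \<and> i \<in> (w ! j) (Inr \<mu>)}"

lemma length_enc [simp]: "length (enc n e E) = n"
  by (simp add: enc_def)

lemma nth_enc: "j < n \<Longrightarrow> enc n e E ! j =
    (\<lambda>\<kappa>. case \<kappa> of Inl x \<Rightarrow> {i. e x = (i, Suc j)} | Inr \<mu> \<Rightarrow> {i. (i, Suc j) \<in> E \<mu>})"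
  by (simp add: enc_def del: upt_Suc)

lemma pebbles_append [simp]: "pebbles x (u @ v) = pebbles x u + pebbles x v"
  and pebbles_Cons [simp]: "pebbles x (l # u) = card (l (Inl x)) + pebbles x u"
  and pebbles_Nil [simp]: "pebbles x [] = 0"
  by (simp_all add: pebbles_def)

lemma pebbles_blank [simp]: "pebbles x (replicate g blank) = 0"
  by (induction g) (auto simp: blank_def)

text \<open>Keeps pumped words inside \<open>valid m\<close>, the only place where the congruences
  below say anything.\<close>

lemma valid_replicate_blank:
  "u @ replicate g blank @ v \<in> valid m \<longleftrightarrow> u @ v \<in> valid m"
  by (auto simp: valid_def) (auto simp: blank_def)

lemma pebbles_sum: "pebbles x w = (\<Sum>j<length w. card ((w ! j) (Inl x)))"
  by (simp add: pebbles_def sum_list_sum_nth atLeast0LessThan)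

lemma valid_pebble_ex1:
  assumes "w \<in> valid m"
  shows "\<exists>!q. \<exists>i j. q = (i, Suc j) \<and> j < length w \<and> i \<in> (w ! j) (Inl x)"
proof -
  \<comment> \<open>Infinite sets have \<open>card\<close> 0, so the pebble count excludes further
    values only because the columns are finite.\<close>
  have fin: "finite ((w ! j) (Inl x))" if "j < length w" for j
    by (rule finite_subset[of _ "{1..m}"]) (use assms that nth_mem in \<open>force simp: valid_def\<close>)+
  have s: "(\<Sum>j<length w. card ((w ! j) (Inl x))) = 1"
    using assms by (simp add: valid_def pebbles_sum)
  have "card (SIGMA j:{..<length w}. (w ! j) (Inl x)) = 1"
    using s fin by (subst card_SigmaI) auto
  then obtain p where p: "(SIGMA j:{..<length w}. (w ! j) (Inl x)) = {p}"
    by (auto simp: card_1_singleton_iff)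
  have iff: "j < length w \<and> i \<in> (w ! j) (Inl x) \<longleftrightarrow> (j, i) = p" for i j
    using p by blast
  show ?thesis
    by (rule ex1I[of _ "(snd p, Suc (fst p))"]) (use iff in \<open>auto simp: conj_assoc\<close>)
qed

lemma dec_fo_iff:
  assumes "w \<in> valid m" "j < length w"
  shows "dec_fo w x = (i, Suc j) \<longleftrightarrow> i \<in> (w ! j) (Inl x)"
proof
  note ex1 = valid_pebble_ex1[OF assms(1), of x]
  show "i \<in> (w ! j) (Inl x)" if "dec_fo w x = (i, Suc j)"
    using theI'[OF ex1] that unfolding dec_fo_def by auto
  show "dec_fo w x = (i, Suc j)" if "i \<in> (w ! j) (Inl x)"
    unfolding dec_fo_def by (rule the1_equality[OF ex1]) (use that assms in auto)
qed

lemma dec_fo_obtain: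
  assumes "w \<in> valid m"
  obtains i j where "dec_fo w x = (i, Suc j)" "j < length w" "i \<in> (w ! j) (Inl x)"
  using theI'[OF valid_pebble_ex1[OF assms(1), of x]] unfolding dec_fo_def by blast

lemma dec_set_iff: "(i, Suc j) \<in> dec_set w \<mu> \<longleftrightarrow> j < length w \<and> i \<in> (w ! j) (Inr \<mu>)"
  by (auto simp: dec_set_def)

lemma valid_rows: "w \<in> valid m \<Longrightarrow> j < length w \<Longrightarrow> i \<in> (w ! j) \<kappa> \<Longrightarrow> i \<in> {1..m}"
  unfolding valid_def using nth_mem by blast

lemma assignment_dec:
  assumes "w \<in> valid m"
  shows "assignment (grid m (length w)) (dec_fo w) (dec_set w)"
  unfolding assignment_def
proof safe
  fix x show "dec_fo w x \<in> grid m (length w)"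
    by (rule dec_fo_obtain[OF assms, of x]) (use valid_rows[OF assms] in \<open>force simp: grid_def\<close>)
next
  fix \<mu> a b assume "(a, b) \<in> dec_set w \<mu>"
  then show "(a, b) \<in> grid m (length w)"
    using valid_rows[OF assms] by (force simp: grid_def dec_set_def)
qed

lemma enc_dec:
  assumes "w \<in> valid m"
  shows "enc (length w) (dec_fo w) (dec_set w) = w"
  by (rule nth_equalityI)
     (auto simp: nth_enc fun_eq_iff dec_fo_iff[OF assms] dec_set_iff split: sum.splits)

lemma enc_valid:
  assumes "assignment (grid m n) e E"
  shows "enc n e E \<in> valid m"
proof -
  have "pebbles x (enc n e E) = 1" for x
  proof -
    obtain i j where ij: "e x = (i, Suc j)" "j < n" "1 \<le> i" "i \<le> m"
    proof -
      obtain i j where "e x = (i, j)" by (cases "e x")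
      moreover have "e x \<in> grid m n" using assms by (simp add: assignment_def)
      ultimately show thesis using that[of i "j - 1"] by (auto simp: grid_def)
    qed
    have "pebbles x (enc n e E) = (\<Sum>j'<n. if j' = j then 1 else 0)"
      unfolding pebbles_sum by (rule sum.cong) (auto simp: nth_enc ij)
    also have "\<dots> = 1" using ij by simp
    finally show ?thesis .
  qed
  moreover have "l \<kappa> \<subseteq> {1..m}" if l: "l \<in> set (enc n e E)" for l \<kappa>
  proof -
    obtain j where j: "j < n" "enc n e E ! j = l" using l by (auto simp: in_set_conv_nth)
    moreover have "i \<in> {1..m}" if "e x = (i, b)" for i b x
    proof -
      have "e x \<in> grid m n" using assms by (simp add: assignment_def)
      then show ?thesis using that by (simp add: grid_def)
    qed
    moreover have "i \<in> {1..m}" if "(i, b) \<in> E \<mu>" for i b \<mu>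
    proof -
      have "E \<mu> \<subseteq> grid m n" using assms by (simp add: assignment_def)
      then show ?thesis using that by (auto simp: grid_def)
    qed
    ultimately show ?thesis
      unfolding j(2)[symmetric] nth_enc[OF j(1)] by (cases \<kappa>) auto
  qed
  ultimately show ?thesis by (simp add: valid_def)
qed

lemma dec_enc:
  assumes "assignment (grid m n) e E"
  shows "dec_fo (enc n e E) = e" "dec_set (enc n e E) = E"
proof -
  have v: "enc n e E \<in> valid m" by (rule enc_valid[OF assms])
  show "dec_fo (enc n e E) = e"
  proof
    fix x
    obtain i j where ij: "dec_fo (enc n e E) x = (i, Suc j)" "j < n" "i \<in> (enc n e E ! j) (Inl x)"
      by (rule dec_fo_obtain[OF v, of x]) auto
    then show "dec_fo (enc n e E) x = e x" by (simp add: nth_enc)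
  qed
  show "dec_set (enc n e E) = E"
  proof (intro ext Set.set_eqI)
    fix \<mu> and p :: "nat \<times> nat"
    obtain a b where [simp]: "p = (a, b)" by (cases p)
    have "(a, b) \<in> E \<mu> \<Longrightarrow> b \<in> {1..n}" using assms unfolding assignment_def grid_def by blast
    then show "(p \<in> dec_set (enc n e E) \<mu>) = (p \<in> E \<mu>)"
      by (cases b) (auto simp: dec_set_def nth_enc)
  qed
qed

definition lang :: "nat \<Rightarrow> fm \<Rightarrow> letter list set" where
  "lang m \<phi> = {w \<in> valid m. sat (grid m (length w)) (dec_fo w) (dec_set w) \<phi>}"

text \<open>Quantification becomes forgetting a track. Every variable always has a value, so for
  \<open>Inl v\<close> the projected word still carries a pebble \<open>v\<close>, at an arbitrary
  position; hence the restriction to \<open>valid m\<close>.\<close>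

definition proj :: "nat \<Rightarrow> nat + nat \<Rightarrow> letter list set \<Rightarrow> letter list set" where
  "proj m \<kappa> L = {w \<in> valid m. \<exists>w'\<in>L. list_all2 (\<lambda>l l'. \<forall>\<kappa>'. \<kappa>' \<noteq> \<kappa> \<longrightarrow> l \<kappa>' = l' \<kappa>') w w'}"

lemma lang_valid: "w \<in> lang m \<phi> \<Longrightarrow> w \<in> valid m"
  by (simp add: lang_def)

lemma lang_Neg: "lang m (Neg \<phi>) = valid m - lang m \<phi>"
  and lang_Conj: "lang m (Conj \<phi> \<psi>) = lang m \<phi> \<inter> lang m \<psi>"
  and lang_Disj: "lang m (Disj \<phi> \<psi>) = lang m \<phi> \<union> lang m \<psi>"
  by (auto simp: lang_def)

lemma dec_fo_relabel:
  assumes "w \<in> valid m" "w' \<in> valid m" "length w = length w'"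
    "\<And>j. j < length w \<Longrightarrow> (w ! j) (Inl x) = (w' ! j) (Inl x)"
  shows "dec_fo w' x = dec_fo w x"
  by (rule dec_fo_obtain[OF assms(1), of x]) (use assms dec_fo_iff[OF assms(2)] in auto)

lemma dec_set_relabel:
  assumes "length w = length w'" "\<And>j. j < length w \<Longrightarrow> (w ! j) (Inr \<mu>) = (w' ! j) (Inr \<mu>)"
  shows "dec_set w' \<mu> = dec_set w \<mu>"
  using assms by (auto simp: dec_set_def)

lemma lang_Ex1: "lang m (Ex1 v \<phi>) = proj m (Inl v) (lang m \<phi>)"
proof (rule Set.set_eqI, rule iffI)
  fix w assume "w \<in> lang m (Ex1 v \<phi>)"
  then obtain a where w: "w \<in> valid m" and a: "a \<in> grid m (length w)"
    and s: "sat (grid m (length w)) ((dec_fo w)(v := a)) (dec_set w) \<phi>"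
    by (auto simp: lang_def)
  have as: "assignment (grid m (length w)) ((dec_fo w)(v := a)) (dec_set w)"
    using assignment_dec[OF w] a by (auto simp: assignment_def)
  let ?w = "enc (length w) ((dec_fo w)(v := a)) (dec_set w)"
  have "?w \<in> lang m \<phi>" using s enc_valid[OF as] dec_enc[OF as] by (simp add: lang_def)
  moreover have "list_all2 (\<lambda>l l'. \<forall>\<kappa>'. \<kappa>' \<noteq> Inl v \<longrightarrow> l \<kappa>' = l' \<kappa>') w ?w"
  proof -
    have "list_all2 (\<lambda>l l'. \<forall>\<kappa>'. \<kappa>' \<noteq> Inl v \<longrightarrow> l \<kappa>' = l' \<kappa>') (enc (length w) (dec_fo w) (dec_set w)) ?w"
      by (auto simp: list_all2_conv_all_nth nth_enc split: sum.splits)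
    then show ?thesis by (simp add: enc_dec[OF w])
  qed
  ultimately show "w \<in> proj m (Inl v) (lang m \<phi>)" using w by (auto simp: proj_def)
next
  fix w assume "w \<in> proj m (Inl v) (lang m \<phi>)"
  then obtain w' where w: "w \<in> valid m" and w': "w' \<in> lang m \<phi>"
    and r: "list_all2 (\<lambda>l l'. \<forall>\<kappa>'. \<kappa>' \<noteq> Inl v \<longrightarrow> l \<kappa>' = l' \<kappa>') w w'"
    by (auto simp: proj_def)
  have len: "length w = length w'" using r by (simp add: list_all2_lengthD)
  have 1: "dec_fo w' = (dec_fo w)(v := dec_fo w' v)"
    using dec_fo_relabel[OF w lang_valid[OF w'] len] r
    by (auto simp: fun_eq_iff list_all2_conv_all_nth)
  have 2: "dec_set w' = dec_set w"
    by (rule ext, rule dec_set_relabel) (use r in \<open>auto simp: list_all2_conv_all_nth\<close>)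
  have "dec_fo w' v \<in> grid m (length w)"
    using assignment_dec[OF lang_valid[OF w']] len by (simp add: assignment_def)
  moreover have "sat (grid m (length w)) ((dec_fo w)(v := dec_fo w' v)) (dec_set w) \<phi>"
    using w' 1 2 len by (simp add: lang_def)
  ultimately show "w \<in> lang m (Ex1 v \<phi>)" using w by (auto simp: lang_def)
qed

lemma lang_ExS: "lang m (ExS \<mu> \<phi>) = proj m (Inr \<mu>) (lang m \<phi>)"
proof (rule Set.set_eqI, rule iffI)
  fix w assume "w \<in> lang m (ExS \<mu> \<phi>)"
  then obtain A where w: "w \<in> valid m" and A: "A \<subseteq> grid m (length w)"
    and s: "sat (grid m (length w)) (dec_fo w) ((dec_set w)(\<mu> := A)) \<phi>"
    by (auto simp: lang_def)
  have as: "assignment (grid m (length w)) (dec_fo w) ((dec_set w)(\<mu> := A))"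
    using assignment_dec[OF w] A by (auto simp: assignment_def)
  let ?w = "enc (length w) (dec_fo w) ((dec_set w)(\<mu> := A))"
  have "?w \<in> lang m \<phi>" using s enc_valid[OF as] dec_enc[OF as] by (simp add: lang_def)
  moreover have "list_all2 (\<lambda>l l'. \<forall>\<kappa>'. \<kappa>' \<noteq> Inr \<mu> \<longrightarrow> l \<kappa>' = l' \<kappa>') w ?w"
  proof -
    have "list_all2 (\<lambda>l l'. \<forall>\<kappa>'. \<kappa>' \<noteq> Inr \<mu> \<longrightarrow> l \<kappa>' = l' \<kappa>') (enc (length w) (dec_fo w) (dec_set w)) ?w"
      by (auto simp: list_all2_conv_all_nth nth_enc split: sum.splits)
    then show ?thesis by (simp add: enc_dec[OF w])
  qed
  ultimately show "w \<in> proj m (Inr \<mu>) (lang m \<phi>)" using w by (auto simp: proj_def)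
next
  fix w assume "w \<in> proj m (Inr \<mu>) (lang m \<phi>)"
  then obtain w' where w: "w \<in> valid m" and w': "w' \<in> lang m \<phi>"
    and r: "list_all2 (\<lambda>l l'. \<forall>\<kappa>'. \<kappa>' \<noteq> Inr \<mu> \<longrightarrow> l \<kappa>' = l' \<kappa>') w w'"
    by (auto simp: proj_def)
  have len: "length w = length w'" using r by (simp add: list_all2_lengthD)
  have 1: "dec_fo w' = dec_fo w"
    by (rule ext, rule dec_fo_relabel[OF w lang_valid[OF w'] len]) (use r in \<open>auto simp: list_all2_conv_all_nth\<close>)
  have 2: "dec_set w' = (dec_set w)(\<mu> := dec_set w' \<mu>)"
    using dec_set_relabel[OF len] r by (auto simp: fun_eq_iff list_all2_conv_all_nth)
  have "dec_set w' \<mu> \<subseteq> grid m (length w)"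
    using assignment_dec[OF lang_valid[OF w']] len by (simp add: assignment_def)
  moreover have "sat (grid m (length w)) (dec_fo w) ((dec_set w)(\<mu> := dec_set w' \<mu>)) \<phi>"
    using w' 1 2 len by (simp add: lang_def)
  ultimately show "w \<in> lang m (ExS \<mu> \<phi>)" using w by (auto simp: lang_def)
qed

section \<open>Index of a word language\<close>

text \<open>The congruence is only required on valid words: recognising that each of the infinitely many
  first-order variables has exactly one value would take an infinite index.\<close>

definition index_le :: "nat \<Rightarrow> letter list set \<Rightarrow> nat \<Rightarrow> bool" where
  "index_le m L N \<longleftrightarrow> (\<exists>h :: letter list \<Rightarrow> nat. (\<forall>w. h w < N) \<and>
     (\<forall>u v x y. h u = h v \<longrightarrow> x @ v @ y \<in> valid m \<longrightarrow> x @ u @ y \<in> L \<longrightarrow> x @ v @ y \<in> L))"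

text \<open>The nondeterministic variant, where \<open>\<rho> u\<close> are the possible states and \<open>acc\<close> the accepting contexts.
  It is stable under set quantification, so a whole block of set quantifiers costs one exponential.\<close>

definition nindex_le :: "nat \<Rightarrow> letter list set \<Rightarrow> nat \<Rightarrow> bool" where
  "nindex_le m L N \<longleftrightarrow> (\<exists>(\<rho> :: letter list \<Rightarrow> nat set) acc. (\<forall>w. \<rho> w \<subseteq> {..<N}) \<and>
     (\<forall>u x y. x @ u @ y \<in> valid m \<longrightarrow> (x @ u @ y \<in> L \<longleftrightarrow> (\<exists>c\<in>\<rho> u. acc c x y))))"

lemma index_leI:
  fixes h :: "letter list \<Rightarrow> 'a"
  assumes "finite S" "range h \<subseteq> S" "card S \<le> N"
    "\<And>u v x y. h u = h v \<Longrightarrow> x @ v @ y \<in> valid m \<Longrightarrow> x @ u @ y \<in> L \<Longrightarrow> x @ v @ y \<in> L"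
  shows "index_le m L N"
proof -
  obtain g where g: "bij_betw g S {0..<card S}"
    using ex_bij_betw_finite_nat[OF assms(1)] by blast
  have mem: "h w \<in> S" for w using assms(2) by auto
  show ?thesis unfolding index_le_def
  proof (intro exI[of _ "g \<circ> h"] conjI allI impI)
    fix w show "(g \<circ> h) w < N"
      using bij_betwE[OF g] mem[of w] assms(3) by fastforce
  next
    fix u v x y
    assume "(g \<circ> h) u = (g \<circ> h) v" "x @ v @ y \<in> valid m" "x @ u @ y \<in> L"
    moreover from this have "h u = h v"
      using bij_betw_imp_inj_on[OF g] mem by (auto dest: inj_onD)
    ultimately show "x @ v @ y \<in> L" using assms(4) by blast
  qed
qed

lemma index_le_mono: "index_le m L N \<Longrightarrow> N \<le> N' \<Longrightarrow> index_le m L N'"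
  unfolding index_le_def
  by (elim exE conjE, rule exI, rule conjI, rule allI, erule allE, erule less_le_trans) auto

lemma nindex_le_mono: "nindex_le m L N \<Longrightarrow> N \<le> N' \<Longrightarrow> nindex_le m L N'"
proof -
  assume "nindex_le m L N" and N: "N \<le> N'"
  then obtain \<rho> acc where \<rho>: "\<forall>w. \<rho> w \<subseteq> {..<N}"
    and r: "\<forall>u x y. x @ u @ y \<in> valid m \<longrightarrow> (x @ u @ y \<in> L \<longleftrightarrow> (\<exists>c\<in>\<rho> u. acc c x y))"
    unfolding nindex_le_def by blast
  have "\<forall>w. \<rho> w \<subseteq> {..<N'}" using \<rho> N by fastforce
  then show ?thesis using r unfolding nindex_le_def by blast
qed

lemma index_le_compl: "index_le m L N \<Longrightarrow> L \<subseteq> valid m \<Longrightarrow> index_le m (valid m - L) N"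
proof -
  assume "index_le m L N" and L: "L \<subseteq> valid m"
  then obtain h :: "letter list \<Rightarrow> nat" where h: "\<forall>w. h w < N"
    and r: "\<forall>u v x y. h u = h v \<longrightarrow> x @ v @ y \<in> valid m \<longrightarrow> x @ u @ y \<in> L \<longrightarrow> x @ v @ y \<in> L"
    unfolding index_le_def by blast
  have "x @ v @ y \<notin> L" if "h u = h v" "x @ u @ y \<in> valid m" "x @ u @ y \<notin> L" for u v x y
    using r[rule_format, OF that(1)[symmetric] that(2)] that(3) by blast
  then show ?thesis unfolding index_le_def using h by (intro exI[of _ h]) auto
qed

lemma index_le_Int_Un:
  assumes "index_le m L N" "index_le m L' N'"
  shows "index_le m (L \<inter> L') (N * N')" "index_le m (L \<union> L') (N * N')"
proof -
  obtain h h' :: "letter list \<Rightarrow> nat" where h: "\<forall>w. h w < N" "\<forall>w. h' w < N'"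
    and r: "\<forall>u v x y. h u = h v \<longrightarrow> x @ v @ y \<in> valid m \<longrightarrow> x @ u @ y \<in> L \<longrightarrow> x @ v @ y \<in> L"
      "\<forall>u v x y. h' u = h' v \<longrightarrow> x @ v @ y \<in> valid m \<longrightarrow> x @ u @ y \<in> L' \<longrightarrow> x @ v @ y \<in> L'"
    using assms unfolding index_le_def by blast
  have "range (\<lambda>w. (h w, h' w)) \<subseteq> {..<N} \<times> {..<N'}" using h by auto
  note I = index_leI[OF _ this, where N = "N * N'" and m = m]
  show "index_le m (L \<inter> L') (N * N')" by (rule I) (use r in auto)
  show "index_le m (L \<union> L') (N * N')" by (rule I) (use r in auto)
qed

lemma nindex_le_of_index_le:
  assumes "index_le m L N"
  shows "nindex_le m L N"
proof -
  obtain h :: "letter list \<Rightarrow> nat" where h: "\<forall>w. h w < N"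
    and r: "\<forall>u v x y. h u = h v \<longrightarrow> x @ v @ y \<in> valid m \<longrightarrow> x @ u @ y \<in> L \<longrightarrow> x @ v @ y \<in> L"
    using assms unfolding index_le_def by blast
  \<comment> \<open>A context accepts the class \<open>c\<close> if it accepts some word of that
    class; by the congruence it then accepts every one that gives a valid word.\<close>
  show ?thesis unfolding nindex_le_def
    by (intro exI[of _ "\<lambda>w. {h w}"] exI[of _ "\<lambda>c x y. \<exists>u. h u = c \<and> x @ u @ y \<in> L"])
      (use h r in auto)
qed

text \<open>Subset construction: the class of a factor is its set of possible states, one of
  \<open>2 ^ N\<close> sets.\<close>

lemma index_le_of_nindex_le:
  assumes "nindex_le m L N" "L \<subseteq> valid m"
  shows "index_le m L (2 ^ N)"
proof -
  obtain \<rho> :: "letter list \<Rightarrow> nat set" and acc where \<rho>: "\<forall>w. \<rho> w \<subseteq> {..<N}"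
    and r: "\<forall>u x y. x @ u @ y \<in> valid m \<longrightarrow> (x @ u @ y \<in> L \<longleftrightarrow> (\<exists>c\<in>\<rho> u. acc c x y))"
    using assms(1) unfolding nindex_le_def by blast
  show ?thesis
    by (rule index_leI[of "Pow {..<N}" \<rho>]) (use \<rho> r assms(2) in \<open>auto simp: card_Pow\<close>)
qed

lemma nindex_le_Int_Un:
  assumes "nindex_le m L N" "nindex_le m L' N'"
  shows "nindex_le m (L \<inter> L') (N * N')" "nindex_le m (L \<union> L') (N + N')"
proof -
  obtain \<rho> acc where \<rho>: "\<forall>w. \<rho> w \<subseteq> {..<N}"
    and r: "\<forall>u x y. x @ u @ y \<in> valid m \<longrightarrow> (x @ u @ y \<in> L \<longleftrightarrow> (\<exists>c\<in>\<rho> u. acc c x y))"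
    using assms(1) unfolding nindex_le_def by blast
  obtain \<rho>' acc' where \<rho>': "\<forall>w. \<rho>' w \<subseteq> {..<N'}"
    and r': "\<forall>u x y. x @ u @ y \<in> valid m \<longrightarrow> (x @ u @ y \<in> L' \<longleftrightarrow> (\<exists>c\<in>\<rho>' u. acc' c x y))"
    using assms(2) unfolding nindex_le_def by blast
  show "nindex_le m (L \<inter> L') (N * N')"
    unfolding nindex_le_def
  proof (intro exI conjI allI impI)
    fix w
    \<comment> \<open>A pair of states is packed into one number below \<open>N * N'\<close>, to be
      read back by \<open>div\<close> and \<open>mod\<close>.\<close>
    show "(\<lambda>(c, c'). c * N' + c') ` (\<rho> w \<times> \<rho>' w) \<subseteq> {..<N * N'}"
    proof clarsimp
      fix a b assume "a \<in> \<rho> w" "b \<in> \<rho>' w"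
      then have "a < N" "b < N'" using \<rho> \<rho>' by auto
      then have "a * N' + b < (a + 1) * N'" by simp
      also have "\<dots> \<le> N * N'" using \<open>a < N\<close> by (intro mult_right_mono) auto
      finally show "a * N' + b < N * N'" .
    qed
  next
    fix u x y assume v: "x @ u @ y \<in> valid m"
    have d: "(a * N' + b) div N' = a \<and> (a * N' + b) mod N' = b" if "b \<in> \<rho>' u" for a b
      using \<rho>' that by (force simp: div_mult_self3)
    show "(x @ u @ y \<in> L \<inter> L') =
      (\<exists>c\<in>(\<lambda>(c, c'). c * N' + c') ` (\<rho> u \<times> \<rho>' u). acc (c div N') x y \<and> acc' (c mod N') x y)"
      using v r r' d by auto
  qed
  show "nindex_le m (L \<union> L') (N + N')"
    unfolding nindex_le_def
  proof (intro exI conjI allI impI)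
    fix w
    show "\<rho> w \<union> (\<lambda>c. N + c) ` \<rho>' w \<subseteq> {..<N + N'}" using \<rho> \<rho>' by force
  next
    fix u x y assume v: "x @ u @ y \<in> valid m"
    show "(x @ u @ y \<in> L \<union> L') =
      (\<exists>c\<in>\<rho> u \<union> (\<lambda>c. N + c) ` \<rho>' u. if c < N then acc c x y else acc' (c - N) x y)"
      using v r r' \<rho> by (fastforce simp: bex_Un)
  qed
qed

text \<open>A set track can be relabelled in each factor independently and without touching the
  pebbles. So the states of \<open>u\<close> are those of all its relabellings, and the accepting
  contexts absorb the relabelling of the rest. A pebble track lacks this independence: its pebble
  sits in exactly one of the factors.\<close>

lemma nindex_le_proj_set:
  assumes "nindex_le m L N" "L \<subseteq> valid m"
  shows "nindex_le m (proj m (Inr \<mu>) L) N"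
proof -
  obtain \<rho> acc where \<rho>: "\<forall>w. \<rho> w \<subseteq> {..<N}"
    and r: "\<forall>u x y. x @ u @ y \<in> valid m \<longrightarrow> (x @ u @ y \<in> L \<longleftrightarrow> (\<exists>c\<in>\<rho> u. acc c x y))"
    using assms(1) unfolding nindex_le_def by blast
  \<comment> \<open>The row bound is part of \<open>R\<close>, so that every relabelling of a valid
    word is valid again.\<close>
  define R :: "letter list \<Rightarrow> letter list \<Rightarrow> bool" where
    "R = list_all2 (\<lambda>l l'. (\<forall>\<kappa>'. \<kappa>' \<noteq> Inr \<mu> \<longrightarrow> l \<kappa>' = l' \<kappa>') \<and> l' (Inr \<mu>) \<subseteq> {1..m})"
  have peb: "pebbles x w' = pebbles x w" if "R w w'" for x w w'
    using that unfolding R_def by induction auto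
  have R_valid: "w' \<in> valid m" if "w \<in> valid m" "R w w'" for w w'
    unfolding valid_def
  proof (intro CollectI conjI ballI allI)
    fix l \<kappa> assume "l \<in> set w'"
    then obtain j where j: "j < length w'" "w' ! j = l" by (auto simp: in_set_conv_nth)
    then have "j < length w" "w ! j \<in> set w" using that(2) by (auto simp: R_def list_all2_conv_all_nth)
    then have "(w ! j) \<kappa> \<subseteq> {1..m}" using that(1) by (auto simp: valid_def)
    then show "l \<kappa> \<subseteq> {1..m}"
      using that(2) j unfolding R_def list_all2_conv_all_nth by (cases "\<kappa> = Inr \<mu>") auto
  qed (use that peb in \<open>auto simp: valid_def\<close>)
  have proj_iff: "w \<in> proj m (Inr \<mu>) L \<longleftrightarrow> (\<exists>w'\<in>L. R w w')" if "w \<in> valid m" for w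
  proof
    assume "w \<in> proj m (Inr \<mu>) L"
    then obtain w' where w': "w' \<in> L" "list_all2 (\<lambda>l l'. \<forall>\<kappa>'. \<kappa>' \<noteq> Inr \<mu> \<longrightarrow> l \<kappa>' = l' \<kappa>') w w'"
      by (auto simp: proj_def)
    moreover have "w' \<in> valid m" using w' assms(2) by auto
    then have "(w' ! j) (Inr \<mu>) \<subseteq> {1..m}" if "j < length w'" for j
      using that nth_mem unfolding valid_def by blast
    ultimately show "\<exists>w'\<in>L. R w w'" by (auto simp: R_def list_all2_conv_all_nth)
  next
    assume "\<exists>w'\<in>L. R w w'"
    then show "w \<in> proj m (Inr \<mu>) L"
      using that by (auto simp: proj_def R_def list_all2_conv_all_nth)
  qed
  have R_append: "R (x @ u @ y) w' \<longleftrightarrow> (\<exists>x' u' y'. w' = x' @ u' @ y' \<and> R x x' \<and> R u u' \<and> R y y')" for x u y w'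
  proof
    show "\<exists>x' u' y'. w' = x' @ u' @ y' \<and> R x x' \<and> R u u' \<and> R y y'" if "R (x @ u @ y) w'"
      using that unfolding R_def list_all2_append1 by blast
    show "R (x @ u @ y) w'" if "\<exists>x' u' y'. w' = x' @ u' @ y' \<and> R x x' \<and> R u u' \<and> R y y'"
      using that unfolding R_def by (blast intro: list_all2_appendI)
  qed
  show ?thesis unfolding nindex_le_def
  proof (intro exI conjI allI impI)
    fix w show "\<Union>(\<rho> ` {w'. R w w'}) \<subseteq> {..<N}" using \<rho> by auto
  next
    fix u x y assume v: "x @ u @ y \<in> valid m"
    have "x @ u @ y \<in> proj m (Inr \<mu>) L \<longleftrightarrow> (\<exists>x' u' y'. R x x' \<and> R u u' \<and> R y y' \<and> x' @ u' @ y' \<in> L)"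
      unfolding proj_iff[OF v] R_append by blast
    also have "\<dots> \<longleftrightarrow> (\<exists>x' u' y'. R x x' \<and> R u u' \<and> R y y' \<and> (\<exists>c\<in>\<rho> u'. acc c x' y'))"
      using r R_valid[OF v] unfolding R_append by blast
    finally show "x @ u @ y \<in> proj m (Inr \<mu>) L \<longleftrightarrow> (\<exists>c\<in>\<Union>(\<rho> ` {w'. R u w'}).
        \<exists>x' y'. R x x' \<and> R y y' \<and> acc c x' y')"
      by blast
  qed
qed

text \<open>The base \<open>2 ^ x\<close> is the order of the index of first-order formulas. With
  it, sums and products are absorbed by adding arguments, that is, by a larger factor
  \<open>c\<close> in \<open>tower k (c * m)\<close>.\<close>

primrec tower :: "nat \<Rightarrow> nat \<Rightarrow> nat" where
  "tower 0 x = 2 ^ x"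
| "tower (Suc k) x = 2 ^ tower k x"

lemma tower_mono: "x \<le> y \<Longrightarrow> tower k x \<le> tower k y"
  by (induction k) (auto intro: power_increasing)

lemma tower_ge: "x < tower k x"
proof (induction k)
  case (Suc k)
  then show ?case using less_trans[OF Suc less_exp] by simp
qed (simp add: less_exp)

lemma tower_add: "1 \<le> x \<Longrightarrow> 1 \<le> y \<Longrightarrow> tower k x + tower k y \<le> tower k (x + y)"
proof (induction k)
  have *: "2 ^ a + 2 ^ b \<le> (2 :: nat) ^ (a + b)" if "1 \<le> a" "1 \<le> b" for a b :: nat
  proof -
    have "2 \<le> (2::nat) ^ a" "2 \<le> (2::nat) ^ b"
      using that power_increasing[of 1 _ "2::nat"] by auto
    then obtain c d where "(2::nat) ^ a = 2 + c" "(2::nat) ^ b = 2 + d"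
      unfolding le_iff_add by blast
    then show ?thesis by (simp add: power_add algebra_simps)
  qed
  case 0 then show ?case using *[of x y] by simp
  case (Suc k)
  have "1 \<le> tower k x" "1 \<le> tower k y" using tower_ge[of x k] tower_ge[of y k] by auto
  from *[OF this] have "tower (Suc k) x + tower (Suc k) y \<le> 2 ^ (tower k x + tower k y)" by simp
  also have "\<dots> \<le> tower (Suc k) (x + y)" using Suc by (simp add: power_increasing)
  finally show ?case .
qed

lemma tower_mult: "1 \<le> x \<Longrightarrow> 1 \<le> y \<Longrightarrow> tower k x * tower k y \<le> tower k (x + y)"
  by (cases k) (auto simp: power_add[symmetric] intro!: power_increasing tower_add)

definition tower_index :: "nat \<Rightarrow> fm set" where
  "tower_index k = {\<phi>. \<exists>c\<ge>1. \<forall>m\<ge>1. index_le m (lang m \<phi>) (tower k (c * m))}"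

definition tower_nindex :: "nat \<Rightarrow> fm set" where
  "tower_nindex k = {\<phi>. \<exists>c\<ge>1. \<forall>m\<ge>1. nindex_le m (lang m \<phi>) (tower k (c * m))}"

lemma lang_subset: "lang m \<phi> \<subseteq> valid m"
  by (auto simp: lang_def)

lemma Bool_closure_tower_index:
  assumes "F \<subseteq> tower_index k"
  shows "Bool_closure F \<subseteq> tower_index k"
proof
  fix \<phi> assume "\<phi> \<in> Bool_closure F"
  then show "\<phi> \<in> tower_index k"
  proof induction
    case (base \<phi>) then show ?case using assms by auto
  next
    case (neg \<phi>)
    then obtain c where c: "c \<ge> 1" "\<forall>m\<ge>1. index_le m (lang m \<phi>) (tower k (c * m))"
      by (auto simp: tower_index_def)
    then have "index_le m (lang m (Neg \<phi>)) (tower k (c * m))" if "m \<ge> 1" for m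
      unfolding lang_Neg using that index_le_compl[OF _ lang_subset] by simp
    then show ?case using c(1) by (auto simp: tower_index_def)
  next
    case (conj \<phi> \<psi>)
    then obtain c d where c: "c \<ge> 1" "d \<ge> 1"
      "\<forall>m\<ge>1. index_le m (lang m \<phi>) (tower k (c * m))" "\<forall>m\<ge>1. index_le m (lang m \<psi>) (tower k (d * m))"
      by (auto simp: tower_index_def)
    have "index_le m (lang m (Conj \<phi> \<psi>)) (tower k ((c + d) * m))" if "m \<ge> 1" for m
      unfolding lang_Conj
      by (rule index_le_mono[OF index_le_Int_Un(1)]) (use c that in \<open>auto simp: algebra_simps intro!: tower_mult\<close>)
    then show ?case using c by (auto simp: tower_index_def intro!: exI[of _ "c + d"])
  next
    case (disj \<phi> \<psi>)
    then obtain c d where c: "c \<ge> 1" "d \<ge> 1"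
      "\<forall>m\<ge>1. index_le m (lang m \<phi>) (tower k (c * m))" "\<forall>m\<ge>1. index_le m (lang m \<psi>) (tower k (d * m))"
      by (auto simp: tower_index_def)
    have "index_le m (lang m (Disj \<phi> \<psi>)) (tower k ((c + d) * m))" if "m \<ge> 1" for m
      unfolding lang_Disj
      by (rule index_le_mono[OF index_le_Int_Un(2)]) (use c that in \<open>auto simp: algebra_simps intro!: tower_mult\<close>)
    then show ?case using c by (auto simp: tower_index_def intro!: exI[of _ "c + d"])
  qed
qed

lemma Sigma1_closure_tower_index:
  assumes "F \<subseteq> tower_index k"
  shows "Sigma1_closure F \<subseteq> tower_index (Suc k)"
proof
  fix \<phi> assume "\<phi> \<in> Sigma1_closure F"
  \<comment> \<open>Determinising only after this induction keeps the price at one exponential for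
    all nested quantifiers together.\<close>
  then have "\<phi> \<in> tower_nindex k"
  proof induction
    case (base \<phi>) then show ?case
      using assms by (fastforce simp: tower_index_def tower_nindex_def intro: nindex_le_of_index_le)
  next
    case (conj \<phi> \<psi>)
    then obtain c d where c: "c \<ge> 1" "d \<ge> 1"
      "\<forall>m\<ge>1. nindex_le m (lang m \<phi>) (tower k (c * m))" "\<forall>m\<ge>1. nindex_le m (lang m \<psi>) (tower k (d * m))"
      by (auto simp: tower_nindex_def)
    have "nindex_le m (lang m (Conj \<phi> \<psi>)) (tower k ((c + d) * m))" if "m \<ge> 1" for m
      unfolding lang_Conj
      by (rule nindex_le_mono[OF nindex_le_Int_Un(1)]) (use c that in \<open>auto simp: algebra_simps intro!: tower_mult\<close>)
    then show ?case using c by (auto simp: tower_nindex_def intro!: exI[of _ "c + d"])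
  next
    case (disj \<phi> \<psi>)
    then obtain c d where c: "c \<ge> 1" "d \<ge> 1"
      "\<forall>m\<ge>1. nindex_le m (lang m \<phi>) (tower k (c * m))" "\<forall>m\<ge>1. nindex_le m (lang m \<psi>) (tower k (d * m))"
      by (auto simp: tower_nindex_def)
    have "nindex_le m (lang m (Disj \<phi> \<psi>)) (tower k ((c + d) * m))" if "m \<ge> 1" for m
      unfolding lang_Disj
      by (rule nindex_le_mono[OF nindex_le_Int_Un(2)]) (use c that in \<open>auto simp: algebra_simps intro!: tower_add\<close>)
    then show ?case using c by (auto simp: tower_nindex_def intro!: exI[of _ "c + d"])
  next
    case (exS \<phi> \<mu>)
    then obtain c where c: "c \<ge> 1" "\<forall>m\<ge>1. nindex_le m (lang m \<phi>) (tower k (c * m))"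
      by (auto simp: tower_nindex_def)
    then have "nindex_le m (lang m (ExS \<mu> \<phi>)) (tower k (c * m))" if "m \<ge> 1" for m
      unfolding lang_ExS using that nindex_le_proj_set[OF _ lang_subset] by simp
    then show ?case using c(1) by (auto simp: tower_nindex_def)
  qed
  then obtain c where c: "c \<ge> 1" "\<forall>m\<ge>1. nindex_le m (lang m \<phi>) (tower k (c * m))"
    by (auto simp: tower_nindex_def)
  then have "index_le m (lang m \<phi>) (tower (Suc k) (c * m))" if "m \<ge> 1" for m
    using that index_le_of_nindex_le[OF _ lang_subset] by simp
  then show "\<phi> \<in> tower_index (Suc k)" using c(1) unfolding tower_index_def by blast
qed

lemma Sigma_over_tower_index: "F \<subseteq> tower_index 0 \<Longrightarrow> Sigma_over k F \<subseteq> tower_index k"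
proof (induction k)
  case (Suc k)
  then show ?case by (simp add: Sigma1_closure_tower_index Bool_closure_tower_index)
qed simp

section \<open>Pumping of blank columns\<close>

definition pumpable :: "nat \<Rightarrow> nat \<Rightarrow> letter list set \<Rightarrow> bool" where
  "pumpable T p L \<longleftrightarrow>
     (\<forall>g\<ge>T. \<forall>x y. x @ replicate g blank @ y \<in> L \<longleftrightarrow> x @ replicate (g + p) blank @ y \<in> L)"

lemma pumpable_mult:
  assumes "pumpable T p L" "T \<le> T'"
  shows "pumpable T' (q * p) L"
proof (induction q)
  case (Suc q)
  show ?case unfolding pumpable_def
  proof (intro allI impI)
    fix g x y assume g: "T' \<le> g"
    then have "x @ replicate g blank @ y \<in> L \<longleftrightarrow> x @ replicate (g + q * p) blank @ y \<in> L"
      using Suc.IH[unfolded pumpable_def, rule_format, OF g] by blast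
    also have "\<dots> \<longleftrightarrow> x @ replicate (g + q * p + p) blank @ y \<in> L"
      using assms(1)[unfolded pumpable_def, rule_format, of "g + q * p" x y] assms(2) g by simp
    finally show "x @ replicate g blank @ y \<in> L \<longleftrightarrow> x @ replicate (g + Suc q * p) blank @ y \<in> L"
      by (simp add: algebra_simps)
  qed
qed (simp add: pumpable_def)

text \<open>Among the \<open>N + 1\<close> blocks of 0 to \<open>N\<close> blank columns two are
  congruent; the shorter length is a threshold and the difference a period.\<close>

lemma pumpable_of_index_le:
  assumes "index_le m L N" "L \<subseteq> valid m"
  obtains T p where "T \<le> N" "1 \<le> p" "p \<le> N" "pumpable T p L"
proof -
  obtain h :: "letter list \<Rightarrow> nat" where h: "\<forall>w. h w < N"
    and r: "\<forall>u v x y. h u = h v \<longrightarrow> x @ v @ y \<in> valid m \<longrightarrow> x @ u @ y \<in> L \<longrightarrow> x @ v @ y \<in> L"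
    using assms unfolding index_le_def by blast
  have "\<not> inj_on (\<lambda>i. h (replicate i blank)) {..N}"
  proof
    assume "inj_on (\<lambda>i. h (replicate i blank)) {..N}"
    moreover have "(\<lambda>i. h (replicate i blank)) ` {..N} \<subseteq> {..<N}" using h by auto
    ultimately have "card {..N} \<le> card {..<N}" by (intro card_inj_on_le) auto
    then show False by simp
  qed
  then obtain i j where ij: "i < j" "j \<le> N" "h (replicate i blank) = h (replicate j blank)"
    unfolding inj_on_def using linorder_neqE_nat by (metis atMost_iff)
  have "pumpable i (j - i) L"
    unfolding pumpable_def
  proof (intro allI impI)
    fix g x y assume "i \<le> g"
    then have s: "replicate g blank @ y = replicate i blank @ replicate (g - i) blank @ y"
      "replicate (g + (j - i)) blank @ y = replicate j blank @ replicate (g - i) blank @ y"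
      using ij by (simp_all add: append_assoc[symmetric] replicate_add[symmetric] del: append_assoc)
    have v: "x @ replicate g blank @ y \<in> valid m \<longleftrightarrow> x @ replicate (g + (j - i)) blank @ y \<in> valid m"
      by (simp add: valid_replicate_blank)
    show "x @ replicate g blank @ y \<in> L \<longleftrightarrow> x @ replicate (g + (j - i)) blank @ y \<in> L"
      using r[rule_format, OF ij(3), of x] r[rule_format, OF ij(3)[symmetric], of x] v assms(2)
      unfolding s by blast
  qed
  then show ?thesis using that[of i "j - i"] ij by auto
qed

text \<open>Applied below to a relabelled block of blank columns: \<open>Q\<close> singles out the
  column that received the pebble, and the second premise says that it is alone.\<close>

lemma replicate_split:
  assumes "\<And>l. l \<in> set u \<Longrightarrow> l = c \<or> Q l" "\<And>a P b. u = a @ P # b \<Longrightarrow> Q P \<Longrightarrow> set a \<union> set b \<subseteq> {c}"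
  shows "u = replicate (length u) c \<or> (\<exists>i P j. u = replicate i c @ P # replicate j c)"
proof (cases "\<exists>P\<in>set u. Q P")
  case True
  then obtain a P b where "u = a @ P # b" "Q P" by (metis split_list)
  then show ?thesis using assms(2)[of a P b]
    by (metis le_sup_iff replicate_length_same singletonD subsetD)
next
  case False
  then show ?thesis using assms(1) by (metis replicate_length_same)
qed

text \<open>The position of the quantified variable splits a block of blank columns into two, one of which is
  long enough to be pumped.\<close>

lemma pumpable_proj_fo:
  assumes p: "pumpable T p L" and L: "L \<subseteq> valid m"
  shows "pumpable (2 * T + p) p (proj m (Inl v) L)"
proof -
  let ?R = "list_all2 (\<lambda>l l'. \<forall>\<kappa>'. \<kappa>' \<noteq> Inl v \<longrightarrow> l \<kappa>' = l' \<kappa>') :: letter list \<Rightarrow> _"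
  have bl: "?R (replicate i blank) (replicate i blank)" for i
    by (auto simp: list_all2_conv_all_nth)
  \<comment> \<open>Pumping in both directions; downwards the block must have \<open>p\<close>
    columns to spare above the threshold.\<close>
  have pump: "x @ replicate a' blank @ y \<in> L"
    if mem: "x @ replicate a blank @ y \<in> L" and a: "T \<le> a" "a' = a + p \<or> T + p \<le> a \<and> a = a' + p" for x y a a'
    using a(2)
  proof
    assume "a' = a + p"
    then show ?thesis using mem p[unfolded pumpable_def, rule_format, OF a(1), of x y] by blast
  next
    assume a': "T + p \<le> a \<and> a = a' + p"
    then show ?thesis using mem p[unfolded pumpable_def, rule_format, of a' x y] by simp
  qed
  have main: "x @ replicate g' blank @ y \<in> proj m (Inl v) L"
    if mem: "x @ replicate g blank @ y \<in> proj m (Inl v) L"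
      and g: "2 * T + p \<le> g" "g' = g + p \<or> 2 * T + 2 * p \<le> g \<and> g = g' + p" for x y g g'
  proof -
    have val: "x @ replicate g' blank @ y \<in> valid m"
      using mem by (simp add: proj_def valid_replicate_blank)
    obtain x' u' y' where R: "?R x x'" "?R (replicate g blank) u'" "?R y y'" and w': "x' @ u' @ y' \<in> L"
      using mem by (auto simp: proj_def list_all2_append1)
    have len: "length u' = g" using R(2) by (simp add: list_all2_lengthD[symmetric])
    have "u' = replicate (length u') blank \<or> (\<exists>i P j. u' = replicate i blank @ P # replicate j blank)"
    proof (rule replicate_split)
      fix l assume "l \<in> set u'"
      then have o: "\<forall>\<kappa>. \<kappa> \<noteq> Inl v \<longrightarrow> l \<kappa> = {}"
        using R(2) by (auto simp: list_all2_conv_all_nth in_set_conv_nth blank_def)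
      show "l = blank \<or> l (Inl v) \<noteq> {}"
        using o unfolding blank_def fun_eq_iff by metis
    next
      fix a P b assume u': "u' = a @ P # b" and P: "P (Inl v) \<noteq> {}"
      have v': "x' @ u' @ y' \<in> valid m" using w' L by auto
      then have fin: "finite (l (Inl v))" if "l \<in> set u'" for l
      proof -
        have "l \<in> set (x' @ u' @ y')" using that by simp
        then have "l (Inl v) \<subseteq> {1..m}" using v' unfolding valid_def by blast
        then show ?thesis by (rule finite_subset) simp
      qed
      then have "card (P (Inl v)) \<ge> 1" using P u' by (simp add: Suc_le_eq card_gt_0_iff)
      moreover have "pebbles v (x' @ u' @ y') = 1" using v' by (simp add: valid_def)
      ultimately have "pebbles v (a @ b) = 0" using u' by simp
      then have c0: "card (l (Inl v)) = 0" if "l \<in> set (a @ b)" for l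
        using that by (auto simp: pebbles_def)
      have e: "l (Inl v) = {}" if "l \<in> set (a @ b)" for l
        using c0[OF that] fin[of l] that u' by auto
      have "l = blank" if "l \<in> set (a @ b)" for l
      proof -
        have "l \<in> set u'" using that u' by auto
        then have "\<forall>\<kappa>. \<kappa> \<noteq> Inl v \<longrightarrow> l \<kappa> = {}"
          using R(2) by (auto simp: list_all2_conv_all_nth in_set_conv_nth blank_def)
        then show ?thesis using e[OF that] unfolding blank_def fun_eq_iff by metis
      qed
      then show "set a \<union> set b \<subseteq> {blank}" by auto
    qed
    then consider "u' = replicate g blank" | i P j where "u' = replicate i blank @ P # replicate j blank"
      using len by auto
    then obtain u'' where "?R (replicate g' blank) u''" "x' @ u'' @ y' \<in> L"
    proof cases
      case 1
      have "x' @ replicate g' blank @ y' \<in> L"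
        by (rule pump[of _ g]) (use g w' 1 in auto)
      then show thesis using that bl by blast
    next
      case 2
      have P: "\<forall>\<kappa>'. \<kappa>' \<noteq> Inl v \<longrightarrow> blank \<kappa>' = P \<kappa>'"
      proof -
        have "u' ! i = P" "i < length u'" by (simp_all add: 2 nth_append)
        then show ?thesis using R(2) by (auto simp: list_all2_conv_all_nth)
      qed
      have RP: "?R (replicate g' blank) (replicate a blank @ P # replicate b blank)" if "a + Suc b = g'" for a b
      proof -
        have "replicate g' blank = replicate a blank @ blank # replicate b blank"
          using that by (metis replicate_Suc replicate_add)
        then show ?thesis using P bl by (auto intro: list_all2_appendI)
      qed
      have ij: "i + Suc j = g" using len 2 by simp
      \<comment> \<open>Truncated subtraction: \<open>g - g'\<close> is 0 when the block grows and
        \<open>p\<close> when it shrinks, which is what the changed side must have beyond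
        \<open>T\<close>.\<close>
      have "T + (g - g') \<le> i \<or> T + (g - g') \<le> j" using ij g by linarith
      then show thesis
      proof
        assume i: "T + (g - g') \<le> i"
        have "x' @ replicate (i + g' - g) blank @ (P # replicate j blank @ y') \<in> L"
          by (rule pump[of _ i]) (use w' 2 g i in auto)
        then show thesis
          using that[OF RP[of "i + g' - g" j]] i ij g by auto
      next
        assume j: "T + (g - g') \<le> j"
        have "(x' @ replicate i blank @ [P]) @ replicate (j + g' - g) blank @ y' \<in> L"
          by (rule pump[of _ j]) (use w' 2 g j in auto)
        then show thesis
          using that[OF RP[of i "j + g' - g"]] j ij g by auto
      qed
    qed
    then show ?thesis
      using val R(1,3) unfolding proj_def by (blast intro: list_all2_appendI)
  qed
  show ?thesis unfolding pumpable_def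
  proof (intro allI impI iffI)
    fix g x y assume g: "2 * T + p \<le> g"
    show "x @ replicate (g + p) blank @ y \<in> proj m (Inl v) L"
      if "x @ replicate g blank @ y \<in> proj m (Inl v) L"
      using main[OF that g] by simp
    show "x @ replicate g blank @ y \<in> proj m (Inl v) L"
      if "x @ replicate (g + p) blank @ y \<in> proj m (Inl v) L"
      using main[OF that, of g] g by simp
  qed
qed

section \<open>Hanf locality\<close>

definition square :: "nat \<Rightarrow> (int \<times> int) set" where
  "square r = {- int r..int r} \<times> {- int r..int r}"

text \<open>Squares replace the balls of Hanf's theorem. Values are partial so that a view records
  where the picture ends, and coordinates are integers so that a view can extend beyond any
  border.\<close>

definition view :: "nat \<Rightarrow> (int \<times> int \<Rightarrow> 'a option) \<Rightarrow> int \<times> int \<Rightarrow> int \<times> int \<Rightarrow> 'a option" where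
  "view r P z = (\<lambda>d. if d \<in> square r then P (z + d) else None)"

definition census :: "nat \<Rightarrow> (int \<times> int \<Rightarrow> 'a option) \<Rightarrow> (int \<times> int \<Rightarrow> 'a option) \<Rightarrow> nat" where
  "census r P \<tau> = card {z \<in> dom P. view r P z = \<tau>}"

definition similar :: "nat \<Rightarrow> nat \<Rightarrow> (int \<times> int \<Rightarrow> 'a option) \<Rightarrow> (int \<times> int \<Rightarrow> 'a option) \<Rightarrow> bool" where
  "similar r t P P' \<longleftrightarrow> (\<forall>\<tau>. min t (census r P \<tau>) = min t (census r P' \<tau>))"

definition place :: "'a \<Rightarrow> int \<times> int \<Rightarrow> (int \<times> int \<Rightarrow> 'a set option) \<Rightarrow> int \<times> int \<Rightarrow> 'a set option" where
  "place v a P = (\<lambda>z. map_option (\<lambda>s. if z = a then insert v s else s - {v}) (P z))"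

lemma finite_square [simp]: "finite (square r)"
  by (simp add: square_def)

lemma card_square: "card (square r) = (2 * r + 1)\<^sup>2"
  by (simp add: square_def card_cartesian_product power2_eq_square algebra_simps nat_add_distrib nat_mult_distrib)

lemma zero_in_square [simp]: "0 \<in> square r"
  by (simp add: square_def zero_prod_def)

lemma square_add: "d \<in> square r \<Longrightarrow> d' \<in> square s \<Longrightarrow> d + d' \<in> square (r + s)"
  by (auto simp: square_def)

lemma square_mono: "r \<le> s \<Longrightarrow> d \<in> square r \<Longrightarrow> d \<in> square s"
  by (auto simp: square_def)

lemma dom_place [simp]: "dom (place v a P) = dom P"
  by (auto simp: place_def)

text \<open>Either some value in \<open>S\<close> fills the cap on both sides, or all counts of
  values in \<open>S\<close> are below the cap, hence exact, and add up.\<close>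

lemma capped_card_refine:
  fixes f :: "'a \<Rightarrow> 'c" and f' :: "'b \<Rightarrow> 'c"
  assumes fin: "finite A" "finite B"
    and eq: "\<And>\<tau>. min t (card {z \<in> A. f z = \<tau>}) = min t (card {z \<in> B. f' z = \<tau>})"
  shows "min t (card {z \<in> A. f z \<in> S}) = min t (card {z \<in> B. f' z \<in> S})"
proof (cases "\<exists>\<tau>\<in>S. t \<le> card {z \<in> A. f z = \<tau>}")
  case True
  then obtain \<tau> where \<tau>: "\<tau> \<in> S" "t \<le> card {z \<in> A. f z = \<tau>}" by blast
  then have "t \<le> card {z \<in> B. f' z = \<tau>}" using eq[of \<tau>] by linarith
  moreover have "card {z \<in> A. f z = \<tau>} \<le> card {z \<in> A. f z \<in> S}"
    "card {z \<in> B. f' z = \<tau>} \<le> card {z \<in> B. f' z \<in> S}"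
    using \<tau>(1) fin by (auto intro!: card_mono)
  ultimately show ?thesis using \<tau>(2) by linarith
next
  case False
  define T where "T = (f ` A \<union> f' ` B) \<inter> S"
  have T: "finite T" using fin by (simp add: T_def)
  have "card {z \<in> A. f z \<in> S} = card (\<Union>\<tau>\<in>T. {z \<in> A. f z = \<tau>})"
    by (rule arg_cong[of _ _ card]) (auto simp: T_def)
  also have "\<dots> = (\<Sum>\<tau>\<in>T. card {z \<in> A. f z = \<tau>})"
    using T fin by (intro card_UN_disjoint) auto
  also have "\<dots> = (\<Sum>\<tau>\<in>T. card {z \<in> B. f' z = \<tau>})"
  proof (rule sum.cong)
    fix \<tau> assume "\<tau> \<in> T"
    then have "card {z \<in> A. f z = \<tau>} < t" using False by (auto simp: T_def not_le)
    then show "card {z \<in> A. f z = \<tau>} = card {z \<in> B. f' z = \<tau>}" using eq[of \<tau>] by linarith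
  qed simp
  also have "\<dots> = card (\<Union>\<tau>\<in>T. {z \<in> B. f' z = \<tau>})"
    using T fin by (intro card_UN_disjoint[symmetric]) auto
  also have "\<dots> = card {z \<in> B. f' z \<in> S}"
    by (rule arg_cong[of _ _ card]) (auto simp: T_def)
  finally show ?thesis by simp
qed

lemma similar_refine:
  assumes "finite (dom P)" "finite (dom P')" "similar r t P P'"
  shows "min t (card {z \<in> dom P. view r P z \<in> S}) = min t (card {z \<in> dom P'. view r P' z \<in> S})"
  by (rule capped_card_refine) (use assms in \<open>auto simp: similar_def census_def\<close>)

lemma similar_mono:
  fixes P P' :: "int \<times> int \<Rightarrow> 'a option"
  assumes "finite (dom P)" "finite (dom P')" "similar r t P P'" "r' \<le> r" "t' \<le> t"
  shows "similar r' t' P P'"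
  unfolding similar_def census_def
proof
  fix \<tau> :: "int \<times> int \<Rightarrow> 'a option"
  define S where "S = {\<sigma>. (\<lambda>d. if d \<in> square r' then \<sigma> d else None) = \<tau>}"
  have v: "view r' Q z = (\<lambda>d. if d \<in> square r' then view r Q z d else None)"
    for Q :: "int \<times> int \<Rightarrow> 'a option" and z
    using square_mono[OF assms(4)] by (auto simp: view_def fun_eq_iff)
  have "min t (card {z \<in> dom P. view r P z \<in> S}) = min t (card {z \<in> dom P'. view r P' z \<in> S})"
    by (rule similar_refine[OF assms(1-3)])
  then have "min t (card {z \<in> dom P. view r' P z = \<tau>}) = min t (card {z \<in> dom P'. view r' P' z = \<tau>})"
    by (simp add: v S_def)
  then show "min t' (card {z \<in> dom P. view r' P z = \<tau>}) = min t' (card {z \<in> dom P'. view r' P' z = \<tau>})"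
    using assms(5) by linarith
qed

lemma card_ne_0_imp: "card A \<noteq> 0 \<Longrightarrow> A \<noteq> {}"
  by auto

text \<open>Choose \<open>a'\<close> with the same view of twice the radius. Placing \<open>v\<close> only erases its old copy at
  positions far from \<open>a\<close>, and the positions near \<open>a\<close> and near \<open>a'\<close>, which are too few to interfere
  with the larger cap, contribute equally.\<close>

lemma similar_place:
  fixes P P' :: "int \<times> int \<Rightarrow> 'a set option"
  assumes fin: "finite (dom P)" "finite (dom P')"
    and sim: "similar (2 * r) (t + (2 * r + 1)\<^sup>2) P P'" and a: "a \<in> dom P"
  obtains a' where "a' \<in> dom P'" "similar r t (place v a P) (place v a' P')"
proof -
  let ?B = "(2 * r + 1)\<^sup>2" and ?\<tau> = "view (2 * r) P a"
  have "census (2 * r) P ?\<tau> \<noteq> 0"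
  proof -
    have "a \<in> {z \<in> dom P. view (2 * r) P z = ?\<tau>}" using a by simp
    moreover have "finite {z \<in> dom P. view (2 * r) P z = ?\<tau>}" using fin(1) by simp
    ultimately show ?thesis unfolding census_def using card_0_eq by blast
  qed
  then have "census (2 * r) P' ?\<tau> \<noteq> 0"
  proof -
    have "y \<noteq> 0" if "min T x = min T y" "1 \<le> T" "x \<noteq> 0" for T x y :: nat
      using that by (auto simp: min_def split: if_splits)
    moreover have "1 \<le> t + ?B" by (simp add: power2_eq_square)
    ultimately show ?thesis
      using sim \<open>census (2 * r) P ?\<tau> \<noteq> 0\<close> unfolding similar_def by blast
  qed
  then have "{z \<in> dom P'. view (2 * r) P' z = ?\<tau>} \<noteq> {}"
    unfolding census_def by (rule card_ne_0_imp)
  then obtain a' where a': "a' \<in> dom P'" "view (2 * r) P' a' = ?\<tau>" by blast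
  have near: "P' (a' + d) = P (a + d)" if "d \<in> square (2 * r)" for d
    using fun_cong[OF a'(2), of d] that by (simp add: view_def)
  have sum2: "d + d' \<in> square (2 * r)" if "d \<in> square r" "d' \<in> square r" for d d'
    using square_add[OF that] by (simp add: mult_2)
  have r2: "d \<in> square (2 * r)" if "d \<in> square r" for d
    using square_mono[OF _ that, of "2 * r"] by simp
  have card_near: "card {z \<in> dom Q. z - b \<in> square r \<and> X z} = card {d \<in> square r. Q (b + d) \<noteq> None \<and> X (b + d)}"
    for Q :: "int \<times> int \<Rightarrow> 'a set option" and b X
  proof -
    have "{z \<in> dom Q. z - b \<in> square r \<and> X z} = (\<lambda>d. b + d) ` {d \<in> square r. Q (b + d) \<noteq> None \<and> X (b + d)}"
    proof (intro equalityI subsetI)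
      fix z assume "z \<in> {z \<in> dom Q. z - b \<in> square r \<and> X z}"
      then show "z \<in> (\<lambda>d. b + d) ` {d \<in> square r. Q (b + d) \<noteq> None \<and> X (b + d)}"
        by (intro image_eqI[of _ _ "z - b"]) auto
    qed auto
    then show ?thesis by (simp add: card_image inj_on_def)
  qed
  have "similar r t (place v a P) (place v a' P')"
    unfolding similar_def
  proof
    fix \<tau> :: "int \<times> int \<Rightarrow> 'a set option"
    \<comment> \<open>The effect of placing \<open>v\<close> on a view that does not contain the new
      position.\<close>
    define er :: "(int \<times> int \<Rightarrow> 'a set option) \<Rightarrow> int \<times> int \<Rightarrow> 'a set option"
      where "er = (\<lambda>\<sigma> d. map_option (\<lambda>s. s - {v}) (\<sigma> d))"
    define n h g where "n = (\<lambda>Q b. card {z \<in> dom Q. z - b \<in> square r \<and> view r (place v b Q) z = \<tau>})"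
      and "h = (\<lambda>Q b. card {z \<in> dom Q. z - b \<in> square r \<and> er (view r Q z) = \<tau>})"
      and "g = (\<lambda>Q. card {z \<in> dom Q. er (view r Q z) = \<tau>})"
    have far: "view r (place v b Q) z = er (view r Q z)" if "z - b \<notin> square r" for Q z b
    proof -
      have "z + d \<noteq> b" if "d \<in> square r" for d
      proof
        assume "z + d = b"
        then have "z - b = - d" by (metis add_diff_cancel_left' diff_add_cancel minus_diff_eq)
        moreover have "- d \<in> square r" using that by (auto simp: square_def)
        ultimately show False using \<open>z - b \<notin> square r\<close> by simp
      qed
      then show ?thesis by (auto simp: view_def er_def place_def fun_eq_iff map_option_case split: option.splits)
    qed
    \<comment> \<open>In the erased count \<open>g\<close>, the contribution \<open>h\<close> of the
      positions near \<open>b\<close> is replaced by their new contribution \<open>n\<close>; stated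
      additively to avoid truncated subtraction.\<close>
    have split: "census r (place v b Q) \<tau> + h Q b = g Q + n Q b" if Q: "finite (dom Q)" for Q b
    proof -
      define F where "F = card {z \<in> dom Q. z - b \<notin> square r \<and> er (view r Q z) = \<tau>}"
      have "census r (place v b Q) \<tau> =
          card ({z \<in> dom Q. z - b \<notin> square r \<and> er (view r Q z) = \<tau>} \<union>
                {z \<in> dom Q. z - b \<in> square r \<and> view r (place v b Q) z = \<tau>})"
        unfolding census_def by (rule arg_cong[of _ _ card]) (auto simp: far)
      also have "\<dots> = F + n Q b"
        unfolding F_def n_def using Q by (intro card_Un_disjoint) auto
      finally have 1: "census r (place v b Q) \<tau> = F + n Q b" .
      have "g Q = card ({z \<in> dom Q. z - b \<notin> square r \<and> er (view r Q z) = \<tau>} \<union>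
                {z \<in> dom Q. z - b \<in> square r \<and> er (view r Q z) = \<tau>})"
        unfolding g_def by (rule arg_cong[of _ _ card]) auto
      also have "\<dots> = F + h Q b"
        unfolding F_def h_def using Q by (intro card_Un_disjoint) auto
      finally show ?thesis using 1 by simp
    qed
    \<comment> \<open>A view centred within distance \<open>r\<close> of \<open>a\<close> reaches up
      to distance \<open>2 * r\<close>; hence the doubled radius.\<close>
    have vn: "view r P' (a' + d) = view r P (a + d)" if "d \<in> square r" for d
      using near sum2[OF that] by (auto simp: view_def fun_eq_iff add.assoc)
    have vp: "view r (place v a' P') (a' + d) = view r (place v a P) (a + d)" if "d \<in> square r" for d
      using near sum2[OF that] by (auto simp: view_def place_def fun_eq_iff add.assoc)
    have n: "n P' a' = n P a" and h: "h P' a' = h P a"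
      unfolding n_def h_def card_near
      by (rule arg_cong[of _ _ card], use near r2 vn vp in auto)+
    have hB: "h P a \<le> ?B"
      unfolding h_def card_near card_square[symmetric] by (rule card_mono) auto
    have "min (t + ?B) (g P) = min (t + ?B) (g P')"
    proof -
      have "min (t + ?B) (card {z \<in> dom P. view r P z \<in> {\<sigma>. er \<sigma> = \<tau>}}) =
          min (t + ?B) (card {z \<in> dom P'. view r P' z \<in> {\<sigma>. er \<sigma> = \<tau>}})"
        by (rule similar_refine[OF fin similar_mono[OF fin sim]]) auto
      then show ?thesis by (simp add: g_def)
    qed
    \<comment> \<open>Removing at most \<open>B\<close> from totals that agree up to the cap
      \<open>t + B\<close> leaves them in agreement up to \<open>t\<close>.\<close>
    moreover have "min t x = min t x'"
      if "x + y = w + z" "x' + y = w' + z" "y \<le> B" "min (t + B) w = min (t + B) w'"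
      for x x' y z w w' B :: nat
      using that by (auto simp: min_def split: if_splits)
    ultimately show "min t (census r (place v a P) \<tau>) = min t (census r (place v a' P') \<tau>)"
      using split[OF fin(1), of a] split[OF fin(2), of a', unfolded n h] hB by blast
  qed
  then show ?thesis using that a'(1) by blast
qed

text \<open>Only variables below \<open>b\<close> are recorded, which leaves finitely many views; a
  formula mentions only finitely many variables.\<close>

definition tracks :: "nat \<Rightarrow> (nat + nat) set" where
  "tracks b = Inl ` {..<b} \<union> Inr ` {..<b}"

definition plane :: "nat \<Rightarrow> (nat \<times> nat) set \<Rightarrow> (nat \<Rightarrow> nat \<times> nat) \<Rightarrow> (nat \<Rightarrow> (nat \<times> nat) set) \<Rightarrow>
    int \<times> int \<Rightarrow> (nat + nat) set option" where
  "plane b D e E = (\<lambda>(i, j). if 0 \<le> i \<and> 0 \<le> j \<and> (nat i, nat j) \<in> D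
     then Some {\<kappa> \<in> tracks b. case \<kappa> of Inl x \<Rightarrow> e x = (nat i, nat j) | Inr \<mu> \<Rightarrow> (nat i, nat j) \<in> E \<mu>}
     else None)"

definition intp :: "nat \<times> nat \<Rightarrow> int \<times> int" where
  "intp q = (int (fst q), int (snd q))"

lemma plane_intp: "plane b D e E (intp q) =
    (if q \<in> D then Some {\<kappa> \<in> tracks b. case \<kappa> of Inl x \<Rightarrow> e x = q | Inr \<mu> \<Rightarrow> q \<in> E \<mu>} else None)"
  by (cases q) (simp add: plane_def intp_def cong: sum.case_cong)

lemma dom_plane: "dom (plane b D e E) = intp ` D"
proof (intro equalityI subsetI)
  fix z assume "z \<in> dom (plane b D e E)"
  then show "z \<in> intp ` D"
    by (intro image_eqI[of _ _ "(nat (fst z), nat (snd z))"])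
       (auto simp: plane_def intp_def dom_def split: if_splits prod.splits)
qed (auto simp: plane_def intp_def)

lemma finite_dom_plane: "finite (dom (plane b (grid m n) e E))"
  by (simp add: dom_plane grid_def)

lemma plane_update:
  assumes "v < b" "a \<in> D"
  shows "plane b D (e(v := a)) E = place (Inl v) (intp a) (plane b D e E)"
proof
  fix z :: "int \<times> int"
  show "plane b D (e(v := a)) E z = place (Inl v) (intp a) (plane b D e E) z"
  proof (cases "z \<in> intp ` D")
    case True
    then obtain q where q: "z = intp q" "q \<in> D" by blast
    have "intp q = intp a \<longleftrightarrow> q = a" by (auto simp: intp_def prod_eq_iff)
    then show ?thesis
      using assms by (auto simp: q place_def plane_intp tracks_def split: sum.splits if_splits)
  next
    case False
    then have "plane b D e' E z = None" for e' using dom_plane[of b D e' E] by (auto simp: dom_def)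
    then show ?thesis by (simp add: place_def)
  qed
qed

definition hanf_local :: "nat \<Rightarrow> nat \<Rightarrow> nat \<Rightarrow> fm \<Rightarrow> bool" where
  "hanf_local b r t \<phi> \<longleftrightarrow> (\<forall>m n e E m' n' e' E'. assignment (grid m n) e E \<longrightarrow> assignment (grid m' n') e' E' \<longrightarrow>
     similar r t (plane b (grid m n) e E) (plane b (grid m' n') e' E') \<longrightarrow>
     sat (grid m n) e E \<phi> \<longrightarrow> sat (grid m' n') e' E' \<phi>)"

lemma similar_sym: "similar r t P P' \<Longrightarrow> similar r t P' P"
  by (simp add: similar_def)

lemma hanf_local_mono:
  assumes "hanf_local b r t \<phi>" "r \<le> r'" "t \<le> t'"
  shows "hanf_local b r' t' \<phi>"
  using assms(1) unfolding hanf_local_def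
  using similar_mono[OF finite_dom_plane finite_dom_plane _ assms(2,3)] by blast

text \<open>For the atomic formulas: each says that some position has a view in a fixed set, and the
  cap 1 is enough to detect one.\<close>

lemma hanf_local_by_view:
  assumes "\<And>m n e E. assignment (grid m n) e E \<Longrightarrow>
     sat (grid m n) e E \<phi> \<longleftrightarrow> (\<exists>z\<in>dom (plane b (grid m n) e E). view r (plane b (grid m n) e E) z \<in> S)"
  shows "hanf_local b r 1 \<phi>"
  unfolding hanf_local_def
proof (intro allI impI)
  fix m n e E m' n' e' E'
  let ?P = "plane b (grid m n) e E" and ?P' = "plane b (grid m' n') e' E'"
  assume as: "assignment (grid m n) e E" "assignment (grid m' n') e' E'"
    and sim: "similar r 1 ?P ?P'" and s: "sat (grid m n) e E \<phi>"
  have "card {z \<in> dom ?P. view r ?P z \<in> S} \<noteq> 0"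
    using s assms[OF as(1)] finite_dom_plane[of b m n e E] by auto
  then have "card {z \<in> dom ?P'. view r ?P' z \<in> S} \<noteq> 0"
    using similar_refine[OF finite_dom_plane finite_dom_plane sim, of S]
    by (cases "card {z \<in> dom ?P'. view r ?P' z \<in> S}") auto
  then have "{z \<in> dom ?P'. view r ?P' z \<in> S} \<noteq> {}" by (rule card_ne_0_imp)
  then show "sat (grid m' n') e' E' \<phi>" using assms[OF as(2)] by blast
qed

lemma hanf_local_Neg: "hanf_local b r t \<phi> \<Longrightarrow> hanf_local b r t (Neg \<phi>)"
  unfolding hanf_local_def using similar_sym by simp blast

lemma hanf_local_Conj: "hanf_local b r t \<phi> \<Longrightarrow> hanf_local b r t \<psi> \<Longrightarrow> hanf_local b r t (Conj \<phi> \<psi>)"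
  unfolding hanf_local_def sat.simps by blast

lemma hanf_local_Disj: "hanf_local b r t \<phi> \<Longrightarrow> hanf_local b r t \<psi> \<Longrightarrow> hanf_local b r t (Disj \<phi> \<psi>)"
  unfolding hanf_local_def sat.simps by blast

lemma hanf_local_Ex1:
  assumes \<phi>: "hanf_local b r t \<phi>" and "v < b"
  shows "hanf_local b (2 * r) (t + (2 * r + 1)\<^sup>2) (Ex1 v \<phi>)"
  unfolding hanf_local_def
proof (intro allI impI)
  fix m n e E m' n' e' E'
  let ?P = "plane b (grid m n) e E" and ?P' = "plane b (grid m' n') e' E'"
  assume as: "assignment (grid m n) e E" "assignment (grid m' n') e' E'"
    and sim: "similar (2 * r) (t + (2 * r + 1)\<^sup>2) ?P ?P'" and s: "sat (grid m n) e E (Ex1 v \<phi>)"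
  obtain a where a: "a \<in> grid m n" "sat (grid m n) (e(v := a)) E \<phi>" using s by auto
  have "intp a \<in> dom ?P" using a(1) by (simp add: dom_plane)
  then obtain z where z: "z \<in> dom ?P'" "similar r t (place (Inl v) (intp a) ?P) (place (Inl v) z ?P')"
    by (rule similar_place[OF finite_dom_plane finite_dom_plane sim])
  obtain a' where a': "a' \<in> grid m' n'" "z = intp a'" using z(1) by (auto simp: dom_plane)
  have "similar r t (plane b (grid m n) (e(v := a)) E) (plane b (grid m' n') (e'(v := a')) E')"
    using z(2) a(1) a' assms(2) by (simp add: plane_update)
  moreover have "assignment (grid m n) (e(v := a)) E" "assignment (grid m' n') (e'(v := a')) E'"
    using as a(1) a'(1) by (auto simp: assignment_def)
  ultimately have "sat (grid m' n') (e'(v := a')) E' \<phi>" using \<phi> a(2) unfolding hanf_local_def by blast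
  then show "sat (grid m' n') e' E' (Ex1 v \<phi>)" using a'(1) by auto
qed

lemma view_plane_intp:
  "d \<in> square r \<Longrightarrow> view r (plane b D e E) (intp q) d = plane b D e E (intp q + d)"
  by (simp add: view_def)

text \<open>All \<open>b\<close> from some \<open>b0\<close> on are covered so that subformulas can
  be given a common \<open>b\<close>; their radii and caps are then aligned by
  \<open>hanf_local_mono\<close>.\<close>

lemma hanf_local_FO:
  assumes "set_quantifier_free \<phi>"
  shows "\<exists>b0. \<forall>b\<ge>b0. \<exists>r t. hanf_local b r t \<phi>"
  using assms
proof (induction \<phi>)
  case (In \<mu> \<nu>)
  have "hanf_local b (Suc 0) 1 (In \<mu> \<nu>)" if "Suc (max \<mu> \<nu>) \<le> b" for b
  proof (rule hanf_local_by_view[where S = "{\<sigma>. \<exists>s. \<sigma> 0 = Some s \<and> Inl \<nu> \<in> s \<and> Inr \<mu> \<in> s}"])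
    fix m n e E assume as: "assignment (grid m n) e E"
    have "e \<nu> \<in> grid m n" using as by (simp add: assignment_def)
    then show "sat (grid m n) e E (In \<mu> \<nu>) \<longleftrightarrow> (\<exists>z\<in>dom (plane b (grid m n) e E).
        view (Suc 0) (plane b (grid m n) e E) z \<in> {\<sigma>. \<exists>s. \<sigma> 0 = Some s \<and> Inl \<nu> \<in> s \<and> Inr \<mu> \<in> s})"
      using that by (auto simp: dom_plane view_plane_intp plane_intp tracks_def)
  qed
  then show ?case by blast
next
  case (Eq x y)
  have "hanf_local b (Suc 0) 1 (Eq x y)" if "Suc (max x y) \<le> b" for b
  proof (rule hanf_local_by_view[where S = "{\<sigma>. \<exists>s. \<sigma> 0 = Some s \<and> Inl x \<in> s \<and> Inl y \<in> s}"])
    fix m n e E assume as: "assignment (grid m n) e E"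
    have "e x \<in> grid m n" using as by (simp add: assignment_def)
    then show "sat (grid m n) e E (Eq x y) \<longleftrightarrow> (\<exists>z\<in>dom (plane b (grid m n) e E).
        view (Suc 0) (plane b (grid m n) e E) z \<in> {\<sigma>. \<exists>s. \<sigma> 0 = Some s \<and> Inl x \<in> s \<and> Inl y \<in> s})"
      using that by (auto simp: dom_plane view_plane_intp plane_intp tracks_def)
  qed
  then show ?case by blast
next
  case (Succ1 x y)
  have "hanf_local b (Suc 0) 1 (Succ1 x y)" if "Suc (max x y) \<le> b" for b
  proof (rule hanf_local_by_view[where S = "{\<sigma>. \<exists>s s'. \<sigma> 0 = Some s \<and> \<sigma> (1, 0) = Some s' \<and> Inl x \<in> s \<and> Inl y \<in> s'}"])
    fix m n e E assume as: "assignment (grid m n) e E"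
    have e: "e x \<in> grid m n" "e y \<in> grid m n" using as by (auto simp: assignment_def)
    have d: "(1, 0) \<in> square (Suc 0)" by (simp add: square_def)
    have sh: "intp q + (1, 0) = intp (fst q + 1, snd q)" for q by (simp add: intp_def)
    show "sat (grid m n) e E (Succ1 x y) \<longleftrightarrow> (\<exists>z\<in>dom (plane b (grid m n) e E). view (Suc 0) (plane b (grid m n) e E) z
        \<in> {\<sigma>. \<exists>s s'. \<sigma> 0 = Some s \<and> \<sigma> (1, 0) = Some s' \<and> Inl x \<in> s \<and> Inl y \<in> s'})"
      using that e by (auto simp: dom_plane view_plane_intp[OF d] view_plane_intp[OF zero_in_square]
          plane_intp tracks_def sh split: if_splits)
  qed
  then show ?case by blast
next
  case (Succ2 x y)
  have "hanf_local b (Suc 0) 1 (Succ2 x y)" if "Suc (max x y) \<le> b" for b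
  proof (rule hanf_local_by_view[where S = "{\<sigma>. \<exists>s s'. \<sigma> 0 = Some s \<and> \<sigma> (0, 1) = Some s' \<and> Inl x \<in> s \<and> Inl y \<in> s'}"])
    fix m n e E assume as: "assignment (grid m n) e E"
    have e: "e x \<in> grid m n" "e y \<in> grid m n" using as by (auto simp: assignment_def)
    have d: "(0, 1) \<in> square (Suc 0)" by (simp add: square_def)
    have sh: "intp q + (0, 1) = intp (fst q, snd q + 1)" for q by (simp add: intp_def)
    show "sat (grid m n) e E (Succ2 x y) \<longleftrightarrow> (\<exists>z\<in>dom (plane b (grid m n) e E). view (Suc 0) (plane b (grid m n) e E) z
        \<in> {\<sigma>. \<exists>s s'. \<sigma> 0 = Some s \<and> \<sigma> (0, 1) = Some s' \<and> Inl x \<in> s \<and> Inl y \<in> s'})"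
      using that e by (auto simp: dom_plane view_plane_intp[OF d] view_plane_intp[OF zero_in_square]
          plane_intp tracks_def sh split: if_splits)
  qed
  then show ?case by blast
next
  case (Neg \<phi>)
  then obtain b0 where b0: "\<forall>b\<ge>b0. \<exists>r t. hanf_local b r t \<phi>" by auto
  then have "\<forall>b\<ge>b0. \<exists>r t. hanf_local b r t (Neg \<phi>)" using hanf_local_Neg by blast
  then show ?case by blast
next
  case (Conj \<phi> \<psi>)
  then obtain b0 b1 where b: "\<forall>b\<ge>b0. \<exists>r t. hanf_local b r t \<phi>" "\<forall>b\<ge>b1. \<exists>r t. hanf_local b r t \<psi>" by auto
  have "\<exists>r t. hanf_local b r t (Conj \<phi> \<psi>)" if "b \<ge> max b0 b1" for b
  proof -
    have "b0 \<le> b" "b1 \<le> b" using that by auto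
    then obtain r t r' t' where "hanf_local b r t \<phi>" "hanf_local b r' t' \<psi>" using b by blast
    then have "hanf_local b (max r r') (max t t') (Conj \<phi> \<psi>)"
      by (intro hanf_local_Conj) (auto intro: hanf_local_mono[OF _ max.cobounded1 max.cobounded1] hanf_local_mono[OF _ max.cobounded2 max.cobounded2])
    then show ?thesis by blast
  qed
  then show ?case by blast
next
  case (Disj \<phi> \<psi>)
  then obtain b0 b1 where b: "\<forall>b\<ge>b0. \<exists>r t. hanf_local b r t \<phi>" "\<forall>b\<ge>b1. \<exists>r t. hanf_local b r t \<psi>" by auto
  have "\<exists>r t. hanf_local b r t (Disj \<phi> \<psi>)" if "b \<ge> max b0 b1" for b
  proof -
    have "b0 \<le> b" "b1 \<le> b" using that by auto
    then obtain r t r' t' where "hanf_local b r t \<phi>" "hanf_local b r' t' \<psi>" using b by blast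
    then have "hanf_local b (max r r') (max t t') (Disj \<phi> \<psi>)"
      by (intro hanf_local_Disj) (auto intro: hanf_local_mono[OF _ max.cobounded1 max.cobounded1] hanf_local_mono[OF _ max.cobounded2 max.cobounded2])
    then show ?thesis by blast
  qed
  then show ?case by blast
next
  case (Ex1 v \<phi>)
  then obtain b0 where b0: "\<forall>b\<ge>b0. \<exists>r t. hanf_local b r t \<phi>" by auto
  have "\<forall>b\<ge>max b0 (Suc v). \<exists>r t. hanf_local b r t (Ex1 v \<phi>)"
  proof (intro allI impI)
    fix b assume "max b0 (Suc v) \<le> b"
    then have "b0 \<le> b" "v < b" by auto
    then show "\<exists>r t. hanf_local b r t (Ex1 v \<phi>)" using b0 hanf_local_Ex1 by blast
  qed
  then show ?case by blast
next
  case (All1 v \<phi>)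
  then obtain b0 where b0: "\<forall>b\<ge>b0. \<exists>r t. hanf_local b r t \<phi>" by auto
  have "\<exists>r t. hanf_local b r t (All1 v \<phi>)" if "b \<ge> max b0 (Suc v)" for b
  proof -
    have "b0 \<le> b" using that by simp
    then obtain r t where "hanf_local b r t \<phi>" using b0 by blast
    then have "hanf_local b (2 * r) (t + (2 * r + 1)\<^sup>2) (Neg (Ex1 v (Neg \<phi>)))"
      using that by (intro hanf_local_Neg hanf_local_Ex1) auto
    then have "hanf_local b (2 * r) (t + (2 * r + 1)\<^sup>2) (All1 v \<phi>)" by (simp add: hanf_local_def)
    then show ?thesis by blast
  qed
  then show ?case by blast
qed auto

section \<open>Views in words of columns: first-order formulas have index
  \<open>2 ^ O(m)\<close>\<close>

definition cells :: "nat \<Rightarrow> nat \<Rightarrow> letter \<Rightarrow> ((nat + nat) \<times> nat) set" where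
  "cells b m l = {(\<kappa>, i). \<kappa> \<in> tracks b \<and> 1 \<le> i \<and> i \<le> m \<and> i \<in> l \<kappa>}"

text \<open>The same plane read off the columns, so that concatenation of words becomes a horizontal
  shift.\<close>

definition strip :: "nat \<Rightarrow> nat \<Rightarrow> letter list \<Rightarrow> int \<times> int \<Rightarrow> (nat + nat) set option" where
  "strip b m w = (\<lambda>(i, j). if 1 \<le> i \<and> i \<le> int m \<and> 1 \<le> j \<and> j \<le> int (length w)
     then Some {\<kappa>. (\<kappa>, nat i) \<in> cells b m (w ! (nat j - 1))} else None)"

lemma plane_dec:
  assumes "w \<in> valid m"
  shows "plane b (grid m (length w)) (dec_fo w) (dec_set w) = strip b m w"
proof (rule ext, clarify)
  fix i j :: int
  show "plane b (grid m (length w)) (dec_fo w) (dec_set w) (i, j) = strip b m w (i, j)"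
  proof (cases "1 \<le> i \<and> i \<le> int m \<and> 1 \<le> j \<and> j \<le> int (length w)")
    case True
    then obtain j' where j': "nat j = Suc j'" "j' < length w"
      by (metis Suc_le_lessD gr0_implies_Suc nat_le_iff zero_less_nat_eq zless_imp_add1_zle linorder_not_le int_one_le_iff_zero_less)
    have i: "1 \<le> nat i" "nat i \<le> m" using True by auto
    have g: "(nat i, nat j) \<in> grid m (length w)" using True by (auto simp: grid_def)
    have "{\<kappa> \<in> tracks b. case \<kappa> of Inl x \<Rightarrow> dec_fo w x = (nat i, nat j) | Inr \<mu> \<Rightarrow> (nat i, nat j) \<in> dec_set w \<mu>}
        = {\<kappa>. (\<kappa>, nat i) \<in> cells b m (w ! (nat j - 1))}"
    proof (rule Set.set_eqI)
      fix \<kappa>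
      show "\<kappa> \<in> {\<kappa> \<in> tracks b. case \<kappa> of Inl x \<Rightarrow> dec_fo w x = (nat i, nat j) | Inr \<mu> \<Rightarrow> (nat i, nat j) \<in> dec_set w \<mu>}
        \<longleftrightarrow> \<kappa> \<in> {\<kappa>. (\<kappa>, nat i) \<in> cells b m (w ! (nat j - 1))}"
        using i j' by (cases \<kappa>) (auto simp: cells_def dec_fo_iff[OF assms] dec_set_iff)
    qed
    then show ?thesis using True g by (simp add: plane_def strip_def)
  next
    case False
    then have "\<not> (0 \<le> i \<and> 0 \<le> j \<and> (nat i, nat j) \<in> grid m (length w))" by (auto simp: grid_def)
    then show ?thesis using False unfolding plane_def strip_def by auto
  qed
qed

lemma finite_dom_strip: "finite (dom (strip b m w))"
proof (rule finite_subset)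
  show "dom (strip b m w) \<subseteq> {1..int m} \<times> {1..int (length w)}"
    by (auto simp: strip_def split: if_splits)
qed simp

lemma strip_cong:
  assumes "map (cells b m) w = map (cells b m) w'"
  shows "strip b m w = strip b m w'"
proof -
  have l: "length w = length w'" using assms map_eq_imp_length_eq by blast
  have "cells b m (w ! j) = cells b m (w' ! j)" if "j < length w" for j
    using assms that l by (metis nth_map)
  then show ?thesis using l unfolding strip_def by (intro ext) auto
qed

lemma strip_append_left: "j \<le> int (length x) \<Longrightarrow> strip b m (x @ y) (i, j) = strip b m x (i, j)"
  by (auto simp: strip_def nth_append)

lemma strip_append_right: "int (length x) < j \<Longrightarrow> strip b m (x @ y) (i, j) = strip b m y (i, j - int (length x))"
proof -
  assume "int (length x) < j"
  then have "j = int (length x) + int (Suc (nat (j - int (length x) - 1)))" by simp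
  then obtain k where k: "j = int (length x) + int (Suc k)" by blast
  moreover have "nat (int (length x) + int (Suc k)) - 1 = length x + k" "nat (int (Suc k)) - 1 = k"
    by simp_all
  ultimately show ?thesis by (simp add: strip_def nth_append del: of_nat_Suc)
qed

definition views :: "nat \<Rightarrow> nat \<Rightarrow> (int \<times> int \<Rightarrow> (nat + nat) set option) set" where
  "views b r = {\<sigma>. \<forall>d. (d \<in> square r \<longrightarrow> \<sigma> d \<in> insert None (Some ` Pow (tracks b))) \<and> (d \<notin> square r \<longrightarrow> \<sigma> d = None)}"

lemma finite_tracks [simp]: "finite (tracks b)"
  by (simp add: tracks_def)

lemma card_tracks: "card (tracks b) = 2 * b"
  unfolding tracks_def by (subst card_Un_disjoint) (auto simp: card_image)

lemma finite_views: "finite (views b r)"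
  unfolding views_def by (rule finite_set_of_finite_funs) auto

lemma view_strip_in_views: "view r (strip b m w) z \<in> views b r"
  by (auto simp: views_def view_def strip_def cells_def split: prod.splits)

text \<open>Counts positions whose views stay, horizontally, inside \<open>u\<close>; these views
  are the same in every context.\<close>

definition inner_census :: "nat \<Rightarrow> nat \<Rightarrow> nat \<Rightarrow> letter list \<Rightarrow> (int \<times> int \<Rightarrow> (nat + nat) set option) \<Rightarrow> nat" where
  "inner_census r b m u \<tau> = card {z \<in> dom (strip b m u).
     (int r < snd z \<and> snd z \<le> int (length u) - int r) \<and> view r (strip b m u) z = \<tau>}"

text \<open>The margins of a long word decide the views of all positions within or close to its context; the
  first component is the whole word if that has length at most \<open>4 * r\<close>.\<close>

definition key where
  "key r t b m u = (map (cells b m) (take (4 * r + 1) u), map (cells b m) (drop (length u - 2 * r) u),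
     restrict (\<lambda>\<tau>. min t (inner_census r b m u \<tau>)) (views b r))"

lemma card_views_shift:
  assumes "\<And>z d. c z \<Longrightarrow> d \<in> square r \<Longrightarrow> P' (z + s + d) = P (z + d)"
    and "\<And>z. c z \<longleftrightarrow> c' (z + s)"
  shows "card {z \<in> dom P. c z \<and> view r P z = \<tau>} = card {z \<in> dom P'. c' z \<and> view r P' z = \<tau>}"
proof -
  have v: "view r P' (z + s) = view r P z" if "c z" for z
    using assms(1)[OF that] by (auto simp: view_def fun_eq_iff)
  have d: "z + s \<in> dom P' \<longleftrightarrow> z \<in> dom P" if "c z" for z
    using assms(1)[OF that zero_in_square] by (auto simp: dom_def)
  have "{z \<in> dom P'. c' z \<and> view r P' z = \<tau>} = (\<lambda>z. z + s) ` {z \<in> dom P. c z \<and> view r P z = \<tau>}"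
  proof (intro equalityI subsetI)
    fix z assume "z \<in> {z \<in> dom P'. c' z \<and> view r P' z = \<tau>}"
    then show "z \<in> (\<lambda>z. z + s) ` {z \<in> dom P. c z \<and> view r P z = \<tau>}"
      using v[of "z - s"] d[of "z - s"] assms(2)[of "z - s"]
      by (intro image_eqI[of _ _ "z - s"]) auto
  next
    fix z' assume "z' \<in> (\<lambda>z. z + s) ` {z \<in> dom P. c z \<and> view r P z = \<tau>}"
    then obtain z where "z' = z + s" "z \<in> dom P" "c z" "view r P z = \<tau>" by blast
    then show "z' \<in> {z \<in> dom P'. c' z \<and> view r P' z = \<tau>}"
      using v[of z] d[of z] assms(2)[of z] by blast
  qed
  then show ?thesis by (simp add: card_image inj_on_def)
qed

text \<open>For long \<open>u\<close>, the positions of \<open>x @ u @ y\<close> are split into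
  those up to column \<open>r\<close> of \<open>u\<close>, the inner ones, and those from the last
  \<open>r\<close> columns of \<open>u\<close> on. The outer views reach at most
  \<open>2 * r\<close> columns into \<open>u\<close>, where the margins agree; the inner counts
  agree up to the cap.\<close>

lemma key_similar:
  assumes key: "key r t b m u = key r t b m v"
  shows "similar r t (strip b m (x @ u @ y)) (strip b m (x @ v @ y))"
proof -
  have tk: "map (cells b m) (take (4 * r + 1) u) = map (cells b m) (take (4 * r + 1) v)"
    and dr: "map (cells b m) (drop (length u - 2 * r) u) = map (cells b m) (drop (length v - 2 * r) v)"
    and inr: "restrict (\<lambda>\<tau>. min t (inner_census r b m u \<tau>)) (views b r) = restrict (\<lambda>\<tau>. min t (inner_census r b m v \<tau>)) (views b r)"
    using key by (simp_all add: key_def)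
  \<comment> \<open>The extra column in the first margin reveals whether a word is longer than
    \<open>4 * r\<close>.\<close>
  have len: "min (4 * r + 1) (length u) = min (4 * r + 1) (length v)"
    using arg_cong[OF tk, of length] by (simp add: min.commute)
  show ?thesis
  proof (cases "length u \<le> 4 * r")
    case True
    then have "length v \<le> 4 * r" using len by linarith
    then have "map (cells b m) u = map (cells b m) v" using tk True by simp
    then have "strip b m (x @ u @ y) = strip b m (x @ v @ y)" by (intro strip_cong) simp
    then show ?thesis by (simp add: similar_def)
  next
    case False
    then have lu: "4 * r < length u" and lv: "4 * r < length v" using len by linarith+
    let ?P = "strip b m (x @ u @ y)" and ?P' = "strip b m (x @ v @ y)"
    define a p q where "a = int (length x)" and "p = int (length u)" and "q = int (length v)"
    have pq: "4 * int r < p" "4 * int r < q" using lu lv by (auto simp: p_def q_def)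
    have L: "?P' (i, j) = ?P (i, j)" if "j \<le> a + 2 * int r" for i j
    proof -
      have dec: "x @ w @ y = (x @ take (2 * r) w) @ (drop (2 * r) w @ y)" for w by simp
      have "map (cells b m) (take (2 * r) u) = map (cells b m) (take (2 * r) v)"
        using arg_cong[OF tk, of "take (2 * r)"] by (simp add: take_map)
      then have "strip b m (x @ take (2 * r) u) = strip b m (x @ take (2 * r) v)"
        by (intro strip_cong) simp
      then show ?thesis
        unfolding dec[of u] dec[of v] using that lu lv by (subst (1 2) strip_append_left) (auto simp: a_def)
    qed
    have R: "?P' (i, j + (q - p)) = ?P (i, j)" if "a + p - 2 * int r < j" for i j
    proof -
      have dec: "x @ w @ y = (x @ take (length w - 2 * r) w) @ (drop (length w - 2 * r) w @ y)" for w by simp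
      have "strip b m (drop (length u - 2 * r) u @ y) = strip b m (drop (length v - 2 * r) v @ y)"
        using dr by (intro strip_cong) simp
      then show ?thesis
        unfolding dec[of u] dec[of v] using that lu lv
        by (subst (1 2) strip_append_right) (auto simp: a_def p_def q_def of_nat_diff algebra_simps)
    qed
    have M: "strip b m (x @ w @ y) (i, j + a) = strip b m w (i, j)" if "0 < j" "j \<le> int (length w)" for w i j
      using that by (subst strip_append_right) (auto simp: a_def strip_append_left)
    have split: "census r (strip b m (x @ w @ y)) \<tau> =
        card {z \<in> dom (strip b m (x @ w @ y)). snd z \<le> a + int r \<and> view r (strip b m (x @ w @ y)) z = \<tau>} +
        inner_census r b m w \<tau> +
        card {z \<in> dom (strip b m (x @ w @ y)). a + int (length w) - int r < snd z \<and> view r (strip b m (x @ w @ y)) z = \<tau>}"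
      if w: "4 * r < length w" for w \<tau>
    proof -
      let ?Q = "strip b m (x @ w @ y)"
      have "inner_census r b m w \<tau> = card {z \<in> dom ?Q. (a + int r < snd z \<and> snd z \<le> a + int (length w) - int r) \<and> view r ?Q z = \<tau>}"
        unfolding inner_census_def
      proof (rule card_views_shift[where s = "(0, a)"])
        fix z d :: "int \<times> int"
        assume z: "int r < snd z \<and> snd z \<le> int (length w) - int r" and d: "d \<in> square r"
        have "0 < snd z + snd d" "snd z + snd d \<le> int (length w)" using z d by (auto simp: square_def)
        from M[OF this, of "fst z + fst d"] show "?Q (z + (0, a) + d) = strip b m w (z + d)"
          by (cases z; cases d) (simp add: algebra_simps)
      qed auto
      moreover have "census r ?Q \<tau> = card (({z \<in> dom ?Q. snd z \<le> a + int r \<and> view r ?Q z = \<tau>} \<union>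
          {z \<in> dom ?Q. (a + int r < snd z \<and> snd z \<le> a + int (length w) - int r) \<and> view r ?Q z = \<tau>}) \<union>
          {z \<in> dom ?Q. a + int (length w) - int r < snd z \<and> view r ?Q z = \<tau>})"
        unfolding census_def by (rule arg_cong[of _ _ card]) auto
      ultimately show ?thesis
        using w finite_dom_strip[of b m "x @ w @ y"]
        by (subst (asm) card_Un_disjoint, simp, simp, force, subst (asm) card_Un_disjoint) auto
    qed
    have left: "card {z \<in> dom ?P. snd z \<le> a + int r \<and> view r ?P z = \<tau>} =
        card {z \<in> dom ?P'. snd z \<le> a + int r \<and> view r ?P' z = \<tau>}" for \<tau>
    proof (rule card_views_shift[where s = 0])
      fix z d :: "int \<times> int" assume "snd z \<le> a + int r" "d \<in> square r"
      then show "?P' (z + 0 + d) = ?P (z + d)"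
        using L[of "snd z + snd d" "fst z + fst d"] by (cases z; cases d) (auto simp: square_def)
    qed simp
    have right: "card {z \<in> dom ?P. a + p - int r < snd z \<and> view r ?P z = \<tau>} =
        card {z \<in> dom ?P'. a + q - int r < snd z \<and> view r ?P' z = \<tau>}" for \<tau>
    proof (rule card_views_shift[where s = "(0, q - p)"])
      fix z d :: "int \<times> int" assume "a + p - int r < snd z" "d \<in> square r"
      then show "?P' (z + (0, q - p) + d) = ?P (z + d)"
        using R[of "snd z + snd d" "fst z + fst d"] by (cases z; cases d) (auto simp: square_def algebra_simps)
    qed auto
    have mid: "min t (inner_census r b m u \<tau>) = min t (inner_census r b m v \<tau>)" for \<tau>
    proof (cases "\<tau> \<in> views b r")
      case True
      then show ?thesis using fun_cong[OF inr, of \<tau>] by simp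
    next
      case False
      \<comment> \<open>Views outside \<open>views b r\<close> never occur, so the key may be
        restricted to this finite set.\<close>
      have "inner_census r b m w \<tau> = 0" for w
      proof -
        have "{z \<in> dom (strip b m w). (int r < snd z \<and> snd z \<le> int (length w) - int r) \<and>
            view r (strip b m w) z = \<tau>} = {}"
          using view_strip_in_views False by blast
        then show ?thesis unfolding inner_census_def by (simp only: card.empty)
      qed
      then show ?thesis by simp
    qed
    show ?thesis unfolding similar_def
    proof
      fix \<tau>
      show "min t (census r ?P \<tau>) = min t (census r ?P' \<tau>)"
        using split[OF lu, of \<tau>] split[OF lv, of \<tau>] left[of \<tau>] right[of \<tau>] mid[of \<tau>]
        unfolding p_def q_def by linarith
    qed
  qed
qed

lemma card_short_lists_le:
  assumes "finite A" "1 \<le> card A"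
  shows "card {xs. set xs \<subseteq> A \<and> length xs \<le> n} \<le> (n + 1) * card A ^ n"
proof -
  have "card {xs. set xs \<subseteq> A \<and> length xs \<le> n} = (\<Sum>i\<le>n. card A ^ i)"
    using assms by (simp add: card_lists_length_le)
  also have "\<dots> \<le> (\<Sum>i\<le>n. card A ^ n)"
    by (intro sum_mono power_increasing) (use assms in auto)
  finally show ?thesis by simp
qed

lemma FO_tower_index: "FO \<subseteq> tower_index 0"
proof
  fix \<phi> assume "\<phi> \<in> FO"
  then obtain b r t where loc: "hanf_local b r t \<phi>"
    using hanf_local_FO[of \<phi>] unfolding FO_def by blast
  define K where "K = card (views b r)"
  \<comment> \<open>One summand for each component of the key. Only the contents of the two margins,
    \<open>2 * b * m\<close> bits per column, grow with \<open>m\<close>; the number of capped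
    counts is a constant.\<close>
  define c where "c = (4 * r + 2) + 2 * b * (4 * r + 1) + ((2 * r + 1) + 2 * b * (2 * r)) + (t + 1) * K"
  have "index_le m (lang m \<phi>) (tower 0 (c * m))" if m: "m \<ge> 1" for m
  proof -
    let ?A = "Pow (tracks b \<times> {1..m})"
    let ?L = "\<lambda>n. {xs. set xs \<subseteq> ?A \<and> length xs \<le> n}"
    let ?S = "?L (4 * r + 1) \<times> ?L (2 * r) \<times> (views b r \<rightarrow>\<^sub>E {..t})"
    have A: "finite ?A" "card ?A = 2 ^ (2 * b * m)"
      by (simp_all add: card_Pow card_cartesian_product card_tracks)
    have Ln: "card (?L n) \<le> 2 ^ ((n + 1 + 2 * b * n) * m)" for n
    proof -
      have "card (?L n) \<le> (n + 1) * card ?A ^ n" by (rule card_short_lists_le) (use A in auto)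
      also have "\<dots> \<le> 2 ^ (n + 1) * 2 ^ (2 * b * m * n)"
        unfolding A power_mult[symmetric] by (intro mult_mono less_imp_le[OF less_exp]) auto
      also have "\<dots> \<le> 2 ^ ((n + 1) * m) * 2 ^ (2 * b * m * n)"
      proof -
        have "n + 1 \<le> (n + 1) * m" using m by (cases m) auto
        then show ?thesis by (intro mult_mono power_increasing) auto
      qed
      finally show ?thesis by (simp add: power_add[symmetric] algebra_simps)
    qed
    have V: "card (views b r \<rightarrow>\<^sub>E {..t}) \<le> 2 ^ ((t + 1) * K * m)"
    proof -
      have "card (views b r \<rightarrow>\<^sub>E {..t}) = (t + 1) ^ K" by (simp add: card_PiE finite_views K_def)
      also have "\<dots> \<le> (2 ^ (t + 1)) ^ K" by (intro power_mono less_imp_le less_exp) auto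
      also have "\<dots> \<le> 2 ^ ((t + 1) * K * m)"
        unfolding power_mult[symmetric] using m by (intro power_increasing) auto
      finally show ?thesis .
    qed
    have "card ?S = card (?L (4 * r + 1)) * (card (?L (2 * r)) * card (views b r \<rightarrow>\<^sub>E {..t}))"
      by (simp add: card_cartesian_product)
    also have "\<dots> \<le> 2 ^ ((4 * r + 1 + 1 + 2 * b * (4 * r + 1)) * m) *
        (2 ^ ((2 * r + 1 + 2 * b * (2 * r)) * m) * 2 ^ ((t + 1) * K * m))"
      by (intro mult_mono Ln V) auto
    also have "\<dots> = 2 ^ (c * m)" by (simp add: c_def power_add[symmetric] algebra_simps)
    finally have card: "card ?S \<le> tower 0 (c * m)" by simp
    have cells_sub: "cells b m l \<in> ?A" for l by (auto simp: cells_def)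
    have range: "range (key r t b m) \<subseteq> ?S"
    proof -
      have "set (map (cells b m) w) \<subseteq> ?A" for w unfolding set_map using cells_sub by blast
      then show ?thesis by (auto simp: key_def simp del: set_map)
    qed
    show ?thesis
    proof (rule index_leI[OF _ range card])
      show "finite ?S"
        using A(1) by (intro finite_cartesian_product finite_lists_length_le finite_PiE finite_views) auto
      fix u v x y
      assume k: "key r t b m u = key r t b m v" and v: "x @ v @ y \<in> valid m" and u: "x @ u @ y \<in> lang m \<phi>"
      have u': "x @ u @ y \<in> valid m" by (rule lang_valid[OF u])
      have "sat (grid m (length (x @ u @ y))) (dec_fo (x @ u @ y)) (dec_set (x @ u @ y)) \<phi>"
        using u by (simp add: lang_def)
      moreover have "similar r t (strip b m (x @ u @ y)) (strip b m (x @ v @ y))" by (rule key_similar[OF k])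
      ultimately have "sat (grid m (length (x @ v @ y))) (dec_fo (x @ v @ y)) (dec_set (x @ v @ y)) \<phi>"
        using loc assignment_dec[OF u'] assignment_dec[OF v] plane_dec[OF u'] plane_dec[OF v]
        unfolding hanf_local_def by metis
      then show "x @ v @ y \<in> lang m \<phi>" using v by (simp add: lang_def)
    qed
  qed
  moreover have "c \<ge> 1" by (simp add: c_def)
  ultimately show "\<phi> \<in> tower_index 0" unfolding tower_index_def by blast
qed

section \<open>First-order closure on unlabelled grids\<close>

text \<open>The period is bounded along with the threshold because each first-order quantifier adds
  it to the threshold.\<close>

definition tower_pumpable :: "nat \<Rightarrow> fm set" where
  "tower_pumpable k = {\<phi>. \<exists>c\<ge>1. \<forall>m\<ge>1. \<exists>T p. 1 \<le> p \<and> T \<le> tower k (c * m) \<and> p \<le> tower k (c * m) \<and>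
     pumpable T p (lang m \<phi>)}"

lemma tower_pumpableD:
  assumes "\<phi> \<in> tower_pumpable k"
  obtains c where "c \<ge> 1" "\<And>m. m \<ge> 1 \<Longrightarrow> \<exists>T p. 1 \<le> p \<and> T \<le> tower k (c * m) \<and> p \<le> tower k (c * m) \<and>
     pumpable T p (lang m \<phi>)"
proof -
  have "\<exists>c. c \<ge> 1 \<and> (\<forall>m\<ge>1. \<exists>T p. 1 \<le> p \<and> T \<le> tower k (c * m) \<and> p \<le> tower k (c * m) \<and>
     pumpable T p (lang m \<phi>))"
    using assms unfolding tower_pumpable_def by (rule CollectD)
  then obtain c where "c \<ge> 1" and c: "\<forall>m\<ge>1. \<exists>T p. 1 \<le> p \<and> T \<le> tower k (c * m) \<and> p \<le> tower k (c * m) \<and>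
     pumpable T p (lang m \<phi>)"
    by (elim exE conjE)
  show thesis by (rule that[OF \<open>c \<ge> 1\<close> c[rule_format]])
qed

lemma pumpable_compl: "pumpable T p L \<Longrightarrow> pumpable T p (valid m - L)"
  unfolding pumpable_def Diff_iff valid_replicate_blank by blast

lemma pumpable_Int: "pumpable T p L \<Longrightarrow> pumpable T p L' \<Longrightarrow> pumpable T p (L \<inter> L')"
  unfolding pumpable_def Int_iff by (intro allI impI) (erule allE, erule allE, erule (1) impE, blast)

lemma tower_pumpable_Neg:
  assumes "\<phi> \<in> tower_pumpable k"
  shows "Neg \<phi> \<in> tower_pumpable k"
proof -
  obtain c where c: "c \<ge> 1" "\<And>m. m \<ge> 1 \<Longrightarrow> \<exists>T p. 1 \<le> p \<and> T \<le> tower k (c * m) \<and> p \<le> tower k (c * m) \<and>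
     pumpable T p (lang m \<phi>)"
    by (rule tower_pumpableD[OF assms]) blast
  have "\<exists>T p. 1 \<le> p \<and> T \<le> tower k (c * m) \<and> p \<le> tower k (c * m) \<and> pumpable T p (lang m (Neg \<phi>))"
    if "m \<ge> 1" for m
    using c(2)[OF that] pumpable_compl unfolding lang_Neg by blast
  then show ?thesis using c(1) unfolding tower_pumpable_def by blast
qed

text \<open>The product of the two periods is a common period, and the larger threshold serves both
  formulas.\<close>

lemma tower_pumpable_Conj:
  assumes "\<phi> \<in> tower_pumpable k" "\<psi> \<in> tower_pumpable k"
  shows "Conj \<phi> \<psi> \<in> tower_pumpable k"
proof -
  obtain c where c: "c \<ge> 1" "\<And>m. m \<ge> 1 \<Longrightarrow> \<exists>T p. 1 \<le> p \<and> T \<le> tower k (c * m) \<and> p \<le> tower k (c * m) \<and>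
     pumpable T p (lang m \<phi>)"
    by (rule tower_pumpableD[OF assms(1)]) blast
  obtain d where d: "d \<ge> 1" "\<And>m. m \<ge> 1 \<Longrightarrow> \<exists>T p. 1 \<le> p \<and> T \<le> tower k (d * m) \<and> p \<le> tower k (d * m) \<and>
     pumpable T p (lang m \<psi>)"
    by (rule tower_pumpableD[OF assms(2)]) blast
  have "\<exists>T p. 1 \<le> p \<and> T \<le> tower k ((c + d) * m) \<and> p \<le> tower k ((c + d) * m) \<and> pumpable T p (lang m (Conj \<phi> \<psi>))"
    if m: "m \<ge> 1" for m
  proof -
    obtain T p where p: "1 \<le> p" "T \<le> tower k (c * m)" "p \<le> tower k (c * m)" "pumpable T p (lang m \<phi>)"
      using c(2)[OF m] by blast
    obtain T' p' where p': "1 \<le> p'" "T' \<le> tower k (d * m)" "p' \<le> tower k (d * m)" "pumpable T' p' (lang m \<psi>)"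
      using d(2)[OF m] by blast
    have "pumpable (max T T') (p' * p) (lang m \<phi>)" "pumpable (max T T') (p * p') (lang m \<psi>)"
      using pumpable_mult[OF p(4), of "max T T'"] pumpable_mult[OF p'(4), of "max T T'"] by auto
    then have "pumpable (max T T') (p * p') (lang m (Conj \<phi> \<psi>))"
      unfolding lang_Conj by (intro pumpable_Int) (simp_all add: mult.commute)
    moreover have "max T T' \<le> tower k ((c + d) * m)"
    proof -
      have "tower k (c * m) \<le> tower k ((c + d) * m)" "tower k (d * m) \<le> tower k ((c + d) * m)"
        by (simp_all add: tower_mono)
      then show ?thesis using p(2) p'(2) by simp
    qed
    moreover have "p * p' \<le> tower k ((c + d) * m)"
    proof -
      have "p * p' \<le> tower k (c * m) * tower k (d * m)" using p(3) p'(3) by (rule mult_le_mono)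
      also have "\<dots> \<le> tower k ((c + d) * m)"
        unfolding add_mult_distrib using c(1) d(1) m by (intro tower_mult) auto
      finally show ?thesis .
    qed
    moreover have "1 \<le> p * p'" using p(1) p'(1) by simp
    ultimately show ?thesis by blast
  qed
  moreover have "c + d \<ge> 1" using c(1) by simp
  ultimately show ?thesis unfolding tower_pumpable_def by blast
qed

lemma tower_pumpable_cong:
  assumes "\<phi> \<in> tower_pumpable k" "\<And>m. lang m \<phi> = lang m \<psi>"
  shows "\<psi> \<in> tower_pumpable k"
  using assms unfolding tower_pumpable_def by simp

lemma tower_pumpable_Ex1:
  assumes "\<phi> \<in> tower_pumpable k"
  shows "Ex1 v \<phi> \<in> tower_pumpable k"
proof -
  obtain c where c: "c \<ge> 1" "\<And>m. m \<ge> 1 \<Longrightarrow> \<exists>T p. 1 \<le> p \<and> T \<le> tower k (c * m) \<and> p \<le> tower k (c * m) \<and>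
     pumpable T p (lang m \<phi>)"
    by (rule tower_pumpableD[OF assms]) blast
  have "\<exists>T p. 1 \<le> p \<and> T \<le> tower k ((c + 2) * m) \<and> p \<le> tower k ((c + 2) * m) \<and> pumpable T p (lang m (Ex1 v \<phi>))"
    if m: "m \<ge> 1" for m
  proof -
    obtain T p where p: "1 \<le> p" "T \<le> tower k (c * m)" "p \<le> tower k (c * m)" "pumpable T p (lang m \<phi>)"
      using c(2)[OF m] by blast
    have "pumpable (2 * T + p) p (lang m (Ex1 v \<phi>))"
      unfolding lang_Ex1 by (rule pumpable_proj_fo[OF p(4) lang_subset])
    moreover have "2 * T + p \<le> tower k ((c + 2) * m)"
    proof -
      \<comment> \<open>The new threshold \<open>2 * T + p\<close> is at most three times the old
        bound, and the factor 3 fits into \<open>tower k (2 * m)\<close>.\<close>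
      have "3 \<le> tower k (2 * m)" using tower_ge[of "2 * m" k] m by linarith
      then have "tower k (c * m) * 3 \<le> tower k (c * m) * tower k (2 * m)" by (rule mult_le_mono2)
      also have "\<dots> \<le> tower k ((c + 2) * m)"
        unfolding add_mult_distrib using c(1) m by (intro tower_mult) auto
      finally show ?thesis using p(2,3) by linarith
    qed
    ultimately show ?thesis using p(1) by (intro exI[of _ "2 * T + p"] exI[of _ p]) auto
  qed
  moreover have "c + 2 \<ge> 1" by simp
  ultimately show ?thesis unfolding tower_pumpable_def by blast
qed

lemma FO_closure_tower_pumpable:
  assumes "F \<subseteq> tower_index k"
  shows "FO_closure F \<subseteq> tower_pumpable k"
proof
  fix \<phi> assume "\<phi> \<in> FO_closure F"
  then show "\<phi> \<in> tower_pumpable k"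
  proof induction
    case (base \<phi>)
    then obtain c where c: "c \<ge> 1" "\<And>m. m \<ge> 1 \<Longrightarrow> index_le m (lang m \<phi>) (tower k (c * m))"
      using assms unfolding tower_index_def by blast
    have "\<exists>T p. 1 \<le> p \<and> T \<le> tower k (c * m) \<and> p \<le> tower k (c * m) \<and> pumpable T p (lang m \<phi>)"
      if "m \<ge> 1" for m
      by (rule pumpable_of_index_le[OF c(2)[OF that] lang_subset]) blast
    then show ?case using c(1) unfolding tower_pumpable_def by blast
  next
    case (disj \<phi> \<psi>)
    then have "Neg (Conj (Neg \<phi>) (Neg \<psi>)) \<in> tower_pumpable k"
      by (intro tower_pumpable_Neg tower_pumpable_Conj)
    then show ?case by (rule tower_pumpable_cong) (auto simp: lang_def)
  next
    case (all1 \<phi> x)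
    then have "Neg (Ex1 x (Neg \<phi>)) \<in> tower_pumpable k"
      by (intro tower_pumpable_Neg tower_pumpable_Ex1)
    then show ?case by (rule tower_pumpable_cong) (auto simp: lang_def)
  qed (auto intro: tower_pumpable_Neg tower_pumpable_Conj tower_pumpable_Ex1)
qed

lemma FO_Sigma_mon_periodic:
  assumes "\<phi> \<in> FO_closure (Sigma_mon k)"
  obtains c where "c \<ge> 1"
    "\<And>m. m \<ge> 1 \<Longrightarrow> \<exists>T p. 1 \<le> p \<and> T \<le> tower k (c * m) \<and>
       (\<forall>n>T. sat (grid m n) (\<lambda>_. (1, 1)) (\<lambda>_. {}) \<phi> \<longleftrightarrow> sat (grid m (n + p)) (\<lambda>_. (1, 1)) (\<lambda>_. {}) \<phi>)"
proof -
  have "\<phi> \<in> tower_pumpable k"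
    using assms FO_closure_tower_pumpable[OF Sigma_over_tower_index[OF FO_tower_index]]
    unfolding Sigma_mon_def by blast
  then obtain c where c: "c \<ge> 1" "\<And>m. m \<ge> 1 \<Longrightarrow> \<exists>T p. 1 \<le> p \<and> T \<le> tower k (c * m) \<and> p \<le> tower k (c * m) \<and>
     pumpable T p (lang m \<phi>)"
    by (rule tower_pumpableD) blast
  let ?e = "\<lambda>_ :: nat. (1, 1) :: nat \<times> nat" and ?E = "\<lambda>_ :: nat. {} :: (nat \<times> nat) set"
  \<comment> \<open>All first-order variables sit on the top left cell, so column 1 is the only one
    that is not blank. Width \<open>n\<close> thus leaves \<open>n - 1\<close> blank columns, whence
    the strict \<open>n > T\<close>.\<close>
  define P :: letter where "P = (\<lambda>\<kappa>. case \<kappa> of Inl x \<Rightarrow> {1} | Inr \<mu> \<Rightarrow> {})"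
  have enc: "enc (Suc n) ?e ?E = [P] @ replicate n blank @ []" for n
    by (rule nth_equalityI)
      (auto simp: nth_enc nth_Cons P_def blank_def fun_eq_iff split: nat.splits sum.splits)
  have "\<exists>T p. 1 \<le> p \<and> T \<le> tower k (c * m) \<and>
      (\<forall>n>T. sat (grid m n) ?e ?E \<phi> \<longleftrightarrow> sat (grid m (n + p)) ?e ?E \<phi>)" if m: "m \<ge> 1" for m
  proof -
    obtain T p where p: "1 \<le> p" "T \<le> tower k (c * m)" "pumpable T p (lang m \<phi>)"
      using c(2)[OF m] by blast
    have lang: "sat (grid m (Suc n)) ?e ?E \<phi> \<longleftrightarrow> [P] @ replicate n blank @ [] \<in> lang m \<phi>" for n
    proof -
      have as: "assignment (grid m (Suc n)) ?e ?E" using m by (simp add: assignment_def grid_def)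
      show ?thesis unfolding enc[symmetric] lang_def using enc_valid[OF as] dec_enc[OF as] by simp
    qed
    have "sat (grid m n) ?e ?E \<phi> \<longleftrightarrow> sat (grid m (n + p)) ?e ?E \<phi>" if n: "T < n" for n
    proof -
      obtain n' where n': "n = Suc n'" "T \<le> n'" using n by (cases n) auto
      have "[P] @ replicate n' blank @ [] \<in> lang m \<phi> \<longleftrightarrow> [P] @ replicate (n' + p) blank @ [] \<in> lang m \<phi>"
        by (rule p(3)[unfolded pumpable_def, rule_format, OF n'(2)])
      then show ?thesis unfolding lang[symmetric] n'(1) by simp
    qed
    then show ?thesis using p by blast
  qed
  then show ?thesis using that c(1) by blast
qed

section \<open>The segmentation formula\<close>

text \<open>The equivalence relation generated by \<open>R\<close> on \<open>D\<close>, in a form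
  that one universal set quantifier can express: no invariant set separates \<open>a\<close> from
  \<open>b\<close>.\<close>

definition linked :: "'a set \<Rightarrow> ('a \<Rightarrow> 'a \<Rightarrow> bool) \<Rightarrow> 'a \<Rightarrow> 'a \<Rightarrow> bool" where
  "linked D R a b \<longleftrightarrow> (\<forall>A\<subseteq>D. a \<in> A \<longrightarrow> (\<forall>u\<in>D. \<forall>v\<in>D. R u v \<longrightarrow> (u \<in> A \<longleftrightarrow> v \<in> A)) \<longrightarrow> b \<in> A)"

lemma linked_refl: "linked D R a a"
  by (simp add: linked_def)

lemma linked_trans: "linked D R a b \<Longrightarrow> linked D R b c \<Longrightarrow> linked D R a c"
  unfolding linked_def by blast

lemma linked_sym:
  assumes "linked D R a b" "a \<in> D"
  shows "linked D R b a"
  unfolding linked_def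
proof (intro allI impI, rule ccontr)
  fix A assume A: "A \<subseteq> D" "b \<in> A" "\<forall>u\<in>D. \<forall>v\<in>D. R u v \<longrightarrow> (u \<in> A \<longleftrightarrow> v \<in> A)" "a \<notin> A"
  \<comment> \<open>The complement of an invariant set is invariant.\<close>
  have "b \<in> D - A"
    by (rule assms(1)[unfolded linked_def, rule_format]) (use A assms(2) in auto)
  then show False using A(2) by blast
qed

lemma linked_step: "u \<in> D \<Longrightarrow> v \<in> D \<Longrightarrow> R u v \<Longrightarrow> linked D R u v"
  unfolding linked_def by blast

lemma linked_invariant:
  assumes "linked D R a b" "a \<in> D" "\<And>u v. u \<in> D \<Longrightarrow> v \<in> D \<Longrightarrow> R u v \<Longrightarrow> g u = g v"
  shows "g b = g a"
proof -
  have "b \<in> {u \<in> D. g u = g a}"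
    by (rule assms(1)[unfolded linked_def, rule_format]) (use assms(2,3) in auto)
  then show ?thesis by simp
qed

definition Imp :: "fm \<Rightarrow> fm \<Rightarrow> fm" where
  "Imp \<phi> \<psi> = Disj (Neg \<phi>) \<psi>"

definition Iff :: "fm \<Rightarrow> fm \<Rightarrow> fm" where
  "Iff \<phi> \<psi> = Conj (Imp \<phi> \<psi>) (Imp \<psi> \<phi>)"

lemma sat_Imp [simp]: "sat D e E (Imp \<phi> \<psi>) \<longleftrightarrow> (sat D e E \<phi> \<longrightarrow> sat D e E \<psi>)"
  and sat_Iff [simp]: "sat D e E (Iff \<phi> \<psi>) \<longleftrightarrow> (sat D e E \<phi> \<longleftrightarrow> sat D e E \<psi>)"
  by (auto simp: Imp_def Iff_def)

text \<open>Set variable 0 is reserved for the bound variable here; the attributes guessed below are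
  numbered from 1.\<close>

definition conn_fm :: "fm \<Rightarrow> nat \<Rightarrow> nat \<Rightarrow> fm" where
  "conn_fm \<psi> x y = Neg (ExS 0 (Conj (Conj (In 0 x) (Neg (In 0 y)))
     (All1 0 (All1 1 (Imp \<psi> (Iff (In 0 0) (In 0 1)))))))"

text \<open>The premise makes \<psi> independent of the set variable 0 that gets bound around it.
  The variables \<open>x\<close> and \<open>y\<close> stand outside the quantifiers over variables 0
  and 1, so they may be 0 and 1 themselves, as in \<open>alike_fm\<close>.\<close>

lemma sat_conn_fm:
  assumes "\<And>A a b. sat D (e(0 := a, 1 := b)) (E(0 := A)) \<psi> \<longleftrightarrow> R a b"
  shows "sat D e E (conn_fm \<psi> x y) \<longleftrightarrow> linked D R (e x) (e y)"
  unfolding conn_fm_def linked_def using assms by auto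

definition down_step :: "nat \<times> nat \<Rightarrow> nat \<times> nat \<Rightarrow> bool" where
  "down_step u v \<longleftrightarrow> v = (fst u + 1, snd u)"

definition right_step :: "nat \<times> nat \<Rightarrow> nat \<times> nat \<Rightarrow> bool" where
  "right_step u v \<longleftrightarrow> v = (fst u, snd u + 1)"

text \<open>Level \<open>l\<close> uses the attributes \<open>2 * l + 1\<close> (the bits) and \<open>2 * l + 2\<close> (the first columns
  of the segments of level \<open>l + 1\<close>); a segment of level 0 is a column.\<close>

primrec step_rel :: "(nat \<Rightarrow> (nat \<times> nat) set) \<Rightarrow> nat \<Rightarrow> nat \<times> nat \<Rightarrow> nat \<times> nat \<Rightarrow> bool" where
  "step_rel E 0 = down_step"
| "step_rel E (Suc l) = (\<lambda>u v. right_step u v \<and> v \<notin> E (2 * l + 2))"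

primrec step_fm :: "nat \<Rightarrow> fm" where
  "step_fm 0 = Succ1 0 1"
| "step_fm (Suc l) = Conj (Succ2 0 1) (Neg (In (2 * l + 2) 1))"

text \<open>Level 0 joins the cells of a column, every higher level only cells of one row: from
  level 1 on, a segment is an interval of a row. The marks are guessed independently for different
  rows and levels.\<close>

definition segment :: "(nat \<times> nat) set \<Rightarrow> (nat \<Rightarrow> (nat \<times> nat) set) \<Rightarrow> nat \<Rightarrow> nat \<times> nat \<Rightarrow> nat \<times> nat \<Rightarrow> bool" where
  "segment D E l = linked D (step_rel E l)"

definition segment_fm :: "nat \<Rightarrow> nat \<Rightarrow> nat \<Rightarrow> fm" where
  "segment_fm l = conn_fm (step_fm l)"

lemma sat_segment_fm [simp]: "sat D e E (segment_fm l x y) \<longleftrightarrow> segment D E l (e x) (e y)"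
  unfolding segment_fm_def segment_def
  by (rule sat_conn_fm) (cases l; simp add: down_step_def right_step_def)

text \<open>Equality of contents, tested by matching members in both directions. The index is one
  ahead of the level: \<open>alike D E (Suc l)\<close> compares the segments of level
  \<open>l\<close> around \<open>a\<close> and \<open>b\<close>, while \<open>alike D E 0\<close>
  compares single cells by their row.\<close>

primrec alike :: "(nat \<times> nat) set \<Rightarrow> (nat \<Rightarrow> (nat \<times> nat) set) \<Rightarrow> nat \<Rightarrow> nat \<times> nat \<Rightarrow> nat \<times> nat \<Rightarrow> bool" where
  "alike D E 0 = linked D right_step"
| "alike D E (Suc l) = (\<lambda>a b.
     (\<forall>u\<in>D. segment D E l a u \<longrightarrow> (\<exists>v\<in>D. segment D E l b v \<and> alike D E l u v \<and>
        (u \<in> E (2 * l + 1) \<longleftrightarrow> v \<in> E (2 * l + 1)))) \<and>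
     (\<forall>v\<in>D. segment D E l b v \<longrightarrow> (\<exists>u\<in>D. segment D E l a u \<and> alike D E l u v \<and>
        (u \<in> E (2 * l + 1) \<longleftrightarrow> v \<in> E (2 * l + 1)))))"

text \<open>The free variables at \<open>l\<close> are \<open>2 * l\<close> and
  \<open>2 * l + 1\<close>, so each level binds the pair of the level below and no renaming is
  called for.\<close>

primrec alike_fm :: "nat \<Rightarrow> fm" where
  "alike_fm 0 = conn_fm (Succ2 0 1) 0 1"
| "alike_fm (Suc l) =
     (let x = 2 * l + 2; y = 2 * l + 3; u = 2 * l; v = 2 * l + 1;
          match = Conj (alike_fm l) (Iff (In (2 * l + 1) u) (In (2 * l + 1) v))
      in Conj (All1 u (Imp (segment_fm l x u) (Ex1 v (Conj (segment_fm l y v) match))))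
              (All1 v (Imp (segment_fm l y v) (Ex1 u (Conj (segment_fm l x u) match)))))"

lemma sat_alike_fm: "sat D e E (alike_fm l) \<longleftrightarrow> alike D E l (e (2 * l)) (e (2 * l + 1))"
proof (induction l arbitrary: e)
  case 0
  have "sat D e E (conn_fm (Succ2 0 1) 0 1) \<longleftrightarrow> linked D right_step (e 0) (e 1)"
    by (rule sat_conn_fm) (simp add: right_step_def)
  then show ?case by simp
next
  case (Suc l)
  show ?case by (simp add: Suc.IH Let_def numeral_3_eq_3)
qed

definition distinct_fm :: "nat \<Rightarrow> fm" where
  "distinct_fm l = All1 (2 * l + 2) (All1 (2 * l + 3)
     (Imp (Conj (segment_fm (Suc l) (2 * l + 2) (2 * l + 3)) (alike_fm (Suc l)))
        (segment_fm l (2 * l + 2) (2 * l + 3))))"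

lemma sat_distinct_fm: "sat D e E (distinct_fm l) \<longleftrightarrow>
    (\<forall>a\<in>D. \<forall>b\<in>D. segment D E (Suc l) a b \<and> alike D E (Suc l) a b \<longrightarrow> segment D E l a b)"
  unfolding distinct_fm_def using sat_alike_fm[of D _ E "Suc l"]
  by (simp add: numeral_3_eq_3 del: alike_fm.simps alike.simps)

primrec all_distinct_fm :: "nat \<Rightarrow> fm" where
  "all_distinct_fm 0 = All1 0 (Eq 0 0)"
| "all_distinct_fm (Suc l) = Conj (all_distinct_fm l) (distinct_fm l)"

lemma sat_all_distinct_fm: "sat D e E (all_distinct_fm K) \<longleftrightarrow> (\<forall>l<K. sat D e E (distinct_fm l))"
  by (induction K) (auto simp: less_Suc_eq)

primrec exs :: "nat \<Rightarrow> fm \<Rightarrow> fm" where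
  "exs 0 \<phi> = \<phi>"
| "exs (Suc n) \<phi> = ExS (Suc n) (exs n \<phi>)"

lemma sat_exs: "sat D e E (exs n \<phi>) \<longleftrightarrow>
    (\<exists>E'. (\<forall>\<mu>\<in>{1..n}. E' \<mu> \<subseteq> D) \<and> (\<forall>\<mu>. \<mu> \<notin> {1..n} \<longrightarrow> E' \<mu> = E \<mu>) \<and> sat D e E' \<phi>)"
proof (induction n arbitrary: E)
  case 0
  have "E' = E" if "\<forall>\<mu>. E' \<mu> = E \<mu>" for E' using that by auto
  then show ?case by auto
next
  case (Suc n)
  show ?case
  proof
    assume "sat D e E (exs (Suc n) \<phi>)"
    then obtain A E' where A: "A \<subseteq> D" and E': "\<forall>\<mu>\<in>{1..n}. E' \<mu> \<subseteq> D"
      and eq: "\<forall>\<mu>. \<mu> \<notin> {1..n} \<longrightarrow> E' \<mu> = (E(Suc n := A)) \<mu>" and s: "sat D e E' \<phi>"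
      unfolding exs.simps sat.simps Suc.IH by blast
    have eq': "E' \<mu> = (E(Suc n := A)) \<mu>" if "\<mu> \<notin> {1..n}" for \<mu> using eq that by blast
    have "E' \<mu> \<subseteq> D" if "\<mu> \<in> {1..Suc n}" for \<mu>
    proof (cases "\<mu> = Suc n")
      case True
      then show ?thesis using eq'[of \<mu>] A by simp
    next
      case False
      then have "\<mu> \<in> {1..n}" using that by auto
      then show ?thesis using E' by blast
    qed
    moreover have "E' \<mu> = E \<mu>" if "\<mu> \<notin> {1..Suc n}" for \<mu>
    proof -
      have "\<mu> \<notin> {1..n}" "\<mu> \<noteq> Suc n" using that by auto
      then show ?thesis using eq'[of \<mu>] by simp
    qed
    ultimately show "\<exists>E'. (\<forall>\<mu>\<in>{1..Suc n}. E' \<mu> \<subseteq> D) \<and> (\<forall>\<mu>. \<mu> \<notin> {1..Suc n} \<longrightarrow> E' \<mu> = E \<mu>) \<and> sat D e E' \<phi>"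
      using s by blast
  next
    assume "\<exists>E'. (\<forall>\<mu>\<in>{1..Suc n}. E' \<mu> \<subseteq> D) \<and> (\<forall>\<mu>. \<mu> \<notin> {1..Suc n} \<longrightarrow> E' \<mu> = E \<mu>) \<and> sat D e E' \<phi>"
    then obtain E' where E': "\<forall>\<mu>\<in>{1..Suc n}. E' \<mu> \<subseteq> D" "\<forall>\<mu>. \<mu> \<notin> {1..Suc n} \<longrightarrow> E' \<mu> = E \<mu>" "sat D e E' \<phi>"
      by blast
    have "sat D e (E(Suc n := E' (Suc n))) (exs n \<phi>)"
      unfolding Suc.IH
    proof (intro exI[of _ E'] conjI ballI allI impI)
      fix \<mu> assume "\<mu> \<in> {1..n}"
      then show "E' \<mu> \<subseteq> D" using E'(1) by simp
    next
      fix \<mu> assume "\<mu> \<notin> {1..n}"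
      then show "E' \<mu> = (E(Suc n := E' (Suc n))) \<mu>" using E'(2) by (cases "\<mu> = Suc n") auto
    qed (rule E'(3))
    moreover have "E' (Suc n) \<subseteq> D" using E'(1) by auto
    ultimately show "sat D e E (exs (Suc n) \<phi>)" by auto
  qed
qed

text \<open>Forbidding marks in \<open>2 * K + 2\<close> makes every row a single segment of level
  \<open>Suc K\<close>, so that a bound on segments becomes a bound on the width.\<close>

definition segmented_fm :: "nat \<Rightarrow> fm" where
  "segmented_fm K = exs (2 * K + 2) (Conj (all_distinct_fm (Suc K)) (All1 0 (Neg (In (2 * K + 2) 0))))"

section \<open>Free variables and formula class of the segmentation formula\<close>

lemma free_Imp [simp]: "free_fo (Imp \<phi> \<psi>) = free_fo \<phi> \<union> free_fo \<psi>" "free_set (Imp \<phi> \<psi>) = free_set \<phi> \<union> free_set \<psi>"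
  and free_Iff [simp]: "free_fo (Iff \<phi> \<psi>) = free_fo \<phi> \<union> free_fo \<psi>" "free_set (Iff \<phi> \<psi>) = free_set \<phi> \<union> free_set \<psi>"
  by (auto simp: Imp_def Iff_def)

lemma free_segment_fm:
  "free_fo (segment_fm l x y) \<subseteq> {x, y}" "free_set (segment_fm l x y) \<subseteq> {1..2 * l}"
  by (cases l; auto simp: segment_fm_def conn_fm_def)+

lemma free_alike_fm: "free_fo (alike_fm l) \<subseteq> {2 * l, 2 * l + 1} \<and> free_set (alike_fm l) \<subseteq> {1..2 * l}"
proof (induction l)
  case 0
  then show ?case by (auto simp: conn_fm_def)
next
  case (Suc l)
  then show ?case
    using free_segment_fm(1)[of l "2 * l + 2" "2 * l"] free_segment_fm(1)[of l "2 * l + 3" "2 * l + 1"]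
      free_segment_fm(2)[of l "2 * l + 2" "2 * l"] free_segment_fm(2)[of l "2 * l + 3" "2 * l + 1"]
    by (auto simp: Let_def) (force+)?
qed

lemma free_distinct_fm: "free_fo (distinct_fm l) = {} \<and> free_set (distinct_fm l) \<subseteq> {1..2 * l + 2}"
  using free_segment_fm(1)[of l "2 * l + 2" "2 * l + 3"] free_segment_fm(1)[of "Suc l" "2 * l + 2" "2 * l + 3"]
    free_segment_fm(2)[of l "2 * l + 2" "2 * l + 3"] free_segment_fm(2)[of "Suc l" "2 * l + 2" "2 * l + 3"]
    free_alike_fm[of "Suc l"]
  by (auto simp: distinct_fm_def simp del: alike_fm.simps) (force+)?

lemma free_all_distinct_fm: "free_fo (all_distinct_fm K) = {} \<and> free_set (all_distinct_fm K) \<subseteq> {1..2 * K}"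
proof (induction K)
  case (Suc K)
  have "free_set (all_distinct_fm K) \<subseteq> {1..2 * Suc K}"
    by (rule order_trans[OF conjunct2[OF Suc.IH]]) auto
  moreover have "free_set (distinct_fm K) \<subseteq> {1..2 * Suc K}"
    by (rule order_trans[OF conjunct2[OF free_distinct_fm]]) auto
  ultimately show ?case
    using conjunct1[OF Suc.IH] conjunct1[OF free_distinct_fm[of K]]
    unfolding all_distinct_fm.simps free_fo.simps free_set.simps by blast
qed simp

lemma free_exs: "free_fo (exs n \<phi>) = free_fo \<phi>" "free_set (exs n \<phi>) = free_set \<phi> - {1..n}"
  by (induction n) (auto simp: le_Suc_eq)

lemma free_segmented_fm: "free_fo (segmented_fm K) = {}" "free_set (segmented_fm K) = {}"
proof -
  have "2 * Suc K = 2 * K + 2" by simp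
  then have "free_set (all_distinct_fm (Suc K)) \<subseteq> {1..2 * K + 2}" using free_all_distinct_fm[of "Suc K"] by metis
  then show "free_fo (segmented_fm K) = {}" "free_set (segmented_fm K) = {}"
    using free_all_distinct_fm[of "Suc K"]
    by (auto simp: segmented_fm_def free_exs simp del: all_distinct_fm.simps)
qed

lemma FO_closure_Imp: "\<phi> \<in> FO_closure F \<Longrightarrow> \<psi> \<in> FO_closure F \<Longrightarrow> Imp \<phi> \<psi> \<in> FO_closure F"
  unfolding Imp_def by (intro FO_closure.disj FO_closure.neg)

lemma FO_closure_Iff: "\<phi> \<in> FO_closure F \<Longrightarrow> \<psi> \<in> FO_closure F \<Longrightarrow> Iff \<phi> \<psi> \<in> FO_closure F"
  unfolding Iff_def by (intro FO_closure.conj FO_closure_Imp)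

lemma FO_subset_Sigma_mon_1: "FO \<subseteq> Sigma_mon 1"
  unfolding Sigma_mon_def by (auto intro: Sigma1_closure.base Bool_closure.base)

lemma FO_in_FO_closure: "\<phi> \<in> FO \<Longrightarrow> \<phi> \<in> FO_closure (Sigma_mon 1)"
  using FO_subset_Sigma_mon_1 by (blast intro: FO_closure.base)

text \<open>The set quantifier stands directly in front of a first-order formula; its negation and
  all that is built on top is left to \<open>FO_closure\<close>.\<close>

lemma conn_fm_in_closure:
  assumes "set_quantifier_free \<psi>"
  shows "conn_fm \<psi> x y \<in> FO_closure (Sigma_mon 1)"
proof -
  have "ExS \<mu> \<phi> \<in> Sigma_mon 1" if "\<phi> \<in> FO" for \<mu> \<phi>
    using that unfolding Sigma_mon_def by (auto intro: Sigma1_closure.exS Sigma1_closure.base Bool_closure.base)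
  then show ?thesis unfolding conn_fm_def
    using assms by (intro FO_closure.neg FO_closure.base) (simp add: FO_def Imp_def Iff_def)
qed

lemma segment_fm_in_closure: "segment_fm l x y \<in> FO_closure (Sigma_mon 1)"
  unfolding segment_fm_def by (rule conn_fm_in_closure) (cases l; simp)

lemma alike_fm_in_closure: "alike_fm l \<in> FO_closure (Sigma_mon 1)"
proof (induction l)
  case 0
  show ?case unfolding alike_fm.simps by (rule conn_fm_in_closure) simp
next
  case (Suc l)
  have "In \<mu> \<nu> \<in> FO_closure (Sigma_mon 1)" for \<mu> \<nu> by (rule FO_in_FO_closure) (simp add: FO_def)
  then show ?case unfolding alike_fm.simps Let_def
    by (intro FO_closure.conj FO_closure.all1 FO_closure.ex1 FO_closure_Imp FO_closure_Iff segment_fm_in_closure Suc)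
qed

lemma all_distinct_fm_in_closure: "all_distinct_fm K \<in> FO_closure (Sigma_mon 1)"
proof (induction K)
  case 0
  show ?case by (rule FO_in_FO_closure) (simp add: FO_def)
next
  case (Suc K)
  then show ?case unfolding all_distinct_fm.simps distinct_fm_def
    by (intro FO_closure.conj FO_closure.all1 FO_closure_Imp segment_fm_in_closure alike_fm_in_closure)
qed

lemma segmented_fm_in_closure: "segmented_fm K \<in> Sigma1_closure (FO_closure (Sigma_mon 1))"
proof -
  have "exs n \<phi> \<in> Sigma1_closure F" if "\<phi> \<in> F" for n \<phi> F
    by (induction n) (auto intro: Sigma1_closure.intros that)
  moreover have "All1 0 (Neg (In (2 * K + 2) 0)) \<in> FO_closure (Sigma_mon 1)"
    by (rule FO_in_FO_closure) (simp add: FO_def)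
  ultimately show ?thesis unfolding segmented_fm_def
    using all_distinct_fm_in_closure by (blast intro: FO_closure.conj)
qed

section \<open>Segmented grids are bounded\<close>

text \<open>At level 0 the rows themselves serve as codes and run up to \<open>m\<close>, hence
  \<open>Suc m\<close>; the factor 2 accounts for the bit that accompanies each content.\<close>

primrec class_bound :: "nat \<Rightarrow> nat \<Rightarrow> nat" where
  "class_bound m 0 = Suc m"
| "class_bound m (Suc l) = 2 ^ (class_bound m l * 2)"

primrec segment_bound :: "nat \<Rightarrow> nat \<Rightarrow> nat" where
  "segment_bound m 0 = m"
| "segment_bound m (Suc l) = class_bound m (Suc l) * segment_bound m l"

lemma linked_row:
  assumes "a \<in> grid m n" "(fst a, snd a + d) \<in> grid m n"
    "\<And>d'. d' < d \<Longrightarrow> R (fst a, snd a + d') (fst a, snd a + Suc d')"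
  shows "linked (grid m n) R a (fst a, snd a + d)"
  using assms(2,3)
proof (induction d)
  case 0
  then show ?case by (simp add: linked_refl)
next
  case (Suc d)
  have g: "(fst a, snd a + d) \<in> grid m n" using assms(1) Suc.prems(1) by (auto simp: grid_def)
  have "linked (grid m n) R a (fst a, snd a + d)" using Suc.IH[OF g] Suc.prems(2) by simp
  moreover have "R (fst a, snd a + d) (fst a, snd a + Suc d)" by (rule Suc.prems(2)) simp
  then have "linked (grid m n) R (fst a, snd a + d) (fst a, snd a + Suc d)"
    using g Suc.prems(1) by (intro linked_step)
  ultimately show ?case by (rule linked_trans)
qed

lemma linked_column:
  assumes "a \<in> grid m n" "(fst a + d, snd a) \<in> grid m n"
    "\<And>d'. d' < d \<Longrightarrow> R (fst a + d', snd a) (fst a + Suc d', snd a)"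
  shows "linked (grid m n) R a (fst a + d, snd a)"
  using assms(2,3)
proof (induction d)
  case 0
  then show ?case by (simp add: linked_refl)
next
  case (Suc d)
  have g: "(fst a + d, snd a) \<in> grid m n" using assms(1) Suc.prems(1) by (auto simp: grid_def)
  have "linked (grid m n) R a (fst a + d, snd a)" using Suc.IH[OF g] Suc.prems(2) by simp
  moreover have "R (fst a + d, snd a) (fst a + Suc d, snd a)" by (rule Suc.prems(2)) simp
  then have "linked (grid m n) R (fst a + d, snd a) (fst a + Suc d, snd a)"
    using g Suc.prems(1) by (intro linked_step)
  ultimately show ?case by (rule linked_trans)
qed

lemma linked_right_iff:
  assumes "a \<in> grid m n" "b \<in> grid m n"
  shows "linked (grid m n) right_step a b \<longleftrightarrow> fst a = fst b"
proof
  show "fst a = fst b" if "linked (grid m n) right_step a b"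
    using linked_invariant[OF that assms(1), of fst] by (simp add: right_step_def)
next
  have le: "linked (grid m n) right_step a b"
    if ab: "a \<in> grid m n" "b \<in> grid m n" "fst a = fst b" "snd a \<le> snd b" for a b
  proof -
    have b: "b = (fst a, snd a + (snd b - snd a))" using ab by (simp add: prod_eq_iff)
    have "linked (grid m n) right_step a (fst a, snd a + (snd b - snd a))"
      by (rule linked_row) (use ab b in \<open>auto simp: right_step_def\<close>)
    then show ?thesis using b by simp
  qed
  assume "fst a = fst b"
  then show "linked (grid m n) right_step a b"
    using le[of a b] le[of b a] assms linked_sym[of "grid m n" right_step b a] by (cases "snd a \<le> snd b") auto
qed

lemma linked_down_iff:
  assumes "a \<in> grid m n" "b \<in> grid m n"
  shows "linked (grid m n) down_step a b \<longleftrightarrow> snd a = snd b"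
proof
  show "snd a = snd b" if "linked (grid m n) down_step a b"
    using linked_invariant[OF that assms(1), of snd] by (simp add: down_step_def)
next
  have le: "linked (grid m n) down_step a b"
    if ab: "a \<in> grid m n" "b \<in> grid m n" "snd a = snd b" "fst a \<le> fst b" for a b
  proof -
    have b: "b = (fst a + (fst b - fst a), snd a)" using ab by (simp add: prod_eq_iff)
    have "linked (grid m n) down_step a (fst a + (fst b - fst a), snd a)"
      by (rule linked_column) (use ab b in \<open>auto simp: down_step_def\<close>)
    then show ?thesis using b by simp
  qed
  assume "snd a = snd b"
  then show "linked (grid m n) down_step a b"
    using le[of a b] le[of b a] assms linked_sym[of "grid m n" down_step b a] by (cases "fst a \<le> fst b") auto
qed

text \<open>Contents are coded by numbers, level by level: a content is a set of pairs of a lower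
  code and a bit, and being alike is equality of these sets.\<close>

lemma alike_classes:
  "\<exists>f. (\<forall>a\<in>grid m n. f a < class_bound m l) \<and>
       (\<forall>a\<in>grid m n. \<forall>b\<in>grid m n. alike (grid m n) E l a b \<longleftrightarrow> f a = f b)"
proof (induction l)
  case 0
  show ?case
    by (rule exI[of _ fst]) (auto simp: linked_right_iff, auto simp: grid_def)
next
  case (Suc l)
  let ?D = "grid m n"
  obtain f where f: "\<forall>a\<in>?D. f a < class_bound m l"
    and alike: "\<forall>a\<in>?D. \<forall>b\<in>?D. alike ?D E l a b \<longleftrightarrow> f a = f b"
    using Suc by blast
  define content where "content = (\<lambda>a. {(f u, u \<in> E (2 * l + 1)) | u. u \<in> ?D \<and> segment ?D E l a u})"
  have sub: "content a \<subseteq> X \<longleftrightarrow> (\<forall>u\<in>?D. segment ?D E l a u \<longrightarrow> (f u, u \<in> E (2 * l + 1)) \<in> X)" for a X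
    by (auto simp: content_def)
  have mem: "(x, y) \<in> content b \<longleftrightarrow> (\<exists>v\<in>?D. segment ?D E l b v \<and> x = f v \<and> y = (v \<in> E (2 * l + 1)))" for b x y
    by (auto simp: content_def)
  have mem': "(f u, u \<in> E (2 * l + 1)) \<in> content b \<longleftrightarrow>
      (\<exists>v\<in>?D. segment ?D E l b v \<and> alike ?D E l u v \<and> (u \<in> E (2 * l + 1) \<longleftrightarrow> v \<in> E (2 * l + 1)))"
      "(f u, u \<in> E (2 * l + 1)) \<in> content b \<longleftrightarrow>
      (\<exists>v\<in>?D. segment ?D E l b v \<and> alike ?D E l v u \<and> (v \<in> E (2 * l + 1) \<longleftrightarrow> u \<in> E (2 * l + 1)))"
    if "u \<in> ?D" for u b
  proof -
    have "f u = f v \<longleftrightarrow> alike ?D E l u v" "f u = f v \<longleftrightarrow> alike ?D E l v u" if "v \<in> ?D" for v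
      using alike that \<open>u \<in> ?D\<close> by auto
    then show "(f u, u \<in> E (2 * l + 1)) \<in> content b \<longleftrightarrow>
      (\<exists>v\<in>?D. segment ?D E l b v \<and> alike ?D E l u v \<and> (u \<in> E (2 * l + 1) \<longleftrightarrow> v \<in> E (2 * l + 1)))"
      "(f u, u \<in> E (2 * l + 1)) \<in> content b \<longleftrightarrow>
      (\<exists>v\<in>?D. segment ?D E l b v \<and> alike ?D E l v u \<and> (v \<in> E (2 * l + 1) \<longleftrightarrow> u \<in> E (2 * l + 1)))"
      unfolding mem by blast+
  qed
  have iff: "alike ?D E (Suc l) a b \<longleftrightarrow> content a = content b" for a b
    unfolding alike.simps set_eq_subset sub using mem' by (simp cong: ball_cong)
  let ?S = "Pow ({..<class_bound m l} \<times> (UNIV :: bool set))"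
  have "finite ?S" by simp
  then obtain g where g: "bij_betw g ?S {0..<card ?S}" using ex_bij_betw_finite_nat by blast
  have card: "card ?S = class_bound m (Suc l)" by (simp add: card_Pow card_cartesian_product)
  have memS: "content a \<in> ?S" for a unfolding content_def using f by auto
  have "g (content a) < class_bound m (Suc l)" for a
    using bij_betwE[OF g] memS[of a] unfolding card by simp
  moreover have "g (content a) = g (content b) \<longleftrightarrow> content a = content b" for a b
    using inj_on_eq_iff[OF bij_betw_imp_inj_on[OF g] memS memS] .
  ultimately show ?case by (intro exI[of _ "g \<circ> content"]) (simp add: iff del: class_bound.simps alike.simps)
qed

lemma segment_trans: "segment D E l a b \<Longrightarrow> segment D E l b c \<Longrightarrow> segment D E l a c"
  unfolding segment_def by (rule linked_trans)

lemma segment_sym: "segment D E l a b \<Longrightarrow> a \<in> D \<Longrightarrow> segment D E l b a"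
  unfolding segment_def by (rule linked_sym)

text \<open>Cells of one segment of level \<open>Suc l\<close> that share a content code lie, by
  distinctness, in one segment of level \<open>l\<close>. So the size is at most the number of codes
  times the bound for level \<open>l\<close>.\<close>

lemma card_segment_le:
  assumes "\<And>l a b. l < K \<Longrightarrow> a \<in> grid m n \<Longrightarrow> b \<in> grid m n \<Longrightarrow> segment (grid m n) E (Suc l) a b \<Longrightarrow>
      alike (grid m n) E (Suc l) a b \<Longrightarrow> segment (grid m n) E l a b"
    and "a \<in> grid m n" "l \<le> K"
  shows "card {b \<in> grid m n. segment (grid m n) E l a b} \<le> segment_bound m l"
  using assms(2,3)
proof (induction l arbitrary: a)
  case 0
  have "{b \<in> grid m n. segment (grid m n) E 0 a b} \<subseteq> {1..m} \<times> {snd a}"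
    using 0 by (auto simp: segment_def linked_down_iff) (auto simp: grid_def)
  then have "card {b \<in> grid m n. segment (grid m n) E 0 a b} \<le> card ({1..m} \<times> {snd a})"
    by (intro card_mono) auto
  then show ?case by (simp add: card_cartesian_product)
next
  case (Suc l)
  let ?D = "grid m n" and ?C = "class_bound m (Suc l)"
  have fin: "finite ?D" by (simp add: grid_def)
  obtain f where f: "\<forall>a\<in>?D. f a < ?C"
    and alike: "\<forall>a\<in>?D. \<forall>b\<in>?D. alike ?D E (Suc l) a b \<longleftrightarrow> f a = f b"
    using alike_classes by blast
  define X where "X = (\<lambda>v. {b \<in> ?D. segment ?D E (Suc l) a b \<and> f b = v})"
  have "card (X v) \<le> segment_bound m l" for v
  proof (cases "X v = {}")
    case False
    then obtain b where b: "b \<in> X v" by blast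
    have "X v \<subseteq> {c \<in> ?D. segment ?D E l b c}"
    proof
      fix c assume c: "c \<in> X v"
      have bc: "b \<in> ?D" "c \<in> ?D" "segment ?D E (Suc l) a b" "segment ?D E (Suc l) a c" "f b = f c"
        using b c by (simp_all add: X_def)
      have "segment ?D E (Suc l) b c" by (rule segment_trans[OF segment_sym[OF bc(3) Suc.prems(1)] bc(4)])
      moreover have "alike ?D E (Suc l) b c" using alike[rule_format, OF bc(1,2)] bc(5) by (rule iffD2)
      moreover have "l < K" using Suc.prems(2) by simp
      ultimately have "segment ?D E l b c" using assms(1) bc(1,2) by blast
      then show "c \<in> {c \<in> ?D. segment ?D E l b c}" using bc(2) by simp
    qed
    then have "card (X v) \<le> card {c \<in> ?D. segment ?D E l b c}" using fin by (intro card_mono) auto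
    also have "\<dots> \<le> segment_bound m l" using Suc.IH[of b] Suc.prems(2) b by (simp add: X_def)
    finally show ?thesis .
  qed simp
  then have "(\<Sum>v<?C. card (X v)) \<le> (\<Sum>v<?C. segment_bound m l)" by (rule sum_mono)
  then have sum: "(\<Sum>v<?C. card (X v)) \<le> segment_bound m (Suc l)" by simp
  have "{b \<in> ?D. segment ?D E (Suc l) a b} = (\<Union>v<?C. X v)" using f by (auto simp: X_def)
  then have "card {b \<in> ?D. segment ?D E (Suc l) a b} \<le> (\<Sum>v<?C. card (X v))"
    using card_UN_le[of "{..<?C}" X] by simp
  then show ?case using sum by linarith
qed

lemma segmented_bounded:
  assumes "sat (grid m n) e E (segmented_fm K)" "m \<ge> 1" "n \<ge> 1"
  shows "n \<le> segment_bound m (Suc K)"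
proof -
  let ?D = "grid m n"
  obtain E' where E': "sat ?D e E' (all_distinct_fm (Suc K))" "\<forall>a\<in>?D. a \<notin> E' (2 * K + 2)"
    using assms(1) by (auto simp: segmented_fm_def sat_exs simp del: all_distinct_fm.simps)
  have one: "(1, 1) \<in> ?D" using assms by (simp add: grid_def)
  have dist: "segment ?D E' l a b" if "l < Suc K" "a \<in> ?D" "b \<in> ?D" "segment ?D E' (Suc l) a b"
    "alike ?D E' (Suc l) a b" for l a b
    using E'(1) that unfolding sat_all_distinct_fm sat_distinct_fm by blast
  have row: "segment ?D E' (Suc K) (1, 1) (1, j)" if "j \<in> {1..n}" for j
  proof -
    have "linked ?D (step_rel E' (Suc K)) (1, 1) (fst (1 :: nat, 1 :: nat), snd (1 :: nat, 1 :: nat) + (j - 1))"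
    proof (rule linked_row[OF one])
      fix d assume "d < j - 1"
      then have "(1, 1 + Suc d) \<in> ?D" using that assms by (auto simp: grid_def)
      then show "step_rel E' (Suc K) (fst (1 :: nat, 1 :: nat), snd (1 :: nat, 1 :: nat) + d)
          (fst (1 :: nat, 1 :: nat), snd (1 :: nat, 1 :: nat) + Suc d)"
        using E'(2) by (auto simp: right_step_def)
    qed (use that assms in \<open>auto simp: grid_def\<close>)
    then show ?thesis using that by (simp add: segment_def)
  qed
  have "card ({1 :: nat} \<times> {1..n}) \<le> card {b \<in> ?D. segment ?D E' (Suc K) (1, 1) b}"
    by (rule card_mono) (use row assms in \<open>auto simp: grid_def\<close>)
  also have "\<dots> \<le> segment_bound m (Suc K)"
    by (rule card_segment_le[of "Suc K"]) (use dist one in auto)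
  finally show ?thesis by (simp add: card_cartesian_product)
qed

section \<open>Large segmented grids\<close>

text \<open>Counterpart of \<open>class_bound\<close> for the labelling below, in which every lower
  content occurs exactly once in a complete segment, with a single bit. A content is then a bit
  vector, and the factor 2 disappears.\<close>

primrec class_count :: "nat \<Rightarrow> nat \<Rightarrow> nat" where
  "class_count m 0 = m"
| "class_count m (Suc l) = 2 ^ class_count m l"

primrec segment_length :: "nat \<Rightarrow> nat \<Rightarrow> nat" where
  "segment_length m 0 = 1"
| "segment_length m (Suc l) = class_count m (Suc l) * segment_length m l"

declare segment_length.simps(2) [simp del]

text \<open>Write the column number in mixed radix: \<open>digit m (Suc l)\<close> is the number of the segment of level \<open>l\<close>
  within its segment of level \<open>Suc l\<close>, and the bit attached to it is the one with that number in
  the digit of the next level. Columns are numbered from 1, hence the \<open>j - 1\<close>.\<close>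

fun digit :: "nat \<Rightarrow> nat \<Rightarrow> nat \<times> nat \<Rightarrow> nat" where
  "digit m 0 (i, j) = i - 1"
| "digit m (Suc l) (i, j) = ((j - 1) div segment_length m l) mod class_count m (Suc l)"

text \<open>A mark cuts a cell from its left neighbour, so column 1 gets none. If the width is the
  length of one segment of some level, no mark for that level remains, as
  \<open>segmented_fm\<close> demands at the top.\<close>

definition labelling :: "nat \<Rightarrow> nat \<Rightarrow> nat \<Rightarrow> (nat \<times> nat) set" where
  "labelling m n \<mu> = {(i, j) \<in> grid m n. \<mu> \<noteq> 0 \<and>
     (if odd \<mu> then bit (digit m (Suc (\<mu> div 2)) (i, j)) (digit m (\<mu> div 2) (i, j))
      else j \<noteq> 1 \<and> segment_length m (\<mu> div 2) dvd j - 1)}"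

lemma labelling_bits: "z \<in> labelling m n (2 * l + 1) \<longleftrightarrow>
    z \<in> grid m n \<and> bit (digit m (Suc l) z) (digit m l z)"
  by (cases z) (simp add: labelling_def)

lemma labelling_marks: "z \<in> labelling m n (2 * l + 2) \<longleftrightarrow>
    z \<in> grid m n \<and> snd z \<noteq> 1 \<and> segment_length m (Suc l) dvd snd z - 1"
  by (cases z) (simp add: labelling_def)

lemma segment_length_pos: "m \<ge> 1 \<Longrightarrow> 0 < segment_length m l"
  by (induction l) (auto simp: segment_length.simps(2))

lemma segment_length_dvd: "l \<le> l' \<Longrightarrow> segment_length m l dvd segment_length m l'"
  by (induction l' rule: dec_induct) (auto simp: segment_length.simps(2))

lemma div_eq_step:
  fixes j q :: nat
  assumes "\<not> q dvd Suc j"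
  shows "Suc j div q = j div q"
  using assms by (simp add: div_Suc dvd_eq_mod_eq_0)

lemma segment_labelling:
  assumes a: "a \<in> grid m n" and b: "b \<in> grid m n" and m: "m \<ge> 1"
  shows "segment (grid m n) (labelling m n) (Suc l) a b \<longleftrightarrow>
    fst a = fst b \<and> (snd a - 1) div segment_length m (Suc l) = (snd b - 1) div segment_length m (Suc l)"
    (is "?L \<longleftrightarrow> ?R a b")
proof
  let ?D = "grid m n" and ?E = "labelling m n" and ?q = "segment_length m (Suc l)"
  let ?g = "\<lambda>z. (fst z, (snd z - 1) div ?q)"
  assume ?L
  then have "?g b = ?g a"
    unfolding segment_def
  proof (rule linked_invariant[OF _ a])
    fix u v assume uv: "u \<in> ?D" "v \<in> ?D" "step_rel ?E (Suc l) u v"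
    then have v: "v = (fst u, snd u + 1)" "v \<notin> ?E (2 * l + 2)" by (auto simp: right_step_def)
    have u: "snd u = Suc (snd u - 1)" using uv(1) by (auto simp: grid_def)
    have "\<not> ?q dvd snd v - 1" using v(2) uv(2) u unfolding labelling_marks v(1) by auto
    then have "\<not> ?q dvd Suc (snd u - 1)" using v(1) u by simp
    from div_eq_step[OF this] show "?g u = ?g v" using v(1) u by simp
  qed
  then show "?R a b" by simp
next
  let ?D = "grid m n" and ?E = "labelling m n" and ?q = "segment_length m (Suc l)"
  have le: "segment ?D ?E (Suc l) a b" if ab: "a \<in> ?D" "b \<in> ?D" "?R a b" "snd a \<le> snd b" for a b
  proof -
    have b': "b = (fst a, snd a + (snd b - snd a))" using ab by (simp add: prod_eq_iff)
    have "linked ?D (step_rel ?E (Suc l)) a (fst a, snd a + (snd b - snd a))"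
    proof (rule linked_row[OF ab(1)])
      fix d assume d: "d < snd b - snd a"
      have pos: "0 < snd a" using ab(1) by (auto simp: grid_def)
      \<comment> \<open>A multiple of the segment length between the two columns would make their
        quotients differ.\<close>
      have "\<not> ?q dvd snd a + d"
      proof
        assume "?q dvd snd a + d"
        then obtain r where r: "snd a + d = ?q * r" by blast
        have q: "0 < ?q" by (rule segment_length_pos[OF m])
        have "snd a - 1 < ?q * r" using r pos by linarith
        then have "(snd a - 1) div ?q < r" using q by (simp add: less_mult_imp_div_less mult.commute)
        moreover have "?q * r \<le> snd b - 1" using r d by linarith
        then have "?q * r div ?q \<le> (snd b - 1) div ?q" by (rule div_le_mono)
        then have "r \<le> (snd b - 1) div ?q" using q by simp
        ultimately show False using ab(3) by simp
      qed
      then show "step_rel ?E (Suc l) (fst a, snd a + d) (fst a, snd a + Suc d)"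
        unfolding step_rel.simps labelling_marks by (simp add: right_step_def)
    qed (use ab b' in simp)
    then show ?thesis unfolding segment_def b'[symmetric] .
  qed
  assume "?R a b"
  then show ?L
    using le[of a b] le[of b a] a b segment_sym[of ?D ?E "Suc l" b a] by (cases "snd a \<le> snd b") auto
qed

lemma segment_labelling_0:
  "a \<in> grid m n \<Longrightarrow> b \<in> grid m n \<Longrightarrow> segment (grid m n) (labelling m n) 0 a b \<longleftrightarrow> snd a = snd b"
  by (simp add: segment_def linked_down_iff)

lemma digit_less: "z \<in> grid m n \<Longrightarrow> m \<ge> 1 \<Longrightarrow> digit m l z < class_count m l"
  by (cases z; cases l) (auto simp: grid_def)

text \<open>This digit is the number of the segment itself, so the bit of that number attached to a
  cell can be read with any other cell of the segment as reference.\<close>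

lemma segment_digit_Suc:
  assumes "a \<in> grid m n" "b \<in> grid m n" "m \<ge> 1" "segment (grid m n) (labelling m n) l a b"
  shows "digit m (Suc l) a = digit m (Suc l) b"
  using assms(4)
proof (cases l)
  case 0
  then show ?thesis using assms by (cases a; cases b) (simp add: segment_labelling_0)
next
  case (Suc l')
  then show ?thesis using assms segment_labelling[OF assms(1-3), of l']
    by (cases a; cases b) (simp)
qed

text \<open>As the segment length divides the width, no segment is cut off at the right border, so
  each one runs through all digit values.\<close>

lemma segment_digit_surj:
  assumes a: "a \<in> grid m n" and m: "m \<ge> 1" and l: "segment_length m l dvd n" and v: "v < class_count m l"
  obtains z where "z \<in> grid m n" "segment (grid m n) (labelling m n) l a z" "digit m l z = v"
proof (cases l)
  case 0
  then have z: "(Suc v, snd a) \<in> grid m n" using a v by (auto simp: grid_def)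
  then have "segment (grid m n) (labelling m n) l a (Suc v, snd a)" using 0 a by (simp add: segment_labelling_0)
  then show thesis using that[OF z] 0 by simp
next
  case (Suc l')
  let ?p = "segment_length m l'" and ?N = "class_count m l"
  let ?q = "segment_length m l"
  have q: "?q = ?N * ?p" by (simp add: Suc segment_length.simps(2))
  have p: "0 < ?p" by (rule segment_length_pos[OF m])
  \<comment> \<open>\<open>r\<close> is the number of the segment of \<open>a\<close>, and
    \<open>J\<close>, counted from 0, is the first column of its subsegment number
    \<open>v\<close>.\<close>
  define r where "r = (snd a - 1) div ?q"
  define J where "J = (r * ?N + v) * ?p"
  have "J div ?p = r * ?N + v" using p by (simp add: J_def)
  moreover have "(r * ?N + v) div ?N = r" "(r * ?N + v) mod ?N = v" using v by auto
  ultimately have J: "J div ?q = r" "J div ?p mod ?N = v"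
    unfolding q mult.commute[of ?N ?p] div_mult2_eq by simp_all
  have "snd a - 1 < n" using a by (auto simp: grid_def)
  then have "r * ?q < n"
    using div_times_less_eq_dividend[of "snd a - 1" ?q] unfolding r_def by linarith
  then have "(r + 1) * ?q \<le> n"
  proof -
    obtain s where s: "n = ?q * s" using l by blast
    then have "r < s" using \<open>r * ?q < n\<close> by (simp add: mult.commute)
    then have "?q * (r + 1) \<le> ?q * s" by (intro mult_le_mono2) simp
    then show ?thesis using s by (simp add: mult.commute)
  qed
  moreover have "J < (r + 1) * ?q"
  proof -
    have "r * ?N + v < (r + 1) * ?N" using v by simp
    then have "J < ((r + 1) * ?N) * ?p" unfolding J_def using p by simp
    then show ?thesis unfolding q by (simp only: mult.assoc)
  qed
  ultimately have "J < n" by linarith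
  then have z: "(fst a, Suc J) \<in> grid m n" using a by (auto simp: grid_def)
  have "segment (grid m n) (labelling m n) l a (fst a, Suc J)"
    using segment_labelling[OF a z m, of l'] J(1) by (simp add: Suc[symmetric] r_def)
  moreover have "digit m l (fst a, Suc J) = v" using J(2) by (simp add: Suc)
  ultimately show thesis using that z by blast
qed

lemma bits_eqI:
  fixes x y N :: nat
  assumes "x < 2 ^ N" "y < 2 ^ N" "\<And>i. i < N \<Longrightarrow> bit x i \<longleftrightarrow> bit y i"
  shows "x = y"
proof -
  have "take_bit N x = take_bit N y" using assms(3) by (simp add: bit_eq_iff bit_take_bit_iff) blast
  then show ?thesis using assms(1,2) by (simp add: take_bit_nat_eq_self)
qed

text \<open>A segment contains each value \<open>i\<close> of the lower digit, paired with bit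
  \<open>i\<close> of its own number; so its content is the binary expansion of that number.\<close>

lemma alike_labelling:
  assumes m: "m \<ge> 1" and n: "segment_length m K dvd n"
  shows "l \<le> Suc K \<Longrightarrow> a \<in> grid m n \<Longrightarrow> b \<in> grid m n \<Longrightarrow>
    alike (grid m n) (labelling m n) l a b \<longleftrightarrow> digit m l a = digit m l b"
proof (induction l arbitrary: a b)
  case 0
  then have "1 \<le> fst a" "1 \<le> fst b" by (auto simp: grid_def)
  then have "fst a = fst b \<longleftrightarrow> digit m 0 a = digit m 0 b" by (cases a; cases b) auto
  then show ?case using linked_right_iff[OF 0(2,3)] by simp
next
  case (Suc l)
  let ?D = "grid m n" and ?E = "labelling m n"
  note a = Suc.prems(2) and b = Suc.prems(3)
  have l: "segment_length m l dvd n" using Suc.prems(1) by (intro dvd_trans[OF segment_length_dvd n]) simp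
  have IH: "alike ?D ?E l u v \<longleftrightarrow> digit m l u = digit m l v" if "u \<in> ?D" "v \<in> ?D" for u v
    using Suc.IH[OF _ that] Suc.prems(1) by simp
  have lab: "u \<in> ?E (2 * l + 1) \<longleftrightarrow> bit (digit m (Suc l) c) (digit m l u)"
    if "u \<in> ?D" "c \<in> ?D" "segment ?D ?E l c u" for u c
    using that(1) segment_digit_Suc[OF that(2,1) m that(3)] unfolding labelling_bits by simp
  show ?case
  proof
    assume al: "alike ?D ?E (Suc l) a b"
    show "digit m (Suc l) a = digit m (Suc l) b"
    proof (rule bits_eqI)
      show "digit m (Suc l) a < 2 ^ class_count m l" "digit m (Suc l) b < 2 ^ class_count m l"
        using digit_less[OF a m, of "Suc l"] digit_less[OF b m, of "Suc l"] by simp_all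
      fix i assume "i < class_count m l"
      then obtain u where u: "u \<in> ?D" "segment ?D ?E l a u" "digit m l u = i"
        by (rule segment_digit_surj[OF a m l])
      obtain v where v: "v \<in> ?D" "segment ?D ?E l b v" "alike ?D ?E l u v" "u \<in> ?E (2 * l + 1) \<longleftrightarrow> v \<in> ?E (2 * l + 1)"
        using al u unfolding alike.simps by blast
      have "digit m l v = i" using v u IH by simp
      then show "bit (digit m (Suc l) a) i \<longleftrightarrow> bit (digit m (Suc l) b) i"
        using lab[OF u(1) a u(2)] lab[OF v(1) b v(2)] v(4) u(3) by simp
    qed
  next
    assume eq: "digit m (Suc l) a = digit m (Suc l) b"
    have half: "\<exists>v\<in>?D. segment ?D ?E l c' v \<and> digit m l u = digit m l v \<and> (u \<in> ?E (2 * l + 1) \<longleftrightarrow> v \<in> ?E (2 * l + 1))"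
      if c: "c \<in> ?D" "c' \<in> ?D" "digit m (Suc l) c = digit m (Suc l) c'" and u: "u \<in> ?D" "segment ?D ?E l c u" for c c' u
    proof -
      obtain v where v: "v \<in> ?D" "segment ?D ?E l c' v" "digit m l v = digit m l u"
        by (rule segment_digit_surj[OF c(2) m l digit_less[OF u(1) m]])
      then show ?thesis using lab[OF u(1) c(1) u(2)] lab[OF v(1) c(2) v(2)] c(3) by auto
    qed
    show "alike ?D ?E (Suc l) a b"
      unfolding alike.simps
    proof (intro conjI ballI impI)
      fix u assume u: "u \<in> ?D" "segment ?D ?E l a u"
      then show "\<exists>v\<in>?D. segment ?D ?E l b v \<and> alike ?D ?E l u v \<and> (u \<in> ?E (2 * l + 1) \<longleftrightarrow> v \<in> ?E (2 * l + 1))"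
        using half[OF a b eq u] IH by blast
    next
      fix v assume v: "v \<in> ?D" "segment ?D ?E l b v"
      then show "\<exists>u\<in>?D. segment ?D ?E l a u \<and> alike ?D ?E l u v \<and> (u \<in> ?E (2 * l + 1) \<longleftrightarrow> v \<in> ?E (2 * l + 1))"
        using half[OF b a eq[symmetric] v] IH[OF _ v(1)] by auto
    qed
  qed
qed

lemma segmented_exists:
  assumes m: "m \<ge> 1"
  shows "sat (grid m (segment_length m (Suc K))) e (\<lambda>_. {}) (segmented_fm K)"
proof -
  let ?n = "segment_length m (Suc K)"
  let ?D = "grid m ?n" and ?E = "labelling m ?n"
  \<comment> \<open>\<open>exs\<close> reassigns only the variables 1 to \<open>2 * K + 2\<close>,
    so the labelling is cut off to these; segments and contents up to level \<open>Suc K\<close>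
    stay the same.\<close>
  define E' where "E' = (\<lambda>\<mu>. if \<mu> \<in> {1..2 * K + 2} then ?E \<mu> else {})"
  have dvd: "segment_length m K dvd ?n" by (rule segment_length_dvd) simp
  have step: "step_rel E' l = step_rel ?E l" if "l \<le> Suc K" for l
    using that by (cases l) (auto simp: E'_def)
  have seg: "segment ?D E' l = segment ?D ?E l" if "l \<le> Suc K" for l
    unfolding segment_def step[OF that] ..
  have alike: "alike ?D E' l a b \<longleftrightarrow> alike ?D ?E l a b" if "l \<le> Suc K" for l a b
    using that
  proof (induction l arbitrary: a b)
    case (Suc l)
    then have "E' (2 * l + 1) = ?E (2 * l + 1)" by (auto simp: E'_def)
    then show ?case using Suc seg[of l] by (simp)
  qed simp
  have "sat ?D e E' (distinct_fm l)" if l: "l < Suc K" for l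
    unfolding sat_distinct_fm
  proof (intro ballI impI)
    fix a b assume a: "a \<in> ?D" and b: "b \<in> ?D" and h: "segment ?D E' (Suc l) a b \<and> alike ?D E' (Suc l) a b"
    let ?q = "segment_length m l" and ?N = "class_count m (Suc l)"
    have s: "fst a = fst b" "(snd a - 1) div segment_length m (Suc l) = (snd b - 1) div segment_length m (Suc l)"
      using h l seg[of "Suc l"] segment_labelling[OF a b m, of l] by auto
    have d: "digit m (Suc l) a = digit m (Suc l) b"
      using h l alike[of "Suc l"] alike_labelling[OF m dvd _ a b, of "Suc l"] by simp
    \<comment> \<open>Quotient and remainder by \<open>?N\<close>: lying in the same segment of
      level \<open>Suc l\<close> and having the same digit gives the same number of the segment of
      level \<open>l\<close>.\<close>
    have "(snd a - 1) div ?q div ?N = (snd b - 1) div ?q div ?N"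
      using s(2) unfolding segment_length.simps(2) mult.commute[of ?N ?q] div_mult2_eq .
    moreover have "(snd a - 1) div ?q mod ?N = (snd b - 1) div ?q mod ?N"
      using d by (cases a; cases b) simp
    ultimately have q: "(snd a - 1) div ?q = (snd b - 1) div ?q"
      by (metis div_mult_mod_eq)
    have "segment ?D ?E l a b"
    proof (cases l)
      case 0
      then have "snd a - 1 = snd b - 1" using q by simp
      then have "snd a = snd b" using a b by (auto simp: grid_def)
      then show ?thesis using 0 a b by (simp add: segment_labelling_0)
    next
      case (Suc l')
      then show ?thesis using s(1) q segment_labelling[OF a b m, of l'] by simp
    qed
    then show "segment ?D E' l a b" using seg l by simp
  qed
  then have "sat ?D e E' (all_distinct_fm (Suc K))" unfolding sat_all_distinct_fm by blast
  moreover have "a \<notin> E' (2 * K + 2)" if "a \<in> ?D" for a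
  proof
    assume "a \<in> E' (2 * K + 2)"
    then have "a \<in> ?E (2 * K + 2)" by (simp add: E'_def)
    then have "snd a \<noteq> 1" "?n dvd snd a - 1" unfolding labelling_marks by auto
    moreover have "1 \<le> snd a" "snd a \<le> ?n" using that by (auto simp: grid_def)
    ultimately show False using dvd_imp_le[of ?n "snd a - 1"] by linarith
  qed
  ultimately have "sat ?D e E' (Conj (all_distinct_fm (Suc K)) (All1 0 (Neg (In (2 * K + 2) 0))))" by simp
  moreover have "E' \<mu> \<subseteq> ?D" for \<mu> by (auto simp: E'_def labelling_def)
  moreover have "E' \<mu> = {}" if "\<mu> \<notin> {1..2 * K + 2}" for \<mu> using that by (auto simp: E'_def)
  ultimately show ?thesis unfolding segmented_fm_def sat_exs by blast
qed

lemma class_count_tower: "class_count m (Suc l) = tower l m"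
  by (induction l) simp_all

lemma segment_length_ge:
  assumes "m \<ge> 1"
  shows "tower l m \<le> segment_length m (Suc l)"
proof -
  have "1 \<le> segment_length m l" using segment_length_pos[OF assms, of l] by simp
  then show ?thesis unfolding segment_length.simps class_count_tower by simp
qed

lemma tower_strict: "x < y \<Longrightarrow> tower k x < tower k y"
  by (induction k) auto

text \<open>Trades the extra exponential of the lower bound for one in the argument, where it beats
  the linear \<open>c * m\<close>.\<close>

lemma tower_Suc_arg: "tower (Suc k) x = tower k (2 ^ x)"
  by (induction k) simp_all

section \<open>Separation\<close>

text \<open>Without attributes the only letter is the everywhere \<open>undefined\<close> function,
  so a picture is nothing but its size.\<close>

lemma blank_picture_in_language:
  assumes "free_fo \<phi> = {}" "free_set \<phi> = {}" "m \<ge> 1" "n \<ge> 1"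
  shows "mat m n (\<lambda>_ _. undefined) \<in> language {} \<phi> \<longleftrightarrow> sat (grid m n) (\<lambda>_. (1, 1)) (\<lambda>_. {}) \<phi>"
proof -
  have "mat m n (\<lambda>_ _. undefined) \<in> pictures (alphabet {})"
    using assms(3,4) by (auto simp: pictures_def alphabet_def elements_mat_def)
  moreover have "assignment (grid m n) (\<lambda>_. (1, 1)) (\<lambda>_. {})"
    using assms(3,4) by (simp add: assignment_def grid_def)
  moreover have "sat (grid m n) e E \<phi> \<longleftrightarrow> sat (grid m n) (\<lambda>_. (1, 1)) (\<lambda>_. {}) \<phi>" for e E
    by (rule sat_cong) (simp_all add: assms(1,2))
  ultimately show ?thesis by (auto simp: language_def pic_dom_def)
qed

text \<open>Periodicity beyond \<open>T\<close> turns one satisfying width above \<open>T\<close>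
  into arbitrarily large ones, against the bound.\<close>

lemma segmented_not_FO_Sigma_mon:
  assumes \<psi>: "\<psi> \<in> FO_closure (Sigma_mon k)"
    and eq: "\<And>m n. m \<ge> 1 \<Longrightarrow> n \<ge> 1 \<Longrightarrow>
      sat (grid m n) (\<lambda>_. (1, 1)) (\<lambda>_. {}) \<psi> \<longleftrightarrow> sat (grid m n) (\<lambda>_. (1, 1)) (\<lambda>_. {}) (segmented_fm (Suc k))"
  shows False
proof -
  let ?sat = "\<lambda>m n. sat (grid m n) (\<lambda>_. (1, 1)) (\<lambda>_. {}) \<psi>"
  obtain c where c: "c \<ge> 1" and per: "\<And>m. m \<ge> 1 \<Longrightarrow> \<exists>T p. 1 \<le> p \<and> T \<le> tower k (c * m) \<and>
       (\<forall>n>T. ?sat m n \<longleftrightarrow> ?sat m (n + p))"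
    by (rule FO_Sigma_mon_periodic[OF \<psi>]) blast
  \<comment> \<open>Any \<open>m\<close> with \<open>c * m < 2 ^ m\<close> would serve.\<close>
  define m where "m = 2 * c"
  have m: "m \<ge> 1" using c by (simp add: m_def)
  have "c * m < 2 ^ m"
  proof -
    have "2 * c \<le> 2 ^ c" using c by (induction c rule: dec_induct) auto
    then have "c * (2 * c) < 2 ^ c * 2 ^ c" using less_exp[of c] c by (intro mult_less_le_imp_less) auto
    then show ?thesis by (simp add: m_def power_add[symmetric] mult_2)
  qed
  obtain T p where p: "1 \<le> p" and T: "T \<le> tower k (c * m)"
    and pT: "\<And>n. T < n \<Longrightarrow> ?sat m n \<longleftrightarrow> ?sat m (n + p)"
    using per[OF m] by blast
  define n0 where "n0 = segment_length m (Suc (Suc k))"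
  have "T < n0"
  proof -
    note T
    also have "tower k (c * m) < tower k (2 ^ m)" by (rule tower_strict) fact
    also have "\<dots> = tower (Suc k) m" by (rule tower_Suc_arg[symmetric])
    also have "\<dots> \<le> n0" unfolding n0_def by (rule segment_length_ge[OF m])
    finally show ?thesis .
  qed
  have n0: "n0 \<ge> 1" unfolding n0_def using segment_length_pos[OF m, of "Suc (Suc k)"] by simp
  have sat: "?sat m (n0 + q * p)" for q
  proof (induction q)
    case 0
    show ?case using eq[OF m n0] segmented_exists[OF m] by (simp add: n0_def)
  next
    case (Suc q)
    then show ?case using pT[of "n0 + q * p"] \<open>T < n0\<close> by (simp add: algebra_simps)
  qed
  \<comment> \<open>The bound itself is taken as the number of periods: \<open>n0 + q * p\<close>
    exceeds \<open>q\<close> because \<open>n0\<close> and \<open>p\<close> are positive.\<close>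
  define q where "q = segment_bound m (Suc (Suc k))"
  have "n0 + q * p \<le> q"
    unfolding q_def
    by (rule segmented_bounded[OF iffD1[OF eq sat]]) (use m n0 in auto)
  moreover have "q \<le> q * p" using p by simp
  ultimately show False using n0 by linarith
qed

theorem corollary2p12:
  fixes k :: nat
  assumes "k \<ge> 1"
  shows "\<exists>J L. finite J \<and> L \<subseteq> pictures (alphabet J) \<and>
           definable J (Sigma1_closure (FO_closure (Sigma_mon 1))) L \<and>
           \<not> definable J (FO_closure (Sigma_mon k)) L"
proof -
  let ?\<phi> = "segmented_fm (Suc k)"
  have "definable {} (Sigma1_closure (FO_closure (Sigma_mon 1))) (language {} ?\<phi>)"
    unfolding definable_def
    by (rule bexI[of _ ?\<phi>])
      (use segmented_fm_in_closure in \<open>auto simp: free_segmented_fm upto_equiv_def equivalent_def\<close>)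
  moreover have "\<not> definable {} (FO_closure (Sigma_mon k)) (language {} ?\<phi>)"
  proof
    assume "definable {} (FO_closure (Sigma_mon k)) (language {} ?\<phi>)"
    then obtain \<phi> \<psi> where \<psi>: "\<psi> \<in> FO_closure (Sigma_mon k)" and equiv: "equivalent \<phi> \<psi>"
      and free: "free_fo \<phi> = {}" "free_set \<phi> = {}" and lang: "language {} ?\<phi> = language {} \<phi>"
      unfolding definable_def upto_equiv_def by auto
    show False
    proof (rule segmented_not_FO_Sigma_mon[OF \<psi>])
      fix m n :: nat assume mn: "m \<ge> 1" "n \<ge> 1"
      have "assignment (grid m n) (\<lambda>_. (1, 1)) (\<lambda>_. {})" using mn by (simp add: assignment_def grid_def)
      then have "sat (grid m n) (\<lambda>_. (1, 1)) (\<lambda>_. {}) \<psi> \<longleftrightarrow> sat (grid m n) (\<lambda>_. (1, 1)) (\<lambda>_. {}) \<phi>"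
        using equiv mn unfolding equivalent_def by blast
      also have "\<dots> \<longleftrightarrow> sat (grid m n) (\<lambda>_. (1, 1)) (\<lambda>_. {}) ?\<phi>"
        using blank_picture_in_language[OF free mn] blank_picture_in_language[OF free_segmented_fm mn] lang by blast
      finally show "sat (grid m n) (\<lambda>_. (1, 1)) (\<lambda>_. {}) \<psi> \<longleftrightarrow> sat (grid m n) (\<lambda>_. (1, 1)) (\<lambda>_. {}) ?\<phi>" .
    qed
  qed
  moreover have "language {} ?\<phi> \<subseteq> pictures (alphabet {})" by (auto simp: language_def)
  ultimately show ?thesis by blast
qed

end
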